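(* Let $m\ge1$ and $k\ge2$ be integers and $p$ a prime with $p\nmid k$. If the polynomial $\widetilde{\Delta}_{mk,m}(C)=\Delta_{mk,m}(C/4)\in\mathbb{Z}[C]$ is irreducible over $\mathbb{F}_p$ (after reduction mod $p$), then $\Delta_{mkp^e,m}$ is irreducible over $\mathbb{Q}$ for every integer $e\ge1$.
   Context: Let $f_c(z)=z^2+c$, with iterates $f_c^{\circ 0}(z)=z$, $f_c^{\circ j}=f_c\circ f_c^{\circ(j-1)}$. For $n\ge1$ let $\Phi_n^*(z,c)=\prod_{j\mid n}(f_c^{\circ j}(z)-z)^{\mu(n/j)}$, and let $\delta_n(x,c)$ be the polynomial, monic in $x$, with $\delta_n(x,c)^n=\operatorname{Res}_z(\Phi_n^*(z,c),x-(f_c^{\circ n})'(z))$. It is known that $\delta_n\in\mathbb{Z}[x,4c]$ and is monic in $4c$. Let $\Psi_j$ be the $j$-th cyclotomic polynomial. For $m\mid n$, $m<n$, set $\Delta_{n,m}(c)=\operatorname{Res}_x(\Psi_{n/m}(x),\delta_m(x,c))$. Then $\widetilde{\Delta}_{n,m}(C):=\Delta_{n,m}(C/4)$ is a monic polynomial in $\mathbb{Z}[C]$. *)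

theory Defs
  imports "Subresultants.Resultant_Prelim" "Berlekamp_Zassenhaus.Finite_Field"
    "HOL-Computational_Algebra.Squarefree"
begin

definition moebius :: "nat \<Rightarrow> int" where
  "moebius n = (if n = 0 then 0 else if squarefree n then (-1) ^ card (prime_factors n) else 0)"

text \<open>Exact Moebius-product of polynomials: prod_{j | n} (g j)^(mu(n/j)),
  computed as (product over mu = 1) div (product over mu = -1) in an integral domain with exact division.\<close>
definition moebius_prod :: "nat \<Rightarrow> (nat \<Rightarrow> 'a :: idom_divide) \<Rightarrow> 'a" where
  "moebius_prod n g =
     (\<Prod>j\<in>{j. j dvd n \<and> moebius (n div j) = 1}. g j) div
     (\<Prod>j\<in>{j. j dvd n \<and> moebius (n div j) = -1}. g j)"

definition cyclotomic :: "nat \<Rightarrow> rat poly" where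
  "cyclotomic j = moebius_prod j (\<lambda>d. Polynomial.monom 1 d - 1)"

text \<open>Variables: c innermost, x in the middle, z outermost.
  Type rat poly poly = Q[c][x];  (rat poly poly) poly = Q[c][x][z].\<close>

definition cvar :: "rat poly poly" where "cvar = [:[:0, 1:]:]"
definition xvar :: "rat poly poly" where "xvar = [:0, 1:]"

definition fpoly :: "rat poly poly poly" where "fpoly = [:cvar, 0, 1:]"

definition fiter :: "nat \<Rightarrow> rat poly poly poly" where
  "fiter j = ((\<lambda>q. pcompose fpoly q) ^^ j) [:0, 1:]"

definition dynatomic :: "nat \<Rightarrow> rat poly poly poly" where
  "dynatomic n = moebius_prod n (\<lambda>j. fiter j - [:0, 1:])"

definition delta :: "nat \<Rightarrow> rat poly poly" where
  "delta n = (THE d. lead_coeff d = 1 \<and>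
      d ^ n = resultant (dynatomic n) ([:xvar:] - pderiv (fiter n)))"

definition Delta :: "nat \<Rightarrow> nat \<Rightarrow> rat poly" where
  "Delta n m = resultant (map_poly (\<lambda>a. [:a:]) (cyclotomic (n div m))) (delta m)"

definition Delta_tilde :: "nat \<Rightarrow> nat \<Rightarrow> rat poly" where
  "Delta_tilde n m = pcompose (Delta n m) [:0, 1/4:]"

end

(* Put C = 4c and A(x, C) = delta_m(x, C/4). Doubling a periodic point turns z -> z^2 + c into the
   relation u_i^2 = 2 u_{i+1} - C, which makes all multipliers integral over Z[C]; letting C tend to
   infinity, where |u_i| ~ |C|^(1/2), shows that up to sign A is monic in C of degree d, with lower
   coefficients in Z[x].

   Let z be a primitive root of unity of order n = k p^e and A(z, t) = 0. Write z = z' y with z' of order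
   k and y of order p^e, pi = 1 - y and N = phi(p^e), so that p is pi^N times an algebraic integer.
   Since A(z', t) - A(z, t) is divisible by pi, so is the value of the given polynomial P at t. As P is
   irreducible mod p, of degree D = phi(k) d, this forces the products pi^i t^j (i < N, j < D) to be
   independent over Q, whence by counting dimensions z^i t^j (i < phi(n), j < d) are independent too.
   So any rational polynomial vanishing at t is divisible by A(w, C) for every primitive n-th root of
   unity w. These divisors are pairwise coprime: two of them with a common root would have to be equal,
   which is excluded at C = 0, where A(x, 0) = (x - 2^m)^nu for m >= 2 and x(x - 2) for m = 1. Hence a
   rational polynomial sharing a root with Delta has at least its degree. *)
theory Submission
  imports Defs "Subresultants.Subresultant" "Jordan_Normal_Form.Char_Poly"
    "HOL-Computational_Algebra.Fundamental_Theorem_Algebra" "HOL-Computational_Algebra.Field_as_Ring"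
    "HOL-Number_Theory.Cong" "HOL-Analysis.Complex_Transcendental" "HOL-Real_Asymp.Real_Asymp"
begin

hide_const (open) Complex_Transcendental.moebius
hide_fact (open) Complex_Transcendental.moebius_def

section \<open>Algebraic integers\<close>

text \<open>The heart is a ramification count: p has ramification index N in the field of y,
  irreducibility mod p forces residue degree at least D, and N D = phi(n) d is already the largest
  degree that z and t could generate. Number rings and ideals are replaced by algebraic integers in
  C. All that is kept of a prime above p is that pi has no algebraic integer inverse and that p is a
  multiple of pi^N. A rational relation is scaled to integer coefficients, which then turn out
  divisible by every power of p. The other obstacle is \<open>delta\<close>, a definite description
  built from a resultant and exact divisions. Its factorization over cycles is available only one
  parameter at a time, because representatives of cycles do not vary polynomially in c. Hence
  identities are checked at the infinitely many parameters where periodic points are simple and then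
  lifted to Q[c]. The arithmetic of \<open>delta\<close> also comes from values: integrality of
  coefficients from values at algebraic integers C, averaged over roots of unity; the leading term
  in C from growth along C = t^2 with t real.\<close>

lemma algebraic_int_if_finite_span:
  fixes z :: "'a :: field_char_0" and B :: "'a set"
  assumes fin: "finite B" and one: "1 \<in> B"
    and closed: "\<And>b. b \<in> B \<Longrightarrow> \<exists>f. z * b = (\<Sum>b'\<in>B. of_int (f b') * b')"
  shows "algebraic_int z"
proof -
  from finite_distinct_list[OF fin] obtain bs where bs: "set bs = B" "distinct bs" by blast
  define n where "n = length bs"
  from closed obtain f where f: "\<And>b. b \<in> B \<Longrightarrow> z * b = (\<Sum>b'\<in>B. of_int (f b b') * b')"
    by metis
  define M :: "int mat" where "M = Matrix.mat n n (\<lambda>(i,j). f (bs ! i) (bs ! j))"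
  define v where "v = Matrix.vec n (\<lambda>i. bs ! i)"
  have M: "M \<in> carrier_mat n n" by (simp add: M_def)
  have M': "map_mat of_int M \<in> carrier_mat n n" using M by simp
  have sumB: "(\<Sum>b'\<in>B. g b') = (\<Sum>j<n. g (bs ! j))" for g :: "'a \<Rightarrow> 'a"
    unfolding bs(1)[symmetric] sum.distinct_set_conv_list[OF bs(2)] n_def
    by (simp add: sum_list_sum_nth atLeast0LessThan)
  \<comment> \<open>With B listed as a vector, multiplication by z becomes an integer matrix having
    z as eigenvalue, so z is a root of its monic integer characteristic polynomial. The entry 1 of B
    keeps the eigenvector nonzero.\<close>
  have "map_mat of_int M *\<^sub>v v = z \<cdot>\<^sub>v v"
  proof (rule eq_vecI)
    fix i assume i: "i < dim_vec (z \<cdot>\<^sub>v v)"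
    hence i: "i < n" by (simp add: v_def)
    have "bs ! i \<in> B" using i bs n_def by auto
    from f[OF this] have "z * bs ! i = (\<Sum>j<n. of_int (f (bs!i) (bs!j)) * bs ! j)" using sumB by simp
    thus "(map_mat of_int M *\<^sub>v v) $ i = (z \<cdot>\<^sub>v v) $ i" using i
      by (simp add: M_def v_def scalar_prod_def atLeast0LessThan)
  qed (simp add: v_def M_def)
  moreover have "v \<noteq> 0\<^sub>v n"
  proof
    assume v0: "v = 0\<^sub>v n"
    from one bs obtain i where i: "i < n" "bs ! i = 1" unfolding n_def by (auto simp: in_set_conv_nth)
    have "v $ i = 1" using i by (simp add: v_def)
    thus False using v0 i by simp
  qed
  ultimately have "eigenvalue (map_mat of_int M) z"
    unfolding eigenvalue_def eigenvector_def using M' by (intro exI[of _ v]) (auto simp: v_def)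
  hence "poly (char_poly (map_mat of_int M)) z = 0"
    using eigenvalue_root_char_poly[OF M', of z] by blast
  moreover have "char_poly (map_mat (of_int :: int \<Rightarrow> 'a) M) = map_poly of_int (char_poly M)"
    by (rule of_int_hom.char_poly_hom[OF M])
  ultimately have "poly (map_poly of_int (char_poly M)) z = 0" by simp
  moreover have "lead_coeff (char_poly M) = 1" using degree_monic_char_poly[OF M] by simp
  ultimately show ?thesis unfolding algebraic_int_altdef_ipoly by blast
qed

lemma algebraic_int_power_reduce:
  fixes x :: "'a :: field_char_0"
  assumes "algebraic_int x"
  obtains m f where "m > 0" "x ^ m = (\<Sum>i<m. of_int (f i) * x ^ i)"
proof -
  from assms obtain p :: "int poly" where p: "poly (map_poly of_int p) x = 0" "lead_coeff p = 1"
    unfolding algebraic_int_altdef_ipoly by blast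
  define m where "m = degree p"
  have "m > 0"
  proof (rule ccontr)
    assume "\<not> m > 0"
    then obtain a where "p = [:a:]" unfolding m_def by (auto elim: degree_eq_zeroE)
    with p show False by auto
  qed
  have "0 = (\<Sum>i\<le>m. of_int (Polynomial.coeff p i) * x ^ i)"
    using p(1) by (simp add: poly_altdef m_def degree_map_poly coeff_map_poly)
  also have "\<dots> = (\<Sum>i<m. of_int (Polynomial.coeff p i) * x ^ i) + x ^ m"
    using p(2) by (simp add: lessThan_Suc_atMost[symmetric] m_def)
  finally have "x ^ m = - (\<Sum>i<m. of_int (Polynomial.coeff p i) * x ^ i)"
    by (metis add.commute eq_neg_iff_add_eq_0)
  hence "x ^ m = (\<Sum>i<m. of_int (- Polynomial.coeff p i) * x ^ i)" by (simp add: sum_negf)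
  thus ?thesis by (rule that[OF \<open>m > 0\<close>])
qed

text \<open>Generated term by term, so that the closure properties are plain inductions; finiteness
  of B enters only when coefficients are read off in \<open>int_span_finite\<close>.\<close>

inductive_set int_span :: "'a :: ring_1 set \<Rightarrow> 'a set" for B where
  zero: "0 \<in> int_span B"
| add: "x \<in> int_span B \<Longrightarrow> b \<in> B \<Longrightarrow> x + of_int a * b \<in> int_span B"

lemma int_span_finite:
  assumes "x \<in> int_span B" "finite B"
  shows "\<exists>f. x = (\<Sum>b\<in>B. of_int (f b) * b)"
  using assms(1)
proof induction
  case zero
  show ?case by (intro exI[of _ "\<lambda>_. 0"]) simp
next
  case (add x b a)
  then obtain f where f: "x = (\<Sum>b\<in>B. of_int (f b) * b)" by auto
  have "x + of_int a * b = (\<Sum>c\<in>B. of_int (f c) * c) + (\<Sum>c\<in>B. if c = b then of_int a * b else 0)"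
    using add.hyps assms(2) f by (simp add: sum.delta)
  also have "\<dots> = (\<Sum>c\<in>B. of_int (f c + (if c = b then a else 0)) * c)"
    unfolding sum.distrib[symmetric] by (rule sum.cong) (auto simp: algebra_simps)
  finally show ?case by (intro exI)
qed

lemma int_span_add: "x \<in> int_span B \<Longrightarrow> y \<in> int_span B \<Longrightarrow> x + y \<in> int_span B"
proof (rotate_tac 1, induction y rule: int_span.induct)
  case (add y b a)
  from int_span.add[OF add.IH[OF add.prems] add.hyps(2), of a] show ?case by (simp add: add.assoc)
qed simp

lemma int_span_scale: "x \<in> int_span B \<Longrightarrow> of_int a * x \<in> int_span B"
proof (induction x rule: int_span.induct)
  case (add x b a')
  from int_span.add[OF add.IH add.hyps(2), of "a * a'"] show ?case by (simp add: distrib_left mult.assoc)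
qed (auto intro: int_span.zero)

lemma int_span_base: "b \<in> B \<Longrightarrow> b \<in> int_span B"
  using int_span.add[OF int_span.zero, of b B 1] by simp

lemma int_span_sum: "(\<And>i. i \<in> I \<Longrightarrow> g i \<in> int_span B) \<Longrightarrow> sum g I \<in> int_span B"
  by (induction I rule: infinite_finite_induct) (auto intro: int_span.zero int_span_add)

lemma int_span_mult:
  fixes z :: "'a :: comm_ring_1"
  assumes "x \<in> int_span B" "\<And>b. b \<in> B \<Longrightarrow> z * b \<in> int_span B"
  shows "z * x \<in> int_span B"
  using assms(1)
proof induction
  case (add x b a)
  have "z * x + of_int a * (z * b) \<in> int_span B"
    using add assms(2) int_span_scale int_span_add by blast
  thus ?case by (simp add: algebra_simps)
qed (auto intro: int_span.zero)

text \<open>The monomials x^i y^j with i < m and j < n span a finitely generated Z-module that is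
  stable under x and under y, because x^m and y^n reduce to lower powers; hence it is stable under x
  + y and x y.\<close>

lemma algebraic_int_add_mult:
  fixes x y :: "'a :: field_char_0"
  assumes "algebraic_int x" "algebraic_int y"
  shows "algebraic_int (x + y)" "algebraic_int (x * y)"
proof -
  from algebraic_int_power_reduce[OF assms(1)] obtain m f where m: "m > 0" "x ^ m = (\<Sum>i<m. of_int (f i) * x ^ i)" .
  from algebraic_int_power_reduce[OF assms(2)] obtain n g where n: "n > 0" "y ^ n = (\<Sum>i<n. of_int (g i) * y ^ i)" .
  define B where "B = (\<lambda>(i,j). x ^ i * y ^ j) ` ({..<m} \<times> {..<n})"
  have fin: "finite B" by (simp add: B_def)
  have one: "1 \<in> B" unfolding B_def using m n by (intro image_eqI[of _ _ "(0,0)"]) auto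
  have B: "x ^ i * y ^ j \<in> int_span B" if "i < m" "j < n" for i j
    by (rule int_span_base) (use that in \<open>auto simp: B_def\<close>)
  have x: "x * b \<in> int_span B" if "b \<in> B" for b
  proof -
    from that obtain i j where b: "b = x ^ i * y ^ j" "i < m" "j < n" by (auto simp: B_def)
    show ?thesis
    proof (cases "Suc i < m")
      case True
      thus ?thesis using B[of "Suc i" j] b by (simp add: mult.assoc)
    next
      case False
      hence "Suc i = m" using b by simp
      hence "x * b = (\<Sum>i<m. of_int (f i) * (x ^ i * y ^ j))"
        using m(2) b(1) by (simp add: mult.assoc[symmetric] sum_distrib_right flip: power_Suc)
      also have "\<dots> \<in> int_span B" by (intro int_span_sum int_span_scale B) (use b in auto)
      finally show ?thesis .
    qed
  qed
  have y: "y * b \<in> int_span B" if "b \<in> B" for b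
  proof -
    from that obtain i j where b: "b = x ^ i * y ^ j" "i < m" "j < n" by (auto simp: B_def)
    show ?thesis
    proof (cases "Suc j < n")
      case True
      thus ?thesis using B[of i "Suc j"] b by (simp add: algebra_simps)
    next
      case False
      hence "Suc j = n" using b by simp
      have "y * b = x ^ i * y ^ Suc j" using b by simp
      also have "\<dots> = (\<Sum>j<n. of_int (g j) * (x ^ i * y ^ j))"
        using n(2) \<open>Suc j = n\<close> by (simp add: sum_distrib_left algebra_simps del: power_Suc)
      also have "\<dots> \<in> int_span B" by (intro int_span_sum int_span_scale B) (use b in auto)
      finally show ?thesis .
    qed
  qed
  have "(x + y) * b \<in> int_span B" if "b \<in> B" for b
    using int_span_add[OF x[OF that] y[OF that]] by (simp add: distrib_right)
  thus "algebraic_int (x + y)"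
    by (intro algebraic_int_if_finite_span[OF fin one] int_span_finite[OF _ fin])
  have "x * y * b \<in> int_span B" if "b \<in> B" for b
    using int_span_mult[OF y[OF that] x] by (simp add: mult.assoc)
  thus "algebraic_int (x * y)"
    by (intro algebraic_int_if_finite_span[OF fin one] int_span_finite[OF _ fin])
qed

lemma algebraic_int_sum:
  "(\<And>i. i \<in> I \<Longrightarrow> algebraic_int (g i :: 'a :: field_char_0)) \<Longrightarrow> algebraic_int (sum g I)"
  by (induction I rule: infinite_finite_induct) (auto intro: algebraic_int_add_mult)

lemma algebraic_int_prod:
  "(\<And>i. i \<in> I \<Longrightarrow> algebraic_int (g i :: 'a :: field_char_0)) \<Longrightarrow> algebraic_int (prod g I)"
  by (induction I rule: infinite_finite_induct) (auto intro: algebraic_int_add_mult)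

lemma algebraic_int_power: "algebraic_int (x :: 'a :: field_char_0) \<Longrightarrow> algebraic_int (x ^ n)"
  by (induction n) (auto intro: algebraic_int_add_mult)

lemma algebraic_int_diff:
  "algebraic_int (x :: 'a :: field_char_0) \<Longrightarrow> algebraic_int y \<Longrightarrow> algebraic_int (x - y)"
  using algebraic_int_add_mult(1)[of x "- y"] by simp

lemmas algebraic_int_ring_intros =
  algebraic_int_add_mult algebraic_int_diff algebraic_int_sum algebraic_int_prod algebraic_int_power

section \<open>Resultants as products over roots\<close>

text \<open>One Euclidean step for resultants, the engine of \<open>resultant_root_prods\<close>. A
  constant H has its own branch: there the index 0 equals the degree of H, and the subresultant is
  given as a scalar multiple of H itself.\<close>

lemma resultant_reduce:
  fixes F B G H :: "'a :: idom poly"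
  assumes eq: "F + B * G = H" and le: "degree G \<le> degree F" and lt: "degree H < degree G" and H: "H \<noteq> 0"
  shows "resultant F G = (-1) ^ (degree F * degree G) * lead_coeff G ^ (degree F - degree H) * resultant G H"
proof (cases "degree H = 0")
  case False
  with BT_lemma_1_12[OF eq le disjI1[OF lt], of 0] show ?thesis
    by (simp add: subresultant_resultant mult.assoc)
next
  case True
  then obtain h where h: "H = [:h:]" by (auto elim: degree_eq_zeroE)
  have "subresultant 0 F G = Polynomial.smult ((-1) ^ (degree F * degree G) * lead_coeff G ^ degree F * h ^ (degree G - 1)) H"
    using BT_lemma_1_13[OF eq le disjI1[OF lt]] True H lt h by auto
  moreover have "h ^ (degree G - 1) * h = h ^ degree G" using lt by (cases "degree G") auto
  ultimately show ?thesis using h True by (simp add: subresultant_resultant mult.assoc)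
qed

lemma prod_mset_swap_mult:
  "(\<Prod>x\<in>#A. \<Prod>y\<in>#B. f x y :: 'a :: comm_monoid_mult) = (\<Prod>y\<in>#B. \<Prod>x\<in>#A. f x y)"
  by (induction A) (auto simp: prod_mset.distrib)

lemma prod_mset_const: "(\<Prod>x\<in>#A. c :: 'a :: comm_monoid_mult) = c ^ size A"
  by (induction A) auto

lemma poly_prod_mset: "poly (prod_mset (image_mset f A)) x = (\<Prod>a\<in>#A. poly (f a) (x :: 'a :: comm_ring_1))"
  by (induction A) auto

definition root_prod :: "'a :: comm_ring_1 multiset \<Rightarrow> 'a poly" where
  "root_prod A = (\<Prod>x\<in>#A. [:- x, 1:])"

lemma poly_root_prod: "poly (root_prod A) y = (\<Prod>x\<in>#A. y - x)"
  by (simp add: root_prod_def poly_prod_mset)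

lemma monic_root_prod: "lead_coeff (root_prod A) = (1 :: 'a :: idom)"
  by (induction A) (auto simp: root_prod_def lead_coeff_mult simp del: mult_pCons_left)

lemma root_prod_nonzero: "root_prod A \<noteq> (0 :: 'a :: idom poly)"
  using monic_root_prod[of A] by auto

lemma degree_root_prod: "degree (root_prod A :: 'a :: idom poly) = size A"
proof (induction A)
  case (add x A)
  have "degree ([:- x, 1:] * root_prod A) = 1 + degree (root_prod A)"
    by (subst degree_mult_eq) (auto simp: root_prod_nonzero)
  thus ?case using add by (simp add: root_prod_def del: mult_pCons_left)
qed (simp add: root_prod_def)

lemma root_factorization:
  fixes f :: "'a :: alg_closed_field poly"
  assumes "f \<noteq> 0"
  obtains A where "f = Polynomial.smult (lead_coeff f) (root_prod A)"
  using alg_closed_imp_factorization[OF assms] unfolding root_prod_def by blast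

text \<open>The right-hand side depends on the first polynomial only through its values at the roots
  of the second, and these do not change when F is replaced by F mod G. So induction on the total
  number of roots follows the Euclidean algorithm; \<open>main\<close> treats deg G <= deg F, the
  other case is obtained by swapping and tracking the sign.\<close>

lemma resultant_root_prods:
  fixes a b :: "'a :: alg_closed_field"
  assumes "a \<noteq> 0" "b \<noteq> 0"
  shows "resultant (Polynomial.smult a (root_prod A)) (Polynomial.smult b (root_prod B))
    = a ^ size B * b ^ size A * (\<Prod>x\<in>#A. \<Prod>y\<in>#B. x - y)"
  using assms
proof (induction "size A + size B" arbitrary: A B a b rule: less_induct)
  case less
  have main: "resultant (Polynomial.smult a (root_prod A)) (Polynomial.smult b (root_prod B))
    = a ^ size B * b ^ size A * (\<Prod>x\<in>#A. \<Prod>y\<in>#B. x - y)"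
    if IH: "\<And>A' B' a' (b' :: 'a). size A' + size B' < size A + size B \<Longrightarrow> a' \<noteq> 0 \<Longrightarrow> b' \<noteq> 0 \<Longrightarrow>
       resultant (Polynomial.smult a' (root_prod A')) (Polynomial.smult b' (root_prod B'))
       = a' ^ size B' * b' ^ size A' * (\<Prod>x\<in>#A'. \<Prod>y\<in>#B'. x - y)"
      and ab: "a \<noteq> 0" "b \<noteq> 0" and le: "size B \<le> size A" for A B :: "'a multiset" and a b :: 'a
  proof (cases "size B = 0")
    case True
    hence "B = {#}" by simp
    thus ?thesis using ab by (simp add: root_prod_def[of "{#}"] prod_mset_const degree_root_prod flip: pCons_one)
  next
    case False
    define F where "F = Polynomial.smult a (root_prod A)"
    define G where "G = Polynomial.smult b (root_prod B)"
    have dF: "degree F = size A" and dG: "degree G = size B"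
      using ab by (simp_all add: F_def G_def degree_root_prod)
    have lG: "lead_coeff G = b" using monic_root_prod[of B] by (simp add: G_def)
    have G0: "G \<noteq> 0" using ab root_prod_nonzero by (simp add: G_def)
    define H where "H = F mod G"
    have eq: "F + (- (F div G)) * G = H" by (simp add: H_def minus_div_mult_eq_mod)
    have polyF: "poly F y = a * (\<Prod>x\<in>#A. y - x)" for y by (simp add: F_def poly_root_prod)
    have HF: "poly H y = poly F y" if "y \<in># B" for y
    proof -
      have "poly G y = 0" using that by (auto simp: G_def poly_root_prod prod_mset_zero_iff)
      thus ?thesis by (simp flip: eq)
    qed
    have sw: "(\<Prod>y\<in>#B. poly F y) = a ^ size B * ((-1) ^ (size A * size B)) * (\<Prod>x\<in>#A. \<Prod>y\<in>#B. x - y)"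
    proof -
      have "(\<Prod>y\<in>#B. poly F y) = a ^ size B * (\<Prod>y\<in>#B. \<Prod>x\<in>#A. y - x)"
        by (simp add: polyF prod_mset.distrib prod_mset_const)
      also have "(\<Prod>y\<in>#B. \<Prod>x\<in>#A. y - x) = (\<Prod>y\<in>#B. \<Prod>x\<in>#A. (-1) * (x - y))" by simp
      also have "\<dots> = (-1) ^ (size A * size B) * (\<Prod>y\<in>#B. \<Prod>x\<in>#A. (x - y))"
        by (simp only: prod_mset.distrib prod_mset_const power_mult)
      finally show ?thesis by (simp add: prod_mset_swap_mult[of _ A B] mult.assoc)
    qed
    show ?thesis
    proof (cases "H = 0")
      case True
      from False obtain y where y: "y \<in># B" by (metis multiset_nonemptyE size_empty)
      hence "poly F y = 0" using HF[OF y] True by simp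
      hence "y \<in># A" using ab by (auto simp: polyF prod_mset_zero_iff)
      hence "(\<Prod>x\<in>#A. \<Prod>y\<in>#B. x - y) = 0" using y
        by (auto simp: prod_mset_zero_iff image_iff intro!: bexI[of _ y])
      moreover have "resultant F G = 0"
      proof -
        have "F = (F div G) * G" using True H_def by (metis add.right_neutral div_mult_mod_eq)
        from subresultant_product[OF this, of 0] show ?thesis using le dF dG False
          by (simp add: subresultant_resultant)
      qed
      ultimately show ?thesis by (simp add: F_def G_def)
    next
      case H0: False
      have lt: "degree H < degree G" using False dG H0 degree_mod_less'[OF G0, of F] unfolding H_def by auto
      obtain E where E: "H = Polynomial.smult (lead_coeff H) (root_prod E)"
        using root_factorization[OF H0] .
      define h where "h = lead_coeff H"
      have h0: "h \<noteq> 0" using H0 h_def by simp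
      have "degree H = degree (Polynomial.smult h (root_prod E))" using E h_def by simp
      hence dH: "degree H = size E" using h0 by (simp add: degree_root_prod)
      have polyH: "poly H y = h * (\<Prod>x\<in>#E. y - x)" for y
        using arg_cong[OF E, of "\<lambda>p. poly p y"] by (simp add: h_def poly_root_prod)
      have "resultant G H = b ^ size E * h ^ size B * (\<Prod>y\<in>#B. \<Prod>x\<in>#E. y - x)"
        using IH[of B E b h] lt le dG dH ab h0 E h_def by (simp add: G_def)
      also have "\<dots> = b ^ size E * (\<Prod>y\<in>#B. poly H y)" by (simp add: polyH prod_mset.distrib prod_mset_const)
      also have "(\<Prod>y\<in>#B. poly H y) = (\<Prod>y\<in>#B. poly F y)"
        by (rule arg_cong[of _ _ prod_mset]) (auto intro!: image_mset_cong HF)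
      finally have GH: "resultant G H = b ^ size E * (\<Prod>y\<in>#B. poly F y)" .
      have "resultant F G = (-1) ^ (size A * size B) * (b ^ (size A - size E) * b ^ size E) * (\<Prod>y\<in>#B. poly F y)"
        using resultant_reduce[OF eq _ lt H0] le dF dG dH lG GH by (simp add: mult.assoc)
      also have "b ^ (size A - size E) * b ^ size E = b ^ size A" using lt le dG dH by (simp flip: power_add)
      finally have "resultant F G = ((-1) ^ (size A * size B) * (-1) ^ (size A * size B)) *
          (a ^ size B * b ^ size A * (\<Prod>x\<in>#A. \<Prod>y\<in>#B. x - y))"
        by (simp only: sw mult_ac)
      also have "((-1) ^ (size A * size B) * (-1) ^ (size A * size B) :: 'a) = 1"
        by (simp flip: power_mult_distrib)
      finally show ?thesis by (simp add: F_def G_def)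
    qed
  qed
  show ?case
  proof (cases "size B \<le> size A")
    case True
    show ?thesis by (rule main[OF less.hyps less.prems True])
  next
    case False
    have "resultant (Polynomial.smult b (root_prod B)) (Polynomial.smult a (root_prod A))
      = b ^ size A * a ^ size B * (\<Prod>x\<in>#B. \<Prod>y\<in>#A. x - y)"
      by (rule main) (use False less in \<open>auto simp: add.commute\<close>)
    also have "(\<Prod>x\<in>#B. \<Prod>y\<in>#A. x - y) = (\<Prod>y\<in>#A. \<Prod>x\<in>#B. (-1) * (y - x))"
      by (simp add: prod_mset_swap_mult[of _ A B])
    also have "\<dots> = (-1) ^ (size A * size B) * (\<Prod>y\<in>#A. \<Prod>x\<in>#B. y - x)"
      by (simp only: prod_mset.distrib prod_mset_const power_mult mult.commute[of "size A"])
    finally have "resultant (Polynomial.smult b (root_prod B)) (Polynomial.smult a (root_prod A))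
      = b ^ size A * a ^ size B * ((-1) ^ (size A * size B) * (\<Prod>y\<in>#A. \<Prod>x\<in>#B. y - x))" .
    hence "resultant (Polynomial.smult a (root_prod A)) (Polynomial.smult b (root_prod B))
      = ((-1) ^ (size A * size B) * (-1) ^ (size A * size B)) *
          (a ^ size B * b ^ size A * (\<Prod>x\<in>#A. \<Prod>y\<in>#B. x - y))"
      using resultant_swap[of "Polynomial.smult a (root_prod A)" "Polynomial.smult b (root_prod B)"] less.prems
      by (simp add: degree_root_prod mult_ac)
    also have "((-1) ^ (size A * size B) * (-1) ^ (size A * size B) :: 'a) = 1"
      by (simp flip: power_mult_distrib)
    finally show ?thesis by simp
  qed
qed

lemma resultant_root_prod:
  fixes g :: "'a :: alg_closed_field poly"
  shows "resultant (root_prod A) g = (\<Prod>x\<in>#A. poly g x)"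
proof (cases "g = 0")
  case True
  thus ?thesis by (cases "A = {#}")
      (auto simp: degree_root_prod nonempty_has_size prod_mset_const root_prod_def[of "{#}"])
next
  case False
  then obtain B where B: "g = Polynomial.smult (lead_coeff g) (root_prod B)" using root_factorization by blast
  define b where "b = lead_coeff g"
  have b0: "b \<noteq> 0" using False by (simp add: b_def)
  have g: "g = Polynomial.smult b (root_prod B)" using B b_def by simp
  show ?thesis using resultant_root_prods[of 1 b A B] b0
    by (simp add: g poly_root_prod prod_mset.distrib prod_mset_const)
qed

section \<open>Moebius products and cyclotomic polynomials\<close>

lemma moebius_times_prime:
  assumes q: "prime q" and nd: "\<not> q dvd d" and d: "squarefree d" "d > 0"
  shows "moebius (q * d) = - moebius d"
proof -
  have cop: "coprime q d" using q nd by (simp add: prime_imp_coprime)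
  have "squarefree (q * d)" using cop d q by (simp add: squarefree_mult_coprime squarefree_prime)
  moreover have "prime_factors (q * d) = insert q (prime_factors d)"
    using q d by (subst prime_factors_product) (auto simp: prime_factorization_prime)
  moreover have "q \<notin> prime_factors d" using nd by (auto simp: prime_factors_dvd)
  moreover have "q * d > 0" using q d by (simp add: prime_gt_0_nat)
  ultimately show ?thesis using d by (simp add: moebius_def)
qed

text \<open>For a prime q dividing n, squarefree divisors d prime to q are paired with q d, and the
  two signs cancel.\<close>

lemma sum_moebius_divisors:
  assumes "n > 0"
  shows "(\<Sum>d | d dvd n. moebius d) = (if n = 1 then 1 else 0)"
proof (cases "n = 1")
  case True
  thus ?thesis by (simp add: moebius_def)
next
  case False
  then obtain q where q: "prime q" "q dvd n" using prime_factor_nat by blast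
  have fin: "finite {d. d dvd n}" using assms by simp
  define S0 where "S0 = {d. d dvd n \<and> squarefree d \<and> \<not> q dvd d}"
  define S1 where "S1 = {d. d dvd n \<and> squarefree d \<and> q dvd d}"
  have f: "finite S0" "finite S1" "S0 \<inter> S1 = {}"
    unfolding S0_def S1_def by (auto intro: finite_subset[OF _ fin])
  have pos: "d > 0" if "d \<in> S0" for d using that assms by (auto simp: S0_def intro!: Nat.gr0I)
  have "(\<Sum>d | d dvd n. moebius d) = (\<Sum>d \<in> S0 \<union> S1. moebius d)"
    by (rule sum.mono_neutral_right[OF fin]) (auto simp: S0_def S1_def moebius_def)
  also have "\<dots> = sum moebius S0 + sum moebius S1" by (rule sum.union_disjoint) (use f in auto)
  also have "sum moebius S1 = (\<Sum>d\<in>S0. moebius (q * d))"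
  proof (rule sum.reindex_bij_witness[of _ "\<lambda>d. q * d" "\<lambda>d. d div q"])
    fix d assume d: "d \<in> S1"
    then obtain e where e: "d = q * e" by (auto simp: S1_def)
    have q0: "q \<noteq> 0" using q by auto
    have "squarefree (q * e)" "q * e dvd n" using d e by (auto simp: S1_def)
    moreover have "\<not> q dvd e"
    proof
      assume "q dvd e"
      hence "q ^ 2 dvd q * e" by (simp add: power2_eq_square)
      with \<open>squarefree (q * e)\<close> have "q dvd 1" unfolding squarefree_def by blast
      with q show False by simp
    qed
    ultimately show "d div q \<in> S0" using e q0
      by (auto simp: S0_def intro: squarefree_mono[of e "q * e"] dvd_mult_right)
    show "q * (d div q) = d" using e q0 by simp
    show "moebius (q * (d div q)) = moebius d" using e q0 by simp
  next
    fix d assume d: "d \<in> S0"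
    have q0: "q \<noteq> 0" using q by auto
    have cop: "coprime q d" using d q by (simp add: S0_def prime_imp_coprime)
    show "q * d div q = d" using q0 by simp
    have "q * d dvd n" using cop d q by (simp add: S0_def divides_mult)
    moreover have "squarefree (q * d)"
      using cop d q by (simp add: S0_def squarefree_mult_coprime squarefree_prime)
    ultimately show "q * d \<in> S1" by (simp add: S1_def)
  qed
  also have "\<dots> = (\<Sum>d\<in>S0. - moebius d)"
    by (rule sum.cong[OF refl], rule moebius_times_prime) (use q pos in \<open>auto simp: S0_def\<close>)
  finally show ?thesis using False by (simp add: sum_negf)
qed

lemma sum_moebius_multiples:
  assumes n: "n > 0" and r: "r dvd n"
  shows "(\<Sum>j | j dvd n \<and> r dvd j. moebius (n div j)) = (if r = n then 1 else 0)"
proof -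
  from r obtain t where t: "n = r * t" by blast
  have pos: "r > 0" "t > 0" using n t by auto
  have "(\<Sum>j | j dvd n \<and> r dvd j. moebius (n div j)) = (\<Sum>d | d dvd t. moebius d)"
  proof (rule sum.reindex_bij_witness[of _ "\<lambda>d. r * (t div d)" "\<lambda>j. n div j"])
    fix j assume "j \<in> {j. j dvd n \<and> r dvd j}"
    then obtain i u where j: "j = r * i" and u: "n = j * u" by (auto elim!: dvdE)
    have tu: "t = i * u" using t u j pos by simp
    have ip: "i > 0" "u > 0" using tu pos by auto
    have nj: "n div j = u" using u j pos ip by simp
    show "r * (t div (n div j)) = j" "n div j \<in> {d. d dvd t}" "moebius (n div j) = moebius (n div j)"
      using nj tu ip j by simp_all
  next
    fix d assume "d \<in> {d. d dvd t}"
    then obtain u where u: "t = d * u" by auto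
    hence "u > 0" "d > 0" using pos by auto
    thus "n div (r * (t div d)) = d" "r * (t div d) \<in> {j. j dvd n \<and> r dvd j}"
      using u t pos by simp_all
  qed
  thus ?thesis using sum_moebius_divisors[OF pos(2)] pos t by auto
qed

lemma moebius_cases: "moebius n = 1 \<or> moebius n = -1 \<or> moebius n = 0"
  by (cases "even (card (prime_factors n))") (auto simp: moebius_def)

lemma card_moebius_multiples:
  assumes n: "n > 0" and r: "r dvd n"
  shows "card {j. j dvd n \<and> moebius (n div j) = 1 \<and> r dvd j}
    = card {j. j dvd n \<and> moebius (n div j) = -1 \<and> r dvd j} + (if r = n then 1 else 0)" (is "card ?P = card ?N + _")
proof -
  have fin: "finite {j. j dvd n}" using n by simp
  let ?A = "{j. j dvd n \<and> r dvd j}"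
  have f: "finite ?A" "finite ?P" "finite ?N" by (auto intro: finite_subset[OF _ fin])
  have "(\<Sum>j\<in>?A. moebius (n div j)) = (\<Sum>j\<in>?P \<union> ?N. moebius (n div j))"
    by (rule sum.mono_neutral_right[OF f(1)]) (use moebius_cases in auto)
  also have "\<dots> = (\<Sum>j\<in>?P. moebius (n div j)) + (\<Sum>j\<in>?N. moebius (n div j))"
    by (rule sum.union_disjoint) (use f in auto)
  also have "\<dots> = int (card ?P) - int (card ?N)" by simp
  finally show ?thesis using sum_moebius_multiples[OF n r] by (simp split: if_splits)
qed

text \<open>Moebius inversion with the denominator multiplied out, since exactness of the
  \<open>div\<close> in \<open>moebius_prod\<close> is not yet known at this point. By
  \<open>card_moebius_multiples\<close> each F z occurs equally often on both sides, except once
  more in the numerator when r z = n. It is applied with r the order of a root of unity and with r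
  the period of a point.\<close>

lemma moebius_prod_numerator:
  fixes F :: "'z \<Rightarrow> 'b :: comm_monoid_mult"
  assumes n: "n > 0" and Z: "finite Z" and r: "\<And>z. z \<in> Z \<Longrightarrow> r z dvd n"
    and g: "\<And>d. d dvd n \<Longrightarrow> g d = (\<Prod>z\<in>{z\<in>Z. r z dvd d}. F z)"
  shows "(\<Prod>j\<in>{j. j dvd n \<and> moebius (n div j) = 1}. g j)
    = (\<Prod>j\<in>{j. j dvd n \<and> moebius (n div j) = -1}. g j) * (\<Prod>z\<in>{z\<in>Z. r z = n}. F z)"
proof -
  have fin: "finite {j. j dvd n}" using n by simp
  have key: "(\<Prod>j\<in>{j. j dvd n \<and> moebius (n div j) = s}. g j)
     = (\<Prod>z\<in>Z. F z ^ card {j. j dvd n \<and> moebius (n div j) = s \<and> r z dvd j})" for s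
  proof -
    let ?J = "{j. j dvd n \<and> moebius (n div j) = s}"
    have J: "finite ?J" by (auto intro: finite_subset[OF _ fin])
    have "(\<Prod>j\<in>?J. g j) = (\<Prod>j\<in>?J. \<Prod>z\<in>{z\<in>Z. r z dvd j}. F z)"
      by (rule prod.cong) (auto simp: g)
    also have "\<dots> = (\<Prod>z\<in>Z. \<Prod>j\<in>{j\<in>?J. r z dvd j}. F z)"
      by (rule prod.swap_restrict[OF J Z])
    also have "\<dots> = (\<Prod>z\<in>Z. F z ^ card {j. j dvd n \<and> moebius (n div j) = s \<and> r z dvd j})"
      by (rule prod.cong) (auto simp: conj_assoc)
    finally show ?thesis .
  qed
  have "(\<Prod>j\<in>{j. j dvd n \<and> moebius (n div j) = 1}. g j)
    = (\<Prod>z\<in>Z. F z ^ card {j. j dvd n \<and> moebius (n div j) = -1 \<and> r z dvd j} * (if r z = n then F z else 1))"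
    unfolding key by (rule prod.cong[OF refl]) (simp add: card_moebius_multiples[OF n r] mult.commute)
  also have "\<dots> = (\<Prod>j\<in>{j. j dvd n \<and> moebius (n div j) = -1}. g j) * (\<Prod>z\<in>Z. if r z = n then F z else 1)"
    by (simp add: prod.distrib key)
  also have "(\<Prod>z\<in>Z. if r z = n then F z else 1) = (\<Prod>z\<in>{z\<in>Z. r z = n}. F z)"
    by (simp add: prod.inter_filter[OF Z])
  finally show ?thesis .
qed

section \<open>Factorization over simple roots, and divisibility tested by specialisation\<close>

lemma root_prod_mset_set: "root_prod (mset_set Z) = (\<Prod>z\<in>Z. [:- z, 1:])"
  by (simp add: root_prod_def prod_unfold_prod_mset)

lemma monic_separable_factorization:
  fixes f :: "'a :: alg_closed_field poly"
  assumes monic: "lead_coeff f = 1" and sep: "\<And>z. poly f z = 0 \<Longrightarrow> poly (pderiv f) z \<noteq> 0"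
  shows "f = (\<Prod>z\<in>{z. poly f z = 0}. [:- z, 1:])"
proof -
  have f0: "f \<noteq> 0" using monic by auto
  obtain A where A: "f = root_prod A" using root_factorization[OF f0] monic by (metis smult_1_left)
  have "count A z \<le> 1" for z
  proof (rule ccontr)
    assume c: "\<not> count A z \<le> 1"
    hence "replicate_mset 2 z \<subseteq># A" by (simp add: count_le_replicate_mset_subset_eq[symmetric])
    then obtain B where "A = replicate_mset 2 z + B" by (auto simp: mset_subset_eq_exists_conv)
    hence "f = [:-z,1:] * ([:-z,1:] * root_prod B)"
      by (simp add: A root_prod_def numeral_2_eq_2 del: mult_pCons_left)
    moreover from this have "poly (pderiv f) z = 0" by (simp add: pderiv_mult del: mult_pCons_left)
    ultimately show False using sep[of z] by (simp del: mult_pCons_left)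
  qed
  hence "A = mset_set (set_mset A)"
    by (intro multiset_eqI) (metis count_mset_set(1,3) finite_set_mset le_antisym count_greater_eq_one_iff not_in_iff)
  moreover have "set_mset A = {z. poly f z = 0}" by (auto simp: A poly_root_prod prod_mset_zero_iff)
  ultimately show ?thesis using A root_prod_mset_set by metis
qed

text \<open>Division by a monic g survives every ring homomorphism. The image of the remainder has
  degree below that of the image of g and is divisible by it, so it vanishes under each member of
  \<Phi>, and joint injectivity kills the remainder. This is how the quotients in
  \<open>moebius_prod\<close> are shown to be exact.\<close>

lemma monic_dvd_specialize:
  fixes f g :: "'a :: idom poly" and \<Phi> :: "('a \<Rightarrow> 'b :: idom) set"
  assumes monic: "lead_coeff g = 1"
    and hom: "\<And>\<phi>. \<phi> \<in> \<Phi> \<Longrightarrow> comm_ring_hom \<phi>"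
    and inj: "\<And>a. (\<And>\<phi>. \<phi> \<in> \<Phi> \<Longrightarrow> \<phi> a = 0) \<Longrightarrow> a = 0"
    and dvd: "\<And>\<phi>. \<phi> \<in> \<Phi> \<Longrightarrow> map_poly \<phi> g dvd map_poly \<phi> f"
  shows "g dvd f"
proof -
  obtain q r where qr: "pseudo_divmod f g = (q, r)" by force
  have g0: "g \<noteq> 0" using monic by auto
  from pseudo_divmod[OF g0 qr] monic have f: "f = g * q + r" and r: "r = 0 \<or> degree r < degree g" by auto
  have "\<phi> (Polynomial.coeff r i) = 0" if \<phi>: "\<phi> \<in> \<Phi>" for \<phi> i
  proof (rule ccontr)
    interpret comm_ring_hom \<phi> by (rule hom[OF \<phi>])
    interpret h: map_poly_comm_ring_hom \<phi> ..
    assume "\<phi> (Polynomial.coeff r i) \<noteq> 0"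
    hence nz: "map_poly \<phi> r \<noteq> 0" by (metis coeff_0 coeff_map_poly hom_zero)
    have "map_poly \<phi> f = map_poly \<phi> g * map_poly \<phi> q + map_poly \<phi> r" by (simp add: f hom_distribs)
    with dvd[OF \<phi>] have "map_poly \<phi> g dvd map_poly \<phi> r"
      by (metis dvd_add_right_iff dvd_triv_left)
    from dvd_imp_degree_le[OF this nz] have "degree (map_poly \<phi> g) \<le> degree (map_poly \<phi> r)" .
    moreover have "degree (map_poly \<phi> g) = degree g"
      by (rule degree_map_poly) (use monic g0 in auto)
    moreover have "degree (map_poly \<phi> r) \<le> degree r" by (rule degree_map_poly_le)
    moreover have "r \<noteq> 0" using nz by auto
    ultimately show False using r by auto
  qed
  hence "r = 0" by (intro poly_eqI) (auto intro: inj)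
  thus ?thesis using f by simp
qed

section \<open>Exact orders and cyclotomic polynomials\<close>

lemma monic_nonzero: "lead_coeff p = 1 \<Longrightarrow> p \<noteq> (0 :: 'a :: comm_ring_1 poly)"
  by auto

text \<open>Exact order, phrased as a divisibility criterion for all exponents, parallel to
  \<open>per\<close>, so that roots of unity and periodic points go through the same Moebius
  argument.\<close>

definition prim_roots :: "nat \<Rightarrow> complex set" where
  "prim_roots n = {z. \<forall>d. z ^ d = 1 \<longleftrightarrow> n dvd d}"

lemma exists_period:
  assumes "(f ^^ n) x = x" "n > 0"
  shows "\<exists>r>0. \<forall>d. (f ^^ d) x = x \<longleftrightarrow> r dvd d"
proof -
  define r where "r = (LEAST r. r > 0 \<and> (f ^^ r) x = x)"
  have r: "r > 0" "(f ^^ r) x = x" using LeastI[of "\<lambda>r. r > 0 \<and> (f ^^ r) x = x" n] assms by (auto simp: r_def)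
  have "(f ^^ d) x = x \<longleftrightarrow> r dvd d" for d
  proof
    assume d: "(f ^^ d) x = x"
    hence "(f ^^ (d mod r)) x = x" using funpow_mod_eq[OF r(2)] by metis
    moreover have "d mod r < r" using r by simp
    ultimately have "\<not> d mod r > 0" using not_less_Least[of "d mod r" "\<lambda>r. r > 0 \<and> (f ^^ r) x = x"] by (auto simp: r_def)
    thus "r dvd d" by auto
  next
    assume "r dvd d"
    then obtain k where "d = r * k" by auto
    thus "(f ^^ d) x = x" using funpow_mod_eq[OF r(2), of d] by simp
  qed
  thus ?thesis using r by blast
qed

text \<open>The order of z is the period of 1 under multiplication by z, so
  \<open>exists_period\<close> covers it.\<close>

lemma exists_order:
  fixes z :: "'a :: comm_monoid_mult"
  assumes "z ^ n = 1" "n > 0"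
  shows "\<exists>r. \<forall>d. z ^ d = 1 \<longleftrightarrow> r dvd d"
proof -
  have *: "((*) z ^^ d) 1 = z ^ d" for d by (induction d) auto
  from exists_period[of n "(*) z" 1] assms show ?thesis by (auto simp: *)
qed

lemma monic_x_pow_minus_1:
  assumes "d > 0"
  shows "lead_coeff (Polynomial.monom 1 d - 1 :: 'a :: idom poly) = 1" "degree (Polynomial.monom 1 d - 1 :: 'a :: idom poly) = d"
proof -
  have "degree (1 :: 'a poly) < degree (Polynomial.monom 1 d :: 'a poly)" using assms by (simp add: degree_monom_eq)
  hence "degree (Polynomial.monom 1 d + (- 1) :: 'a poly) = d"
    by (subst degree_add_eq_left) (simp_all add: degree_monom_eq)
  thus d: "degree (Polynomial.monom 1 d - 1 :: 'a poly) = d" by simp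
  show "lead_coeff (Polynomial.monom 1 d - 1 :: 'a :: idom poly) = 1" unfolding d using assms by simp
qed

lemma finite_roots_of_unity: "n > 0 \<Longrightarrow> finite {z::complex. z ^ n = 1}"
proof -
  assume n: "n > 0"
  have "(Polynomial.monom 1 n - 1 :: complex poly) \<noteq> 0"
    using monic_x_pow_minus_1(2)[OF n, where 'a = complex] n by (metis degree_0 less_numeral_extra(3))
  from poly_roots_finite[OF this] show ?thesis by (simp add: poly_monom)
qed

lemma prim_roots_iff: "z \<in> prim_roots n \<Longrightarrow> z ^ d = 1 \<longleftrightarrow> n dvd d"
  unfolding prim_roots_def by blast

lemma finite_prim_roots: "n > 0 \<Longrightarrow> finite (prim_roots n)"
  using finite_subset[OF _ finite_roots_of_unity[of n], of "prim_roots n"] prim_roots_iff[of _ n n] by auto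

lemma x_pow_minus_1_factorization:
  assumes "d > 0"
  shows "(Polynomial.monom 1 d - 1 :: complex poly) = (\<Prod>z\<in>{z. z ^ d = 1}. [:- z, 1:])"
proof -
  have "(Polynomial.monom 1 d - 1 :: complex poly) = (\<Prod>z\<in>{z. poly (Polynomial.monom 1 d - 1) z = 0}. [:- z, 1:])"
  proof (rule monic_separable_factorization[OF monic_x_pow_minus_1(1)[OF assms]])
    fix z :: complex assume "poly (Polynomial.monom 1 d - 1) z = 0"
    hence "z ^ d = 1" by (simp add: poly_monom)
    hence "z \<noteq> 0" using assms by (auto simp: power_0_left)
    thus "poly (pderiv (Polynomial.monom 1 d - 1)) z \<noteq> 0"
      using assms by (simp add: pderiv_diff pderiv_monom poly_monom)
  qed
  thus ?thesis by (simp add: poly_monom)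
qed

text \<open>Over C the numerator is visibly the denominator times the product over primitive roots.
  The divisibility is pulled back to Q[x] along the single embedding \<open>of_rat\<close>; only
  then may the \<open>div\<close> be mapped to C and the denominator cancelled.\<close>

lemma cyclotomic_complex:
  assumes n: "n > 0"
  shows "map_poly of_rat (cyclotomic n) = (\<Prod>z\<in>prim_roots n. [:- z, 1:])"
proof -
  interpret h: map_poly_comm_ring_hom "of_rat :: rat \<Rightarrow> complex" ..
  let ?g = "\<lambda>d. Polynomial.monom 1 d - 1 :: rat poly"
  let ?h = "\<lambda>d. Polynomial.monom 1 d - 1 :: complex poly"
  let ?P = "{j. j dvd n \<and> moebius (n div j) = 1}" and ?N = "{j. j dvd n \<and> moebius (n div j) = - 1}"
  define Z where "Z = {z::complex. z ^ n = 1}"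
  have Z: "finite Z" unfolding Z_def by (rule finite_roots_of_unity[OF n])
  have "\<forall>z\<in>Z. \<exists>r. \<forall>d. z ^ d = 1 \<longleftrightarrow> r dvd d" using exists_order n by (auto simp: Z_def)
  then obtain r where r: "\<And>z d. z \<in> Z \<Longrightarrow> z ^ d = 1 \<longleftrightarrow> r z dvd d" by metis
  have rn: "r z dvd n" if "z \<in> Z" for z using r[OF that, of n] that by (simp add: Z_def)
  have hg: "map_poly of_rat (?g d) = ?h d" for d by (simp add: hom_distribs)
  have "?h d = (\<Prod>z\<in>{z \<in> Z. r z dvd d}. [:- z, 1:])" if "d dvd n" for d
  proof -
    have "d > 0" using that n by (auto intro!: Nat.gr0I)
    moreover have "{z. z ^ d = 1} = {z \<in> Z. r z dvd d}"
    proof (intro equalityI subsetI)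
      fix z :: complex assume z: "z \<in> {z. z ^ d = 1}"
      hence "z \<in> Z" using that by (auto simp: Z_def power_mult elim!: dvdE)
      thus "z \<in> {z \<in> Z. r z dvd d}" using r z by blast
    qed (use r in blast)
    ultimately show ?thesis using x_pow_minus_1_factorization[of d] by simp
  qed
  from moebius_prod_numerator[OF n Z rn this]
  have num: "(\<Prod>j\<in>?P. ?h j) = (\<Prod>j\<in>?N. ?h j) * (\<Prod>z\<in>{z \<in> Z. r z = n}. [:- z, 1:])" by blast
  have "{z \<in> Z. r z = n} = prim_roots n"
  proof (intro equalityI subsetI)
    fix z assume "z \<in> {z \<in> Z. r z = n}"
    thus "z \<in> prim_roots n" using r unfolding prim_roots_def by blast
  next
    fix z assume z: "z \<in> prim_roots n"
    hence zZ: "z \<in> Z" using prim_roots_iff[OF z, of n] by (simp add: Z_def)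
    have "n dvd d \<longleftrightarrow> r z dvd d" for d using r[OF zZ, of d] prim_roots_iff[OF z, of d] by simp
    hence "r z = n" by (metis dvd_antisym dvd_refl)
    with zZ show "z \<in> {z \<in> Z. r z = n}" by simp
  qed
  note num = num[unfolded this]
  have mon: "lead_coeff (\<Prod>j\<in>?N. Polynomial.monom 1 j - 1 :: 'b :: idom poly) = 1"
  proof -
    have "lead_coeff (Polynomial.monom 1 j - 1 :: 'b :: idom poly) = 1" if "j \<in> ?N" for j
      by (rule monic_x_pow_minus_1) (use that n in \<open>auto intro!: Nat.gr0I\<close>)
    thus ?thesis unfolding lead_coeff_prod by (intro prod.neutral) blast
  qed
  have mapN: "map_poly of_rat (\<Prod>j\<in>?N. ?g j) = (\<Prod>j\<in>?N. ?h j)" "map_poly of_rat (\<Prod>j\<in>?P. ?g j) = (\<Prod>j\<in>?P. ?h j)"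
    by (simp_all only: h.hom_prod hg)
  have "(\<Prod>j\<in>?N. ?g j) dvd (\<Prod>j\<in>?P. ?g j)"
    by (rule monic_dvd_specialize[where \<Phi> = "{of_rat :: rat \<Rightarrow> complex}", OF mon])
      (auto simp only: singleton_iff mapN num dvd_triv_left intro: of_rat_hom.comm_ring_hom_axioms of_rat_eq_0_iff[THEN iffD1])
  hence "(\<Prod>j\<in>?P. ?g j) = (\<Prod>j\<in>?N. ?g j) * cyclotomic n"
    by (simp add: cyclotomic_def moebius_prod_def)
  hence "map_poly of_rat (\<Prod>j\<in>?P. ?g j) = map_poly of_rat (\<Prod>j\<in>?N. ?g j) * (map_poly of_rat (cyclotomic n) :: complex poly)"
    by (simp only: h.hom_mult)
  hence "(\<Prod>j\<in>?N. ?h j) * map_poly of_rat (cyclotomic n) = (\<Prod>j\<in>?N. ?h j) * (\<Prod>z\<in>prim_roots n. [:- z, 1:])"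
    by (metis num mapN)
  moreover have "(\<Prod>j\<in>?N. ?h j) \<noteq> 0" by (rule monic_nonzero[OF mon])
  ultimately show ?thesis by (rule mult_left_cancel[THEN iffD1, rotated])
qed

section \<open>Specialised dynatomic polynomials\<close>

text \<open>Evaluation of the innermost variable. It is reused later for any rational polynomial in
  one variable, with the argument a root of unity or a value of C instead of c.\<close>

definition evc :: "complex \<Rightarrow> rat poly \<Rightarrow> complex" where
  "evc c p = poly (map_poly of_rat p) c"

definition evx :: "complex \<Rightarrow> rat poly poly \<Rightarrow> complex poly" where
  "evx c q = map_poly (evc c) q"

definition ev :: "complex \<Rightarrow> complex \<Rightarrow> rat poly poly \<Rightarrow> complex" where
  "ev c x q = poly (evx c q) x"

lemma comm_ring_hom_evc: "comm_ring_hom (evc c)"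
proof -
  interpret h: map_poly_comm_ring_hom "of_rat :: rat \<Rightarrow> complex" ..
  show ?thesis unfolding evc_def by unfold_locales (simp_all add: h.hom_mult h.hom_add)
qed

interpretation evc: comm_ring_hom "evc c" for c by (rule comm_ring_hom_evc)

lemma comm_ring_hom_evx: "comm_ring_hom (evx c)"
proof -
  interpret map_poly_comm_ring_hom "evc c" ..
  show ?thesis unfolding evx_def by unfold_locales
qed

interpretation evx: comm_ring_hom "evx c" for c by (rule comm_ring_hom_evx)

lemma comm_ring_hom_ev: "comm_ring_hom (ev c x)"
  unfolding ev_def by unfold_locales (auto simp: hom_distribs)

interpretation ev: comm_ring_hom "ev c x" for c x by (rule comm_ring_hom_ev)

interpretation ev: idom_hom "ev c x" for c x ..

interpretation mev: map_poly_comm_ring_hom "ev c x" for c x ..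

lemma evc_eq_0_infinite:
  assumes inf: "infinite S" and z: "\<And>c. c \<in> S \<Longrightarrow> evc c p = 0"
  shows "p = 0"
proof (rule ccontr)
  assume "p \<noteq> 0"
  hence "map_poly of_rat p \<noteq> (0 :: complex poly)" by simp
  from poly_roots_finite[OF this] have "finite S"
    by (rule finite_subset[rotated]) (use z in \<open>auto simp: evc_def\<close>)
  with inf show False by simp
qed

lemma evx_eq_infinite:
  assumes inf: "infinite S" and z: "\<And>c. c \<in> S \<Longrightarrow> evx c p = evx c q"
  shows "p = q"
proof -
  have "Polynomial.coeff (p - q) i = 0" for i
  proof (rule evc_eq_0_infinite[OF inf])
    fix c assume "c \<in> S"
    hence "Polynomial.coeff (evx c p) i = Polynomial.coeff (evx c q) i" using z by simp
    thus "evc c (Polynomial.coeff (p - q) i) = 0" by (simp add: evx_def hom_distribs)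
  qed
  hence "p - q = 0" by (intro poly_eqI) simp
  thus ?thesis by simp
qed

lemma evx_monic:
  assumes "lead_coeff p = 1"
  shows "lead_coeff (evx c p) = 1" "degree (evx c p) = degree p"
proof -
  show d: "degree (evx c p) = degree p"
    unfolding evx_def by (rule degree_map_poly) (use assms in auto)
  thus "lead_coeff (evx c p) = 1" using assms by (simp add: evx_def)
qed

section \<open>Iterates and multipliers at a fixed parameter\<close>

definition qmap :: "complex \<Rightarrow> complex \<Rightarrow> complex" where
  "qmap c z = z\<^sup>2 + c"

definition multiplier :: "complex \<Rightarrow> nat \<Rightarrow> complex \<Rightarrow> complex" where
  "multiplier c n z = (\<Prod>i<n. 2 * (qmap c ^^ i) z)"

primrec itp :: "complex \<Rightarrow> nat \<Rightarrow> complex poly" where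
  "itp c 0 = [:0, 1:]"
| "itp c (Suc n) = itp c n ^ 2 + [:c:]"

lemma poly_itp: "poly (itp c n) z = (qmap c ^^ n) z"
  by (induction n) (auto simp: qmap_def)

lemma poly_pderiv_itp: "poly (pderiv (itp c n)) z = multiplier c n z"
  by (induction n) (auto simp: multiplier_def pderiv_add pderiv_power pderiv_pCons poly_itp algebra_simps pderiv.simps)

lemma fiter_Suc: "fiter (Suc j) = fiter j ^ 2 + [:cvar:]"
  by (simp add: fiter_def fpoly_def pcompose_pCons power2_eq_square)

lemma fiter_0: "fiter 0 = [:0, 1:]"
  by (simp add: fiter_def)

lemma ev_cvar: "ev c x cvar = c"
  by (simp add: ev_def evx_def cvar_def evc_def hom_distribs)

lemma ev_xvar: "ev c x xvar = x"
  by (simp add: ev_def evx_def xvar_def hom_distribs)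

lemma map_poly_ev_fiter: "map_poly (ev c x) (fiter j) = itp c j"
  by (induction j) (auto simp: fiter_0 fiter_Suc hom_distribs ev_cvar)

lemma degree_lead_square_add_const:
  fixes p :: "'a :: idom poly"
  assumes "lead_coeff p = 1" "degree p = n" "n > 0"
  shows "lead_coeff (p ^ 2 + [:c:]) = 1" "degree (p ^ 2 + [:c:]) = 2 * n"
proof -
  have d: "degree (p ^ 2) = 2 * n" using assms by (subst degree_power_eq) auto
  show d': "degree (p ^ 2 + [:c:]) = 2 * n" using d assms by (subst degree_add_eq_left) auto
  have "Polynomial.coeff (p ^ 2) (2 * n) = 1" using lead_coeff_power[of p 2] unfolding d assms(1) by simp
  thus "lead_coeff (p ^ 2 + [:c:]) = 1" unfolding d' using assms(3)
    by (simp add: coeff_pCons split: nat.splits)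
qed

lemma fiter_monic: "lead_coeff (fiter j) = 1 \<and> degree (fiter j) = 2 ^ j"
proof (induction j)
  case (Suc j)
  hence "lead_coeff (fiter j) = 1" "degree (fiter j) = 2 ^ j" by blast+
  from degree_lead_square_add_const[OF this] show ?case by (simp only: fiter_Suc power_Suc) simp
qed (simp add: fiter_0)

lemma itp_monic: "lead_coeff (itp c j) = 1 \<and> degree (itp c j) = 2 ^ j"
proof (induction j)
  case (Suc j)
  hence "lead_coeff (itp c j) = 1" "degree (itp c j) = 2 ^ j" by blast+
  from degree_lead_square_add_const[OF this] show ?case by (simp only: itp.simps power_Suc) simp
qed simp

lemma monic_minus_X:
  fixes p :: "'a :: idom poly"
  assumes "lead_coeff p = 1 \<and> degree p = 2 ^ j" "j > 0"
  shows "lead_coeff (p - [:0, 1:]) = 1 \<and> degree (p - [:0, 1:]) = 2 ^ j"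
proof -
  have lt: "1 < (2::nat) ^ j" using assms(2) by (intro one_less_power) auto
  have "degree (p + (- [:0, 1:])) = 2 ^ j" using lt assms by (subst degree_add_eq_left) auto
  hence d: "degree (p - [:0, 1:]) = 2 ^ j" unfolding diff_conv_add_uminus .
  have "Polynomial.coeff [:0, 1 :: 'a:] (2 ^ j) = 0" using lt by (intro coeff_eq_0) auto
  moreover have "Polynomial.coeff p (2 ^ j) = 1" using assms(1) by metis
  ultimately show ?thesis using d by simp
qed

text \<open>The derivative of f^j(z) - z is the multiplier minus 1, so at a good parameter all these
  polynomials with 1 <= j <= n, in particular for all divisors j of n, have only simple roots, and
  periodic points can be treated as sets.\<close>

definition good :: "nat \<Rightarrow> complex \<Rightarrow> bool" where
  "good n c \<longleftrightarrow> (\<forall>j\<in>{1..n}. \<forall>z. (qmap c ^^ j) z = z \<longrightarrow> multiplier c j z \<noteq> 1)"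

lemma qmap_0_funpow [simp]: "(qmap 0 ^^ j) z = z ^ (2 ^ j)"
  by (induction j) (auto simp: qmap_def power_mult[symmetric] mult.commute)

lemma multiplier_0: "multiplier 0 j z = 2 ^ j * z ^ (2 ^ j - 1)"
proof (induction j)
  case (Suc j)
  have e: "(2::nat) ^ Suc j - 1 = (2 ^ j - 1) + 2 ^ j" by simp
  have "multiplier 0 (Suc j) z = multiplier 0 j z * (2 * z ^ 2 ^ j)" by (simp add: multiplier_def)
  thus ?case unfolding e Suc.IH power_add by simp
qed (simp add: multiplier_def)

text \<open>For z -> z^2 a fixed point of the j-th iterate is either 0, with multiplier 0, or
  satisfies z^(2^j - 1) = 1 and has multiplier 2^j.\<close>

lemma good_0: "good n 0"
  unfolding good_def
proof (intro ballI allI impI)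
  fix j z assume j: "j \<in> {1..n}" and z: "(qmap 0 ^^ j) z = z"
  hence z: "z ^ (2 ^ j) = z" by simp
  show "multiplier 0 j z \<noteq> 1"
  proof (cases "z = 0")
    case True
    have "(2::nat) ^ j > 1" using j by (intro one_less_power) auto
    thus ?thesis using True by (simp add: multiplier_0 power_0_left)
  next
    case False
    have "z * z ^ (2 ^ j - 1) = z" using z by (simp flip: power_Suc)
    hence "z ^ (2 ^ j - 1) = 1" using False by simp
    moreover have "(2::complex) ^ j \<noteq> 1"
    proof
      assume "(2::complex) ^ j = 1"
      hence "(of_nat (2 ^ j) :: complex) = of_nat 1" by simp
      hence "(2::nat) ^ j = 1" by (simp only: of_nat_eq_iff)
      thus False using j by auto
    qed
    ultimately show ?thesis by (simp add: multiplier_0)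
  qed
qed


section \<open>Finiteness of the exceptional parameters\<close>

lemma monic_pderiv:
  fixes p :: "'a :: {idom, ring_char_0} poly"
  assumes "lead_coeff p = 1 \<and> degree p = 2 ^ j" "j > 0"
  shows "degree (pderiv p) = 2 ^ j - 1" "degree (pderiv p - [:c:]) = 2 ^ j - 1" "degree ([:c:] - pderiv p) = 2 ^ j - 1"
proof -
  show d: "degree (pderiv p) = 2 ^ j - 1" using assms by (simp add: degree_pderiv)
  have lt: "1 < (2::nat) ^ j" using assms(2) by (intro one_less_power) auto
  have "degree (pderiv p + [:-c:]) = 2 ^ j - 1" using lt d by (subst degree_add_eq_left) auto
  moreover have "pderiv p + [:- c:] = pderiv p - [:c:]" by simp
  ultimately show d2: "degree (pderiv p - [:c:]) = 2 ^ j - 1" by simp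
  have "degree (- (pderiv p - [:c:])) = 2 ^ j - 1" unfolding degree_minus by (rule d2)
  thus "degree ([:c:] - pderiv p) = 2 ^ j - 1" by simp
qed

lemma poly_itp_minus_X: "poly (itp c j - [:0, 1:]) z = (qmap c ^^ j) z - z"
  by (simp add: poly_itp)

text \<open>The exceptional c are the zeros of the resultant of f^j(z) - z and its derivative in z;
  this is not identically zero because it does not vanish at c = 0.\<close>

lemma finite_not_good_aux:
  assumes j: "j > 0"
  shows "finite {c. \<exists>z. (qmap c ^^ j) z = z \<and> multiplier c j z = 1}"
proof -
  define R where "R = resultant (fiter j - [:0, 1:]) (pderiv (fiter j) - [:1:])"
  have evR: "ev c x R = resultant (itp c j - [:0, 1:]) (pderiv (itp c j) - [:1:])" for c x
  proof -
    have m1: "map_poly (ev c x) (fiter j - [:0, 1:]) = itp c j - [:0, 1:]"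
      by (simp add: hom_distribs map_poly_ev_fiter)
    have m2: "map_poly (ev c x) (pderiv (fiter j) - [:1:]) = pderiv (itp c j) - [:1:]"
      by (simp add: hom_distribs map_poly_ev_fiter del: pCons_one)
    show ?thesis unfolding R_def m1[symmetric] m2[symmetric]
      by (rule ev.resultant_map_poly[symmetric], unfold m1 m2)
        (simp_all only: conjunct2[OF monic_minus_X[OF fiter_monic j]] conjunct2[OF monic_minus_X[OF itp_monic j]]
          monic_pderiv(2)[OF itp_monic j] monic_pderiv(2)[OF fiter_monic j])
  qed
  have zero: "ev c x R = 0 \<longleftrightarrow> (\<exists>z. (qmap c ^^ j) z = z \<and> multiplier c j z = 1)" for c x
  proof -
    have m: "lead_coeff (itp c j - [:0, 1:]) = 1" using monic_minus_X[OF itp_monic j] by blast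
    obtain A where A: "itp c j - [:0, 1:] = root_prod A"
      using root_factorization[OF monic_nonzero[OF m]] m by (metis smult_1_left)
    have root: "z \<in># A \<longleftrightarrow> (qmap c ^^ j) z = z" for z
    proof -
      have "z \<in># A \<longleftrightarrow> poly (root_prod A) z = 0" by (auto simp: poly_root_prod prod_mset_zero_iff)
      also have "\<dots> \<longleftrightarrow> (qmap c ^^ j) z - z = 0" unfolding A[symmetric] poly_itp_minus_X ..
      finally show ?thesis by simp
    qed
    have "ev c x R = (\<Prod>z\<in>#A. multiplier c j z - 1)"
      unfolding evR A resultant_root_prod poly_diff poly_pderiv_itp by (simp del: pCons_one)
    thus ?thesis using root by (auto simp: prod_mset_zero_iff)
  qed
  \<comment> \<open>R has the type of a polynomial in c and x, but by \<open>zero\<close> its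
    vanishing at (c, x) does not depend on x. So x is set to 0, and the constant coefficient in x is
    the polynomial in c to be used.\<close>
  have "evc 0 (Polynomial.coeff R 0) \<noteq> 0"
  proof -
    have "ev 0 0 R \<noteq> 0" using zero[of 0 0] good_0[of j] j unfolding good_def by auto
    thus ?thesis by (simp add: ev_def evx_def poly_0_coeff_0)
  qed
  hence "Polynomial.coeff R 0 \<noteq> 0" by auto
  hence "map_poly of_rat (Polynomial.coeff R 0) \<noteq> (0 :: complex poly)" by simp
  from poly_roots_finite[OF this] have "finite {c. evc c (Polynomial.coeff R 0) = 0}" by (simp add: evc_def)
  moreover have "evc c (Polynomial.coeff R 0) = ev c 0 R" for c by (simp add: ev_def evx_def poly_0_coeff_0)
  ultimately show ?thesis using zero[of _ 0] by simp
qed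

lemma finite_not_good: "finite {c. \<not> good n c}"
proof -
  have "{c. \<not> good n c} = (\<Union>j\<in>{1..n}. {c. \<exists>z. (qmap c ^^ j) z = z \<and> multiplier c j z = 1})"
    by (auto simp: good_def)
  moreover have "finite \<dots>" by (intro finite_UN_I finite_not_good_aux) auto
  ultimately show ?thesis by simp
qed

lemma infinite_good: "infinite {c. good n c}"
proof
  assume "finite {c. good n c}"
  hence "finite ({c. good n c} \<union> {c. \<not> good n c})" using finite_not_good by blast
  moreover have "{c. good n c} \<union> {c. \<not> good n c} = UNIV" by auto
  ultimately show False using infinite_UNIV_char_0[where 'a = complex] by simp
qed

text \<open>At a good parameter this is the root set of the n-th dynatomic polynomial; elsewhere
  that polynomial can also vanish at points of smaller period.\<close>

definition per :: "complex \<Rightarrow> nat \<Rightarrow> complex set" where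
  "per c n = {z. \<forall>d. (qmap c ^^ d) z = z \<longleftrightarrow> n dvd d}"

lemma per_iff: "z \<in> per c n \<Longrightarrow> (qmap c ^^ d) z = z \<longleftrightarrow> n dvd d"
  unfolding per_def by blast

lemma itp_factorization:
  assumes "good n c" "d \<in> {1..n}"
  shows "itp c d - [:0, 1:] = (\<Prod>z\<in>{z. (qmap c ^^ d) z = z}. [:- z, 1:])"
proof -
  have "lead_coeff (itp c d - [:0, 1:]) = 1" using conjunct1[OF monic_minus_X[OF itp_monic[of c d]]] assms(2) by fastforce
  hence "itp c d - [:0, 1:] = (\<Prod>z\<in>{z. poly (itp c d - [:0, 1:]) z = 0}. [:- z, 1:])"
  proof (rule monic_separable_factorization)
    fix z assume "poly (itp c d - [:0, 1:]) z = 0"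
    hence "(qmap c ^^ d) z = z" unfolding poly_itp_minus_X by simp
    hence "multiplier c d z \<noteq> 1" using assms unfolding good_def by blast
    thus "poly (pderiv (itp c d - [:0, 1:])) z \<noteq> 0"
      by (simp add: pderiv_diff poly_pderiv_itp pderiv_pCons)
  qed
  thus ?thesis unfolding poly_itp_minus_X by simp
qed

lemma finite_fixpoints:
  assumes "n > 0"
  shows "finite {z. (qmap c ^^ n) z = z}"
proof -
  have "lead_coeff (itp c n - [:0, 1:]) = 1" using monic_minus_X[OF itp_monic assms] by blast
  from poly_roots_finite[OF monic_nonzero[OF this]] show ?thesis unfolding poly_itp_minus_X by simp
qed

lemma per_subset: "per c n \<subseteq> {z. (qmap c ^^ n) z = z}"
  using per_iff[of _ c n n] by auto

lemma finite_per: "n > 0 \<Longrightarrow> finite (per c n)"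
  using finite_subset[OF per_subset finite_fixpoints] .

text \<open>The pattern of \<open>cyclotomic_complex\<close>, with the single embedding replaced by
  all evaluations at good c and arbitrary x. These are jointly injective because there are
  infinitely many good c.\<close>

lemma dynatomic_props:
  assumes n: "n > 0"
  shows "lead_coeff (dynatomic n) = 1"
    and "good n c \<Longrightarrow> map_poly (ev c x) (dynatomic n) = (\<Prod>z\<in>per c n. [:- z, 1:])"
proof -
  let ?g = "\<lambda>d. fiter d - [:0, 1:]"
  let ?h = "\<lambda>c d. itp c d - [:0, 1:]"
  let ?P = "{j. j dvd n \<and> moebius (n div j) = 1}" and ?N = "{j. j dvd n \<and> moebius (n div j) = - 1}"
  let ?num = "\<Prod>j\<in>?P. ?g j" and ?den = "\<Prod>j\<in>?N. ?g j"
  let ?numc = "\<lambda>c. \<Prod>j\<in>?P. ?h c j" and ?denc = "\<lambda>c. \<Prod>j\<in>?N. ?h c j"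
  have pos: "d > 0" if "d dvd n" for d using that n by (auto intro!: Nat.gr0I)
  have hg: "map_poly (ev c x) (?g d) = ?h c d" for c x d by (simp add: hom_distribs map_poly_ev_fiter)
  have mapN: "map_poly (ev c x) ?den = ?denc c" "map_poly (ev c x) ?num = ?numc c" for c x
    by (simp_all only: mev.hom_prod hg)
  have mong: "lead_coeff (?g d) = 1" if "d dvd n" for d
    using monic_minus_X[OF fiter_monic pos[OF that]] by blast
  have monh: "lead_coeff (?h c d) = 1" if "d dvd n" for c d
    using monic_minus_X[OF itp_monic pos[OF that]] by blast
  have monP: "lead_coeff ?num = 1" unfolding lead_coeff_prod by (intro prod.neutral) (use mong in blast)
  have monN: "lead_coeff ?den = 1" unfolding lead_coeff_prod by (intro prod.neutral) (use mong in blast)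
  have monc: "lead_coeff (?denc c) = 1" for c unfolding lead_coeff_prod by (intro prod.neutral) (use monh in blast)
  have num: "?numc c = ?denc c * (\<Prod>z\<in>per c n. [:- z, 1:])" if good: "good n c" for c
  proof -
    define Z where "Z = {z. (qmap c ^^ n) z = z}"
    have Z: "finite Z" unfolding Z_def by (rule finite_fixpoints[OF n])
    have "\<forall>z\<in>Z. \<exists>r. \<forall>d. (qmap c ^^ d) z = z \<longleftrightarrow> r dvd d"
      using exists_period[of n "qmap c"] n unfolding Z_def by blast
    then obtain r where r: "\<And>z d. z \<in> Z \<Longrightarrow> (qmap c ^^ d) z = z \<longleftrightarrow> r z dvd d" by metis
    have rn: "r z dvd n" if "z \<in> Z" for z using r[OF that, of n] that by (simp add: Z_def)
    have "?h c d = (\<Prod>z\<in>{z \<in> Z. r z dvd d}. [:- z, 1:])" if d: "d dvd n" for d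
    proof -
      have "d \<in> {1..n}" using pos[OF d] dvd_imp_le[OF d n] by simp
      moreover have "{z. (qmap c ^^ d) z = z} = {z \<in> Z. r z dvd d}"
      proof (intro equalityI subsetI)
        fix z assume z: "z \<in> {z. (qmap c ^^ d) z = z}"
        hence "(qmap c ^^ n) z = (qmap c ^^ (n mod d)) z" using funpow_mod_eq[of d "qmap c" z n] by simp
        hence "z \<in> Z" using d by (simp add: Z_def)
        thus "z \<in> {z \<in> Z. r z dvd d}" using r z by blast
      qed (use r in blast)
      ultimately show ?thesis using itp_factorization[OF good] by simp
    qed
    from moebius_prod_numerator[OF n Z rn this]
    have num: "?numc c = ?denc c * (\<Prod>z\<in>{z \<in> Z. r z = n}. [:- z, 1:])" by blast
    have "{z \<in> Z. r z = n} = per c n"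
    proof (intro equalityI subsetI)
      fix z assume "z \<in> {z \<in> Z. r z = n}"
      thus "z \<in> per c n" using r unfolding per_def by blast
    next
      fix z assume z: "z \<in> per c n"
      hence zZ: "z \<in> Z" using per_iff[OF z, of n] by (simp add: Z_def)
      have "n dvd d \<longleftrightarrow> r z dvd d" for d using r[OF zZ, of d] per_iff[OF z, of d] by simp
      hence "r z = n" by (metis dvd_antisym dvd_refl)
      with zZ show "z \<in> {z \<in> Z. r z = n}" by simp
    qed
    thus ?thesis using num by simp
  qed
  have "?den dvd ?num"
  proof (rule monic_dvd_specialize[where \<Phi> = "{ev c x |c x. good n c}", OF monN])
    fix \<phi> assume "\<phi> \<in> {ev c x |c x. good n c}"
    then obtain c x where \<phi>: "\<phi> = ev c x" and g: "good n c" by blast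
    show "comm_ring_hom \<phi>" unfolding \<phi> by (rule comm_ring_hom_ev)
    show "map_poly \<phi> ?den dvd map_poly \<phi> ?num" unfolding \<phi> mapN num[OF g] by (rule dvd_triv_left)
  next
    fix a assume a: "\<And>\<phi>. \<phi> \<in> {ev c x |c x. good n c} \<Longrightarrow> \<phi> a = 0"
    show "a = 0"
    proof (rule evx_eq_infinite[OF infinite_good[of n]])
      fix c assume c: "c \<in> {c. good n c}"
      have "poly (evx c a) x = 0" for x using a[of "ev c x"] c by (auto simp: ev_def)
      hence "evx c a = 0" using poly_all_0_iff_0 by blast
      thus "evx c a = evx c 0" by simp
    qed
  qed
  hence eq: "?num = ?den * dynatomic n" by (simp add: dynatomic_def moebius_prod_def)
  from arg_cong[OF this, of lead_coeff] show "lead_coeff (dynatomic n) = 1"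
    unfolding lead_coeff_mult monP monN by simp
  assume g: "good n c"
  from arg_cong[OF eq, of "map_poly (ev c x)"]
  have "?denc c * map_poly (ev c x) (dynatomic n) = ?denc c * (\<Prod>z\<in>per c n. [:- z, 1:])"
    unfolding mev.hom_mult mapN num[OF g] by (rule sym)
  thus "map_poly (ev c x) (dynatomic n) = (\<Prod>z\<in>per c n. [:- z, 1:])"
    by (rule mult_left_cancel[THEN iffD1, OF monic_nonzero[OF monc]])
qed

section \<open>Multiplier polynomials\<close>

text \<open>The cofactor is a sum of n monic terms of the same degree (n - 1) d, so nothing cancels
  at the top and its leading coefficient is n.\<close>

lemma monic_power_diff_factor:
  fixes U V :: "'a :: {idom, ring_char_0} poly"
  assumes U: "lead_coeff U = 1" "degree U = d" and V: "lead_coeff V = 1" "degree V = d" and n: "n > 0"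
  obtains W where "U ^ n - V ^ n = (U - V) * W" "degree W = (n - 1) * d" "lead_coeff W = of_nat n"
proof -
  define W where "W = (\<Sum>i<n. V ^ (n - Suc i) * U ^ i)"
  have t: "degree (V ^ (n - Suc i) * U ^ i) = (n - 1) * d \<and> lead_coeff (V ^ (n - Suc i) * U ^ i) = 1" if "i < n" for i
  proof
    have nz: "U \<noteq> 0" "V \<noteq> 0" using U V by auto
    hence "degree (V ^ (n - Suc i) * U ^ i) = (n - Suc i) * d + i * d"
      using U V by (simp add: degree_mult_eq degree_power_eq)
    also have "\<dots> = (n - 1) * d" using that by (simp flip: add_mult_distrib)
    finally show "degree (V ^ (n - Suc i) * U ^ i) = (n - 1) * d" .
    show "lead_coeff (V ^ (n - Suc i) * U ^ i) = 1"
      unfolding lead_coeff_mult lead_coeff_power U(1) V(1) by simp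
  qed
  have le: "degree W \<le> (n - 1) * d" unfolding W_def by (intro degree_sum_le) (use t in auto)
  have c: "Polynomial.coeff W ((n - 1) * d) = of_nat n"
  proof -
    have "Polynomial.coeff W ((n - 1) * d) = (\<Sum>i<n. Polynomial.coeff (V ^ (n - Suc i) * U ^ i) ((n - 1) * d))"
      by (simp add: W_def coeff_sum)
    also have "\<dots> = (\<Sum>i<n. 1)" by (rule sum.cong[OF refl]) (metis t lessThan_iff)
    finally show ?thesis by simp
  qed
  have deg: "degree W = (n - 1) * d" using le c n by (intro antisym le_degree) auto
  show ?thesis
    by (rule that[of W]) (use deg c in \<open>simp_all add: power_diff_sumr2 W_def\<close>)
qed

text \<open>If U and V differed, the top term of (U - V) W would sit at an index of at least (n - 1)
  d. Hence a monic n-th root is determined by the coefficients from that index on.\<close>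

lemma monic_power_inj:
  fixes U V :: "'a :: {idom, ring_char_0} poly"
  assumes "lead_coeff U = 1" "degree U = d" "lead_coeff V = 1" "degree V = d" "n > 0"
    and low: "\<And>i. (n - 1) * d \<le> i \<Longrightarrow> Polynomial.coeff (U ^ n) i = Polynomial.coeff (V ^ n) i"
  shows "U = V"
proof (rule ccontr)
  assume ne: "U \<noteq> V"
  obtain W where W: "U ^ n - V ^ n = (U - V) * W" "degree W = (n - 1) * d" "lead_coeff W = of_nat n"
    using monic_power_diff_factor[OF assms(1-5)] .
  define i where "i = degree (U - V) + degree W"
  have "Polynomial.coeff (U ^ n - V ^ n) i = lead_coeff (U - V) * of_nat n"
    unfolding W(1) i_def coeff_mult_degree_sum W(3) ..
  moreover have "Polynomial.coeff (U ^ n - V ^ n) i = 0" using low[of i] by (simp add: i_def W(2))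
  ultimately have "lead_coeff (U - V) = 0" using \<open>n > 0\<close> by (metis mult_eq_0_iff of_nat_eq_0_iff less_numeral_extra(3))
  thus False using ne by (metis leading_coeff_0_iff right_minus_eq)
qed

text \<open>Coefficients are found from the top down: adding a x^j to S changes the coefficient of
  S^n at (n - 1) d + j by n a and leaves all higher ones alone. It yields a candidate root over Q[c]
  before anything is known to be an n-th power there.\<close>

lemma exists_truncated_root:
  fixes R :: "'a :: {idom, ring_char_0} poly"
  assumes div: "\<And>b :: 'a. \<exists>a. of_nat n * a = b" and n: "n > 0"
    and R: "degree R = n * d" "lead_coeff R = 1"
  shows "\<exists>S. lead_coeff S = 1 \<and> degree S = d \<and> (\<forall>i\<ge>(n - 1) * d. Polynomial.coeff (S ^ n) i = Polynomial.coeff R i)"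
proof -
  have "t \<le> d \<Longrightarrow> \<exists>S. lead_coeff S = 1 \<and> degree S = d \<and> (\<forall>i\<ge>n * d - t. Polynomial.coeff (S ^ n) i = Polynomial.coeff R i)" for t
  proof (induction t)
    case 0
    show ?case
    proof (intro exI[of _ "Polynomial.monom 1 d"] conjI allI impI)
      fix i assume "n * d - 0 \<le> i"
      thus "Polynomial.coeff (Polynomial.monom 1 d ^ n) i = Polynomial.coeff R i"
        using R by (cases "i = n * d") (auto simp: monom_power coeff_eq_0 mult.commute)
    qed (simp_all add: degree_monom_eq)
  next
    case (Suc t)
    then obtain S where S: "lead_coeff S = 1" "degree S = d"
      and c: "\<And>i. i \<ge> n * d - t \<Longrightarrow> Polynomial.coeff (S ^ n) i = Polynomial.coeff R i" by auto
    define j where "j = d - Suc t"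
    have j: "j < d" "n * d - Suc t = (n - 1) * d + j" "n * d - t = Suc ((n - 1) * d + j)"
      using Suc.prems n by (cases n; simp add: j_def)+
    obtain a where a: "of_nat n * a = Polynomial.coeff R ((n - 1) * d + j) - Polynomial.coeff (S ^ n) ((n - 1) * d + j)"
      using div by blast
    define S' where "S' = S + Polynomial.monom a j"
    have deg: "degree S' = d" unfolding S'_def
      by (subst degree_add_eq_left) (use j S degree_monom_le[of a j] in auto)
    have lead: "lead_coeff S' = 1" unfolding deg using S j by (simp add: S'_def)
    obtain W where W: "S' ^ n - S ^ n = (S' - S) * W" "degree W = (n - 1) * d" "lead_coeff W = of_nat n"
      using monic_power_diff_factor[OF lead deg S n] .
    have W1: "Polynomial.coeff (S' ^ n) i = Polynomial.coeff (S ^ n) i + Polynomial.coeff (Polynomial.monom a j * W) i" for i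
    proof -
      have "S' ^ n = S ^ n + Polynomial.monom a j * W" using W(1) by (simp add: S'_def algebra_simps)
      thus ?thesis by simp
    qed
    show ?case
    proof (intro exI[of _ S'] conjI allI impI lead deg)
      fix i assume i: "n * d - Suc t \<le> i"
      show "Polynomial.coeff (S' ^ n) i = Polynomial.coeff R i"
      proof (cases "i = (n - 1) * d + j")
        case True
        have "Polynomial.coeff (Polynomial.monom a j * W) i = a * of_nat n"
          using W by (simp add: True coeff_monom_mult)
        thus ?thesis unfolding W1 True using a by (simp add: mult.commute)
      next
        case False
        hence i: "i > (n - 1) * d + j" using i j by simp
        have "Polynomial.coeff (Polynomial.monom a j * W) i = 0"
          using i W by (simp add: coeff_monom_mult coeff_eq_0)
        thus ?thesis unfolding W1 using c[of i] i j by simp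
      qed
    qed
  qed
  from this[of d] obtain S where S: "lead_coeff S = 1" "degree S = d"
    "\<And>i. i \<ge> n * d - d \<Longrightarrow> Polynomial.coeff (S ^ n) i = Polynomial.coeff R i" by auto
  moreover have "n * d - d = (n - 1) * d" using n by (simp add: diff_mult_distrib)
  ultimately show ?thesis by auto
qed

text \<open>Every point of S has exact period n, so S decomposes into full orbits of size n; one
  orbit is removed at a time and contributes the n-th power of the value at one of its
  points.\<close>

lemma orbit_representatives:
  fixes f :: "'a \<Rightarrow> 'a" and h :: "'a \<Rightarrow> 'b :: comm_monoid_mult"
  assumes n: "n > 0" and "finite S" and "\<And>z. z \<in> S \<Longrightarrow> f z \<in> S"
    and "\<And>z d. z \<in> S \<Longrightarrow> (f ^^ d) z = z \<longleftrightarrow> n dvd d"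
    and h: "\<And>z. z \<in> S \<Longrightarrow> h (f z) = h z"
  shows "\<exists>T\<subseteq>S. card S = n * card T \<and> (\<Prod>z\<in>S. h z) = (\<Prod>z\<in>T. h z) ^ n"
  using assms(2-)
proof (induction "card S" arbitrary: S rule: less_induct)
  case less
  show ?case
  proof (cases "S = {}")
    case True
    thus ?thesis by auto
  next
    case False
    then obtain z where z: "z \<in> S" by blast
    define O' where "O' = (\<lambda>i. (f ^^ i) z) ` {..<n}"
    have inS: "(f ^^ i) z \<in> S" for i by (induction i) (auto simp: z less.prems(2))
    have hz: "h ((f ^^ i) z) = h z" for i by (induction i) (auto simp: less.prems(4)[OF inS])
    have inj: "inj_on (\<lambda>i. (f ^^ i) z) {..<n}"
    proof -
      have "i = j" if "i \<le> j" "j < n" "(f ^^ i) z = (f ^^ j) z" for i j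
      proof -
        have "(f ^^ (n - j + i)) z = (f ^^ (n - j)) ((f ^^ j) z)" by (simp add: funpow_add that)
        also have "\<dots> = (f ^^ (n - j + j)) z" by (simp only: funpow_add o_apply)
        also have "\<dots> = z" using that less.prems(3)[OF z, of n] by simp
        finally have "n dvd n - j + i" using less.prems(3)[OF z] by blast
        moreover have "n - j + i > 0" "n - j + i \<le> n" using that by auto
        ultimately have "n - j + i = n" using dvd_imp_le by (metis le_antisym)
        thus ?thesis using that by simp
      qed
      thus ?thesis unfolding inj_on_def by (metis lessThan_iff nle_le)
    qed
    have O: "finite O'" "card O' = n" "O' \<subseteq> S" using inj inS by (auto simp: O'_def card_image)
    have closed: "f w \<in> S - O'" if w: "w \<in> S - O'" for w
    proof -
      have "f w \<notin> O'"
      proof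
        assume "f w \<in> O'"
        then obtain i where i: "f w = (f ^^ i) z" by (auto simp: O'_def)
        have "w = (f ^^ (n - 1 + 1)) w" using less.prems(3)[of w n] w n by simp
        also have "\<dots> = (f ^^ (n - 1)) (f w)" by (simp only: funpow_add o_apply One_nat_def funpow.simps id_apply)
        also have "\<dots> = (f ^^ (n - 1 + i)) z" by (simp add: i funpow_add)
        also have "\<dots> = (f ^^ ((n - 1 + i) mod n)) z"
          using funpow_mod_eq[of n f z] less.prems(3)[OF z, of n] by simp
        also have "\<dots> \<in> O'" using n by (auto simp: O'_def)
        finally show False using w by simp
      qed
      thus ?thesis using w less.prems by blast
    qed
    have cS: "card S = n + card (S - O')"
      using O card_mono[OF less.prems(1) O(3)] by (simp add: card_Diff_subset)
    have "\<exists>T\<subseteq>S - O'. card (S - O') = n * card T \<and> (\<Prod>z\<in>S - O'. h z) = (\<Prod>z\<in>T. h z) ^ n"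
      by (rule less.hyps) (use less.prems closed cS n in auto)
    then obtain T where T: "T \<subseteq> S - O'" "card (S - O') = n * card T" "(\<Prod>z\<in>S - O'. h z) = (\<Prod>z\<in>T. h z) ^ n" by blast
    have finT: "finite T" using T(1) less.prems(1) by (auto intro: finite_subset)
    have zT: "z \<notin> T" using T(1) n by (auto simp: O'_def image_iff) (use n in force)
    have "(\<Prod>z\<in>S. h z) = (\<Prod>z\<in>S - O'. h z) * (\<Prod>z\<in>O'. h z)"
      by (rule prod.subset_diff[OF O(3) less.prems(1)])
    also have "(\<Prod>z\<in>O'. h z) = h z ^ n"
      unfolding O'_def by (subst prod.reindex[OF inj]) (simp add: hz)
    finally have "(\<Prod>z\<in>S. h z) = (\<Prod>z\<in>insert z T. h z) ^ n"
      using T finT zT by (simp add: power_mult_distrib mult.commute)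
    moreover have "card S = n * card (insert z T)" using cS T finT zT by simp
    ultimately show ?thesis using T z by (intro exI[of _ "insert z T"]) auto
  qed
qed

section \<open>Multipliers along a cycle and the polynomial delta\<close>

lemma multiplier_Suc_shift: "2 * (qmap c ^^ n) z * multiplier c n z = multiplier c n (qmap c z) * (2 * z)"
proof -
  have "(\<Prod>i<Suc n. 2 * (qmap c ^^ i) z) = 2 * z * (\<Prod>i<n. 2 * (qmap c ^^ Suc i) z)"
    by (subst prod.lessThan_Suc_shift) simp
  moreover have "(qmap c ^^ Suc i) z = (qmap c ^^ i) (qmap c z)" for i by (simp only: funpow_Suc_right o_apply)
  ultimately show ?thesis unfolding multiplier_def by (simp add: mult_ac del: funpow.simps)
qed

text \<open>Shifting along the cycle only permutes the factors, which is proved by cancelling 2 z.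
  When z = 0 this is impossible, but then the critical point lies on the cycle and both multipliers
  vanish.\<close>

lemma multiplier_periodic_shift:
  assumes z: "(qmap c ^^ n) z = z"
  shows "multiplier c n (qmap c z) = multiplier c n z"
proof (cases "n = 0 \<or> z \<noteq> 0")
  case True
  thus ?thesis using multiplier_Suc_shift[of n c z] z by (auto simp: multiplier_def)
next
  case False
  hence n: "n > 0" and z0: "z = 0" by auto
  have "multiplier c n z = 0" unfolding multiplier_def using n z0 by (intro prod_zero) (auto intro!: bexI[of _ 0])
  moreover have "multiplier c n (qmap c z) = 0" unfolding multiplier_def
  proof (intro prod_zero bexI[of _ "n - 1"])
    have "(qmap c ^^ (n - 1)) (qmap c z) = (qmap c ^^ Suc (n - 1)) z" by (simp only: funpow_Suc_right o_apply)
    also have "\<dots> = 0" using n z z0 by simp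
    finally show "2 * (qmap c ^^ (n - 1)) (qmap c z) = 0" by simp
  qed (use n in auto)
  ultimately show ?thesis by simp
qed

lemma per_closed:
  assumes z: "z \<in> per c n" and pos: "n > 0"
  shows "qmap c z \<in> per c n"
  unfolding per_def
proof (intro CollectI allI)
  fix d
  have n: "(qmap c ^^ n) z = z" using per_iff[OF z, of n] by simp
  have sh: "(qmap c ^^ d) (qmap c z) = qmap c ((qmap c ^^ d) z)" for d using funpow_swap1[of "qmap c" d z] by simp
  show "(qmap c ^^ d) (qmap c z) = qmap c z \<longleftrightarrow> n dvd d"
  proof
    assume "n dvd d"
    thus "(qmap c ^^ d) (qmap c z) = qmap c z" using per_iff[OF z, of d] unfolding sh by simp
  next
    assume a: "(qmap c ^^ d) (qmap c z) = qmap c z"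
    show "n dvd d"
    proof -
      have "(qmap c ^^ (n + d)) z = (qmap c ^^ (n - 1 + d)) (qmap c z)"
        using pos by (cases n) (simp_all only: add_Suc diff_Suc_1 funpow_Suc_right o_apply less_irrefl)
      also have "\<dots> = (qmap c ^^ (n - 1)) (qmap c z)" using a by (simp only: funpow_add o_apply)
      also have "\<dots> = (qmap c ^^ n) z" using pos by (cases n) (simp_all only: funpow_Suc_right o_apply diff_Suc_1 less_irrefl)
      finally have "(qmap c ^^ (n + d)) z = z" using n by simp
      thus ?thesis using per_iff[OF z, of "n + d"] by simp
    qed
  qed
qed

definition dyn_res :: "nat \<Rightarrow> rat poly poly" where
  "dyn_res n = resultant (dynatomic n) ([:xvar:] - pderiv (fiter n))"

lemma evx_dyn_res:
  assumes n: "n > 0" and good: "good n c"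
  shows "evx c (dyn_res n) = (\<Prod>z\<in>per c n. [:- multiplier c n z, 1:])"
proof -
  have "poly (evx c (dyn_res n)) x = poly (\<Prod>z\<in>per c n. [:- multiplier c n z, 1:]) x" for x
  proof -
    have m1: "map_poly (ev c x) (dynatomic n) = root_prod (mset_set (per c n))"
      unfolding root_prod_mset_set by (rule dynatomic_props(2)[OF n good])
    have m2: "map_poly (ev c x) ([:xvar:] - pderiv (fiter n)) = [:x:] - pderiv (itp c n)"
      by (simp add: hom_distribs map_poly_ev_fiter ev_xvar)
    have d1: "degree (map_poly (ev c x) (dynatomic n)) = degree (dynatomic n)"
      by (rule degree_map_poly) (use dynatomic_props(1)[OF n] in auto)
    have d2: "degree (map_poly (ev c x) ([:xvar:] - pderiv (fiter n))) = degree ([:xvar:] - pderiv (fiter n))"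
      unfolding m2 by (simp only: monic_pderiv(3)[OF itp_monic n] monic_pderiv(3)[OF fiter_monic n])
    have "poly (evx c (dyn_res n)) x = ev c x (dyn_res n)" by (simp add: ev_def)
    also have "\<dots> = resultant (root_prod (mset_set (per c n))) ([:x:] - pderiv (itp c n))"
      unfolding dyn_res_def ev.resultant_map_poly[OF d1 d2, symmetric] m1 m2 ..
    also have "\<dots> = (\<Prod>z\<in>per c n. x - multiplier c n z)"
      by (simp add: resultant_root_prod poly_pderiv_itp prod_unfold_prod_mset)
    finally show ?thesis by (simp add: poly_prod)
  qed
  thus ?thesis by (simp add: poly_eq_poly_eq_iff[symmetric] fun_eq_iff)
qed

lemma monic_prod_linear:
  "lead_coeff (\<Prod>z\<in>T. [:- h z, 1 :: 'a :: idom:]) = 1" "degree (\<Prod>z\<in>T. [:- h z, 1 :: 'a :: idom:]) = card T"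
  by (simp add: lead_coeff_prod) (subst degree_prod_eq_sum_degree, auto)

lemma card_per:
  assumes n: "n > 0" and good: "good n c"
  shows "card (per c n) = degree (dynatomic n)"
proof -
  have "degree (map_poly (ev c 0) (dynatomic n)) = degree (dynatomic n)"
    by (rule degree_map_poly) (use dynatomic_props(1)[OF n] in auto)
  thus ?thesis unfolding dynatomic_props(2)[OF n good] monic_prod_linear .
qed

lemma multiplier_representatives:
  assumes n: "n > 0"
  shows "\<exists>T\<subseteq>per c n. card (per c n) = n * card T \<and>
    (\<Prod>z\<in>per c n. [:- multiplier c n z, 1:]) = (\<Prod>z\<in>T. [:- multiplier c n z, 1:]) ^ n"
proof (rule orbit_representatives[OF n finite_per[OF n], where f = "qmap c"])
  fix z assume z: "z \<in> per c n"
  have "(qmap c ^^ n) z = z" using per_iff[OF z, of n] by simp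
  thus "[:- multiplier c n (qmap c z), 1:] = [:- multiplier c n z, 1:]" by (simp add: multiplier_periodic_shift)
qed (use per_closed n per_iff in blast)+

lemma coeff_evx: "Polynomial.coeff (evx c q) i = evc c (Polynomial.coeff q i)"
  by (simp add: evx_def)

text \<open>At a good c the defining resultant is the n-th power of \<open>D c\<close>, a product
  over cycle representatives, but the choice of representatives is made separately for each c. A
  candidate S that is polynomial in c comes from \<open>exists_truncated_root\<close>;
  \<open>monic_power_inj\<close> shows that it specialises to \<open>D c\<close>, so S^n equals the
  resultant, and also that the description of \<open>delta\<close> has no other solution.\<close>

lemma delta_props:
  assumes n: "n > 0"
  shows "lead_coeff (delta n) = 1"
    and "degree (dynatomic n) = n * degree (delta n)"
    and "good n c \<Longrightarrow> \<exists>T\<subseteq>per c n. card T = degree (delta n) \<and> evx c (delta n) = (\<Prod>z\<in>T. [:- multiplier c n z, 1:])"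
proof -
  define N where "N = degree (dynatomic n)"
  define d where "d = N div n"
  have "\<exists>T. \<forall>c. T c \<subseteq> per c n \<and> card (per c n) = n * card (T c) \<and>
    (\<Prod>z\<in>per c n. [:- multiplier c n z, 1:]) = (\<Prod>z\<in>T c. [:- multiplier c n z, 1:]) ^ n"
    by (intro choice allI multiplier_representatives[OF n])
  then obtain T where T: "\<And>c. T c \<subseteq> per c n" "\<And>c. card (per c n) = n * card (T c)"
    "\<And>c. (\<Prod>z\<in>per c n. [:- multiplier c n z, 1:]) = (\<Prod>z\<in>T c. [:- multiplier c n z, 1:]) ^ n" by blast
  define D where "D = (\<lambda>c. \<Prod>z\<in>T c. [:- multiplier c n z, 1:])"
  have cT: "card (T c) = d" if "good n c" for c
    using T(2)[of c] card_per[OF n that] n by (simp add: d_def N_def)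
  have Nd: "N = n * d" using T(2)[of 0] cT[OF good_0] card_per[OF n good_0] by (simp add: N_def)
  have D: "lead_coeff (D c) = 1" "degree (D c) = d" if "good n c" for c
    unfolding D_def by (rule monic_prod_linear) (simp only: monic_prod_linear(2) cT[OF that])
  have res: "evx c (dyn_res n) = D c ^ n" if "good n c" for c
    unfolding evx_dyn_res[OF n that] T(3) D_def ..
  have resc: "evc c (Polynomial.coeff (dyn_res n) i) = Polynomial.coeff (D c ^ n) i" if "good n c" for c i
    using arg_cong[OF res[OF that], of "\<lambda>p. Polynomial.coeff p i"] by (simp add: coeff_evx)
  have Dn: "degree (D c ^ n) = N" "lead_coeff (D c ^ n) = 1" if "good n c" for c
    using D[OF that] monic_nonzero[OF D(1)[OF that]] lead_coeff_power[of "D c" n]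
    by (simp_all add: degree_power_eq Nd del: lead_coeff_power)
  have high: "Polynomial.coeff (dyn_res n) i = 0" if "i > N" for i
    by (rule evc_eq_0_infinite[OF infinite_good[of n]]) (use that Dn resc in \<open>auto simp: coeff_eq_0\<close>)
  have "Polynomial.coeff (dyn_res n) N - 1 = 0"
  proof (rule evc_eq_0_infinite[OF infinite_good[of n]])
    fix c assume "c \<in> {c. good n c}"
    hence g: "good n c" by simp
    show "evc c (Polynomial.coeff (dyn_res n) N - 1) = 0"
      using Dn[OF g] resc[OF g, of N] by (simp add: hom_distribs)
  qed
  hence lead: "Polynomial.coeff (dyn_res n) N = 1" by simp
  have degR: "degree (dyn_res n) = n * d" unfolding Nd[symmetric]
    by (intro antisym degree_le le_degree) (use high lead in auto)
  have leadR: "lead_coeff (dyn_res n) = 1" using lead by (simp add: degR Nd)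
  have "\<exists>a. of_nat n * a = b" for b :: "rat poly"
    by (intro exI[of _ "Polynomial.smult (1 / of_nat n) b"]) (use n in \<open>simp add: of_nat_poly\<close>)
  from exists_truncated_root[OF this n degR leadR]
  obtain S where S: "lead_coeff S = 1" "degree S = d"
    and c: "\<And>i. (n - 1) * d \<le> i \<Longrightarrow> Polynomial.coeff (S ^ n) i = Polynomial.coeff (dyn_res n) i" by blast
  have SD: "evx c S = D c" if g: "good n c" for c
  proof (rule monic_power_inj[OF evx_monic(1)[OF S(1)] _ D[OF g] n])
    show "degree (evx c S) = d" using evx_monic(2)[OF S(1)] S by simp
    fix i assume "(n - 1) * d \<le> i"
    thus "Polynomial.coeff (evx c S ^ n) i = Polynomial.coeff (D c ^ n) i"
      using arg_cong[OF c, of i "evc c"] resc[OF g, of i] by (simp add: coeff_evx flip: evx.hom_power)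
  qed
  have Sn: "S ^ n = dyn_res n"
    by (rule evx_eq_infinite[OF infinite_good[of n]]) (use SD res in \<open>auto simp: evx.hom_power\<close>)
  have "delta n = S"
    unfolding delta_def dyn_res_def[symmetric]
  proof (rule the_equality)
    show "lead_coeff S = 1 \<and> S ^ n = dyn_res n" using S Sn by blast
  next
    fix e assume e: "lead_coeff e = 1 \<and> e ^ n = dyn_res n"
    have le: "lead_coeff e = 1" and en: "e ^ n = dyn_res n" using e by blast+
    have "n * degree e = degree (e ^ n)" using monic_nonzero[OF le] by (simp add: degree_power_eq)
    also have "\<dots> = n * d" unfolding en by (rule degR)
    finally have de: "degree e = d" using n by simp
    show "e = S" by (rule monic_power_inj[OF le de S n]) (simp add: en Sn)
  qed
  note delta = this
  show "lead_coeff (delta n) = 1" unfolding delta by (rule S(1))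
  show "degree (dynatomic n) = n * degree (delta n)" using S(2) Nd unfolding delta N_def by simp
  show "\<exists>T\<subseteq>per c n. card T = degree (delta n) \<and> evx c (delta n) = (\<Prod>z\<in>T. [:- multiplier c n z, 1:])"
    if g: "good n c"
  proof (intro exI[of _ "T c"] conjI T(1))
    show "card (T c) = degree (delta n)" unfolding delta S(2) by (rule cT[OF g])
    show "evx c (delta n) = (\<Prod>z\<in>T c. [:- multiplier c n z, 1:])" using SD[OF g] unfolding delta D_def .
  qed
qed

section \<open>Integrality in 4c\<close>

lemma periodic_mod:
  assumes "\<And>i. u (i + m) = u (i :: nat)"
  shows "u i = u (i mod m)"
proof -
  have "u (r + m * t) = u r" for r t
  proof (induction t)
    case (Suc t)
    have "r + m * Suc t = r + m * t + m" by simp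
    thus ?case using assms[of "r + m * t"] Suc by metis
  qed simp
  from this[of "i mod m" "i div m"] show ?thesis by simp
qed

text \<open>The module spanned by C^k times squarefree monomials in u_0, ..., u_(m-1) is finitely
  generated and stable under each u_j: a repeated factor is removed by the relation for its
  square.\<close>

lemma algebraic_int_orbit:
  fixes u :: "nat \<Rightarrow> 'a :: field_char_0"
  assumes C: "algebraic_int C" and m: "m > 0" and per: "\<And>i. u (i + m) = u i"
    and rec: "\<And>i. u i * u i = 2 * u (Suc i) - C"
  shows "algebraic_int (u i)"
proof -
  from algebraic_int_power_reduce[OF C] obtain q f where q: "q > 0" "C ^ q = (\<Sum>i<q. of_int (f i) * C ^ i)" .
  define mon where "mon = (\<lambda>(k, I). C ^ k * (\<Prod>i\<in>I. u i))"
  define B where "B = mon ` ({..<q} \<times> Pow {..<m})"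
  have fin: "finite B" by (simp add: B_def)
  have one: "1 \<in> B" unfolding B_def mon_def using q by (intro image_eqI[of _ _ "(0, {})"]) auto
  have mon: "C ^ k * prod u I \<in> int_span B" if "k < q" "I \<subseteq> {..<m}" for k I
    by (rule int_span_base) (use that in \<open>auto simp: B_def mon_def intro!: image_eqI[of _ _ "(k, I)"]\<close>)
  have base: "C * (C ^ k * prod u I) \<in> int_span B" if k: "k < q" and I: "I \<subseteq> {..<m}" for k I
  proof (cases "Suc k < q")
    case True
    thus ?thesis using mon[OF True I] by (simp add: mult.assoc)
  next
    case False
    hence "Suc k = q" using k by simp
    hence "C * (C ^ k * prod u I) = (\<Sum>i<q. of_int (f i) * (C ^ i * prod u I))"
      using q(2) by (simp add: mult.assoc[symmetric] sum_distrib_right flip: power_Suc)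
    also have "\<dots> \<in> int_span B" by (intro int_span_sum int_span_scale mon) (use I in auto)
    finally show ?thesis .
  qed
  have Cmul: "C * x \<in> int_span B" if "x \<in> int_span B" for x
    by (rule int_span_mult[OF that]) (use base in \<open>auto simp: B_def mon_def\<close>)
  have umod: "u i = u (i mod m)" for i by (rule periodic_mod[of u m, OF per])
  have step: "u j * (C ^ k * prod u I) \<in> int_span B" if "k < q" "I \<subseteq> {..<m}" for j k I
    using that(2)
  proof (induction "card I" arbitrary: I j rule: less_induct)
    case less
    define i where "i = j mod m"
    have i: "u j = u i" "i < m" using umod[of j] m by (simp_all add: i_def)
    have finI: "finite I" using less.prems by (auto intro: finite_subset)
    show ?case
    proof (cases "i \<in> I")
      case False
      hence eq: "u j * (C ^ k * prod u I) = C ^ k * prod u (insert i I)" using finI i by simp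
      show ?thesis unfolding eq by (rule mon) (use that(1) less.prems i in auto)
    next
      case True
      define J where "J = I - {i}"
      have J: "card J < card I" "J \<subseteq> {..<m}" using card_Diff1_less[OF finI True] less.prems by (auto simp: J_def)
      have "prod u I = u i * prod u J" using True finI by (simp add: J_def prod.remove)
      hence "u j * (C ^ k * prod u I) = (u i * u i) * (C ^ k * prod u J)" using i by simp
      \<comment> \<open>The square is traded for a multiple of u_(i+1) and a multiple of C, each
        acting on the monomial over J, which has one factor fewer; this is why the induction is on
        the size of I.\<close>
      also have "\<dots> = of_int 2 * (u (Suc i) * (C ^ k * prod u J)) + of_int (-1) * (C * (C ^ k * prod u J))"
        unfolding rec by (simp add: algebra_simps)
      also have "\<dots> \<in> int_span B"
        by (intro int_span_add int_span_scale less.hyps[OF J] base[OF that(1) J(2)])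
      finally show ?thesis .
    qed
  qed
  have "u i * b \<in> int_span B" if "b \<in> B" for b
    using that step by (auto simp: B_def mon_def)
  thus ?thesis by (intro algebraic_int_if_finite_span[OF fin one] int_span_finite[OF _ fin])
qed

lemma orbit_rec:
  assumes z: "(qmap (C / 4) ^^ m) z = z" and u_def: "u = (\<lambda>i. 2 * (qmap (C / 4) ^^ i) z)"
  shows "u (i + m) = u i" "u i * u i = 2 * u (Suc i) - C" "multiplier (C / 4) m z = (\<Prod>i<m. u i)"
  using z by (simp_all add: u_def funpow_add qmap_def power2_eq_square multiplier_def)

lemma algebraic_int_multiplier:
  assumes C: "algebraic_int C" and m: "m > 0" and z: "(qmap (C / 4) ^^ m) z = z"
  shows "algebraic_int (multiplier (C / 4) m z)"
  unfolding orbit_rec(3)[OF z refl]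
  by (intro algebraic_int_prod algebraic_int_orbit[OF C m] orbit_rec(1,2)[OF z refl])

lemma algebraic_int_coeff_prod_linear:
  fixes h :: "'b \<Rightarrow> 'a :: field_char_0"
  assumes "\<And>z. z \<in> T \<Longrightarrow> algebraic_int (h z)"
  shows "algebraic_int (Polynomial.coeff (\<Prod>z\<in>T. [:- h z, 1:]) i)"
  using assms
proof (induction T arbitrary: i rule: infinite_finite_induct)
  case (insert z T)
  have "algebraic_int (Polynomial.coeff [:- h z, 1:] k)" for k
    using insert.prems by (auto simp: coeff_pCons split: nat.splits)
  thus ?case using insert
    by (simp add: coeff_mult algebraic_int_sum algebraic_int_add_mult del: mult_pCons_left)
qed (auto simp: coeff_1)

lemma cis_power_eq_1_iff:
  fixes q l :: nat
  assumes "q > 0"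
  shows "cis (2 * pi / q) ^ l = 1 \<longleftrightarrow> q dvd l"
proof -
  have "cis (2 * pi / q) ^ l = exp (of_nat l * (\<i> * of_real (2 * pi / real q)))"
    unfolding exp_of_nat_mult cis_conv_exp ..
  also have "of_nat l * (\<i> * of_real (2 * pi / real q)) = 2 * of_real pi * \<i> * of_nat l / (of_nat q :: complex)"
    by simp
  finally show ?thesis using complex_root_unity_eq_1[of q l] assms by simp
qed

text \<open>Averaging p over the q-th roots of unity on the circle of radius q isolates one
  coefficient: q^(j+1) times the j-th coefficient is an algebraic integer and rational, hence an
  integer. Two coprime values of q remove the power of q.\<close>

lemma integer_coeffs_if_algebraic_int_values:
  fixes p :: "rat poly"
  assumes fin: "finite S" and val: "\<And>C. algebraic_int C \<Longrightarrow> C \<notin> S \<Longrightarrow> algebraic_int (evc C p)"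
  shows "Polynomial.coeff p j \<in> \<int>"
proof -
  from fin obtain K where K: "\<And>s. s \<in> S \<Longrightarrow> norm s \<le> K" using finite_imp_bounded[OF fin] bounded_iff by metis
  \<comment> \<open>The bound K keeps circles of radius q >= M away from S; the other two bounds
    ensure 0 < i + (q - j) < 2 q for i <= degree p, so that only i = j survives the
    averaging.\<close>
  obtain M :: nat where M: "real M > K" "M > degree p" "M > j"
  proof -
    obtain M1 :: nat where M1: "real M1 > K" using reals_Archimedean2 by blast
    show ?thesis by (rule that[of "M1 + degree p + j + 1"]) (use M1 in auto)
  qed
  have key: "Polynomial.coeff p j * of_nat (q ^ Suc j) \<in> \<int>" if q: "q \<ge> M" for q
  proof -
    have q0: "q > 0" using q M by simp
    define w where "w = cis (2 * pi / q)"
    have wl: "w ^ l = 1 \<longleftrightarrow> q dvd l" for l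
      unfolding w_def by (rule cis_power_eq_1_iff[OF q0])
    have sumw: "(\<Sum>k<q. (w ^ k) ^ l) = (if q dvd l then of_nat q else 0)" for l
    proof -
      have "(\<Sum>k<q. (w ^ k) ^ l) = (\<Sum>k<q. (w ^ l) ^ k)" by (simp add: power_mult[symmetric] mult.commute)
      also have "\<dots> = (if q dvd l then of_nat q else 0)"
      proof (cases "q dvd l")
        case True
        thus ?thesis using wl[of l] by simp
      next
        case False
        moreover have "(w ^ l) ^ q = 1" using wl[of "l * q"] by (simp add: power_mult)
        ultimately show ?thesis using wl[of l] geometric_sum[of "w ^ l" q] by simp
      qed
      finally show ?thesis .
    qed
    \<comment> \<open>The exponent q - j stands for -j, since w^q = 1.\<close>
    define X where "X = (\<Sum>k<q. (w ^ k) ^ (q - j) * evc (of_nat q * w ^ k) p)"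
    have wint: "algebraic_int (w ^ k)" for k
    proof -
      have "algebraic_int w"
        by (rule algebraic_int_root[of 1 "Polynomial.monom 1 q"])
          (use wl[of q] q0 in \<open>auto simp: poly_monom degree_monom_eq\<close>)
      thus ?thesis by (rule algebraic_int_power)
    qed
    have normw: "norm (w ^ k) = 1" for k by (simp add: w_def norm_power)
    have "algebraic_int X" unfolding X_def
    proof (intro algebraic_int_sum algebraic_int_add_mult(2) algebraic_int_power[OF wint] wint val algebraic_int_of_nat)
      fix k
      show "of_nat q * w ^ k \<notin> S"
      proof
        assume "of_nat q * w ^ k \<in> S"
        from K[OF this] have "real q \<le> K" by (simp add: norm_mult normw)
        thus False using M(1) q by simp
      qed
    qed
    moreover have "X = of_rat (Polynomial.coeff p j * of_nat (q ^ Suc j))"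
    proof -
      have "X = (\<Sum>k<q. \<Sum>i\<le>degree p. of_rat (Polynomial.coeff p i) * of_nat q ^ i * (w ^ k) ^ (i + (q - j)))"
        unfolding X_def evc_def
        by (intro sum.cong) (auto simp: poly_altdef sum_distrib_left power_mult_distrib power_add mult_ac)
      also have "\<dots> = (\<Sum>i\<le>degree p. of_rat (Polynomial.coeff p i) * of_nat q ^ i * (\<Sum>k<q. (w ^ k) ^ (i + (q - j))))"
        by (subst sum.swap) (simp add: sum_distrib_left)
      also have "\<dots> = (\<Sum>i\<le>degree p. if i = j then of_rat (Polynomial.coeff p i) * of_nat q ^ i * of_nat q else 0)"
      proof (rule sum.cong[OF refl])
        fix i assume i: "i \<in> {..degree p}"
        have "q dvd i + (q - j) \<longleftrightarrow> i = j"
        proof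
          assume a: "q dvd i + (q - j)"
          have lt: "i < q" "j < q" using i q M by auto
          show "i = j"
          proof (rule ccontr)
            assume ne: "i \<noteq> j"
            from a obtain t where t: "i + (q - j) = q * t" by blast
            have "t < 2"
            proof -
              have "q * t < q * 2" using lt unfolding t[symmetric] by linarith
              thus ?thesis by simp
            qed
            moreover have "t \<noteq> 0" using t lt by (intro notI) simp
            ultimately have "t = 1" by simp
            thus False using t lt ne by simp
          qed
        qed (use q M in simp)
        thus "of_rat (Polynomial.coeff p i) * of_nat q ^ i * (\<Sum>k<q. (w ^ k) ^ (i + (q - j)))
          = (if i = j then of_rat (Polynomial.coeff p i) * of_nat q ^ i * of_nat q else 0)"
          unfolding sumw by simp
      qed
      also have "\<dots> = of_rat (Polynomial.coeff p j * of_nat (q ^ Suc j))"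
        by (cases "j \<le> degree p") (simp_all add: coeff_eq_0 of_rat_mult of_rat_power mult_ac)
      finally show ?thesis .
    qed
    ultimately have "(of_rat (Polynomial.coeff p j * of_nat (q ^ Suc j)) :: complex) \<in> \<int>"
      by (intro rational_algebraic_int_is_int) auto
    then obtain t where "(of_rat (Polynomial.coeff p j * of_nat (q ^ Suc j)) :: complex) = of_int t" by (auto elim: Ints_cases)
    hence "(of_rat (Polynomial.coeff p j * of_nat (q ^ Suc j)) :: complex) = of_rat (of_int t)" by simp
    hence "Polynomial.coeff p j * of_nat (q ^ Suc j) = of_int t" by (simp only: of_rat_eq_iff)
    thus ?thesis by simp
  qed
  \<comment> \<open>Consecutive radii M and M + 1 are coprime, and so are their powers; a Bezout
    combination of the two integers is the coefficient itself.\<close>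
  have "coprime (M ^ Suc j) (Suc M ^ Suc j)" by (simp only: coprime_power_left_iff coprime_power_right_iff) simp
  hence "coprime (int (M ^ Suc j)) (int (Suc M ^ Suc j))" by (simp only: coprime_int_iff)
  then obtain x y where xy: "x * int (M ^ Suc j) + y * int (Suc M ^ Suc j) = 1"
    using bezout_int[of "int (M ^ Suc j)" "int (Suc M ^ Suc j)"] by (auto simp: coprime_iff_gcd_eq_1)
  have "of_int x * (Polynomial.coeff p j * of_nat (M ^ Suc j)) + of_int y * (Polynomial.coeff p j * of_nat (Suc M ^ Suc j)) \<in> \<int>"
    using key[of M] key[of "Suc M"] by (intro Ints_add Ints_mult[OF Ints_of_int]) auto
  also have "of_int x * (Polynomial.coeff p j * of_nat (M ^ Suc j)) + of_int y * (Polynomial.coeff p j * of_nat (Suc M ^ Suc j))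
    = Polynomial.coeff p j * of_int (x * int (M ^ Suc j) + y * int (Suc M ^ Suc j))"
    by (simp only: of_int_add of_int_mult of_int_of_nat_eq) (simp add: algebra_simps)
  finally show ?thesis unfolding xy by simp
qed

section \<open>Integrality of delta in terms of C\<close>

definition delta_coeff :: "nat \<Rightarrow> nat \<Rightarrow> rat poly" where
  "delta_coeff m i = pcompose (Polynomial.coeff (delta m) i) [:0, 1/4:]"

lemma evc_delta_coeff: "evc C (delta_coeff m i) = Polynomial.coeff (evx (C / 4) (delta m)) i"
  by (simp add: delta_coeff_def evc_def coeff_evx of_rat_hom.map_poly_pcompose poly_pcompose of_rat_divide)

lemma finite_not_good_scaled: "finite {C. \<not> good n (C / 4)}"
proof -
  have "{C. \<not> good n (C / 4)} = (\<lambda>c. 4 * c) ` {c. \<not> good n c}"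
    by (auto intro!: image_eqI[of _ _ "_ / 4"])
  thus ?thesis using finite_not_good by simp
qed

text \<open>At an algebraic integer C outside a finite set, the coefficients are polynomial
  expressions over Z in multipliers, which are algebraic integers.\<close>

lemma delta_coeff_int:
  assumes m: "m > 0"
  shows "Polynomial.coeff (delta_coeff m i) j \<in> \<int>"
proof (rule integer_coeffs_if_algebraic_int_values[OF finite_not_good_scaled[of m]])
  fix C :: complex assume C: "algebraic_int C" and "C \<notin> {C. \<not> good m (C / 4)}"
  hence g: "good m (C / 4)" by simp
  from delta_props(3)[OF m g] obtain T where T: "T \<subseteq> per (C / 4) m"
    "evx (C / 4) (delta m) = (\<Prod>z\<in>T. [:- multiplier (C / 4) m z, 1:])" by blast
  have "algebraic_int (multiplier (C / 4) m z)" if "z \<in> T" for z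
    by (rule algebraic_int_multiplier[OF C m]) (use T(1) that per_subset in blast)
  thus "algebraic_int (evc C (delta_coeff m i))"
    unfolding evc_delta_coeff T(2) by (rule algebraic_int_coeff_prod_linear)
qed

section \<open>Growth at infinity\<close>

lemma poly_over_power_tendsto:
  fixes r :: "real poly"
  assumes deg: "degree r \<le> n"
  shows "((\<lambda>t. poly r t / t ^ n) \<longlongrightarrow> Polynomial.coeff r n) at_top"
proof -
  have "((\<lambda>t::real. t ^ i / t ^ n) \<longlongrightarrow> (if i = n then 1 else 0)) at_top" if "i \<le> n" for i
  proof (cases "i = n")
    case True
    have "\<forall>\<^sub>F t::real in at_top. t ^ i / t ^ n = 1"
      using eventually_gt_at_top[of 0] by eventually_elim (simp add: True)
    thus ?thesis using True tendsto_eventually by auto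
  next
    case False
    have "filterlim (\<lambda>t::real. t ^ (n - i)) at_top at_top"
      by (rule filterlim_pow_at_top[OF _ filterlim_ident]) (use that False in auto)
    hence "((\<lambda>t::real. inverse (t ^ (n - i))) \<longlongrightarrow> 0) at_top"
      by (rule tendsto_inverse_0_at_top)
    moreover have "\<forall>\<^sub>F t::real in at_top. inverse (t ^ (n - i)) = t ^ i / t ^ n"
      using eventually_gt_at_top[of 0]
      by eventually_elim (use that in \<open>simp add: field_simps flip: power_add\<close>)
    ultimately show ?thesis using False by (auto elim: Lim_transform_eventually)
  qed
  hence "((\<lambda>t. \<Sum>i\<le>n. Polynomial.coeff r i * (t ^ i / t ^ n)) \<longlongrightarrow>
      (\<Sum>i\<le>n. Polynomial.coeff r i * (if i = n then 1 else 0))) at_top"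
    by (intro tendsto_sum tendsto_mult tendsto_const) auto
  moreover have "(\<Sum>i\<le>n. Polynomial.coeff r i * (t ^ i / t ^ n)) = poly r t / t ^ n" for t
    unfolding poly_altdef sum_divide_distrib
    by (rule sum.mono_neutral_cong_right) (use deg in \<open>auto simp: coeff_eq_0\<close>)
  moreover have "(\<Sum>i\<le>n. Polynomial.coeff r i * (if i = n then 1 else 0)) = (\<Sum>i\<in>{n}. Polynomial.coeff r i)"
    by (rule sum.mono_neutral_cong_right) auto
  ultimately show ?thesis by simp
qed

lemma poly_growth:
  fixes r :: "real poly"
  assumes lim: "((\<lambda>t. \<bar>poly r t\<bar> / t ^ n) \<longlongrightarrow> L) at_top"
  shows "degree r \<le> n" "\<bar>Polynomial.coeff r n\<bar> = L"
proof -
  have abs: "((\<lambda>t. \<bar>poly r t\<bar> / t ^ k) \<longlongrightarrow> \<bar>Polynomial.coeff r k\<bar>) at_top" if "degree r \<le> k" for k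
  proof (rule Lim_transform_eventually[OF tendsto_rabs[OF poly_over_power_tendsto[OF that]]])
    show "\<forall>\<^sub>F t in at_top. \<bar>poly r t / t ^ k\<bar> = \<bar>poly r t\<bar> / t ^ k"
      using eventually_gt_at_top[of 0] by eventually_elim simp
  qed
  show deg: "degree r \<le> n"
  proof (rule ccontr)
    assume n: "\<not> degree r \<le> n"
    define k where "k = degree r"
    have "filterlim (\<lambda>t::real. t ^ (k - n)) at_top at_top"
      by (rule filterlim_pow_at_top[OF _ filterlim_ident]) (use n in \<open>auto simp: k_def\<close>)
    from tendsto_mult[OF lim tendsto_inverse_0_at_top[OF this]]
    have "((\<lambda>t. \<bar>poly r t\<bar> / t ^ n * inverse (t ^ (k - n))) \<longlongrightarrow> 0) at_top" by simp
    moreover have "\<forall>\<^sub>F t::real in at_top. \<bar>poly r t\<bar> / t ^ n * inverse (t ^ (k - n)) = \<bar>poly r t\<bar> / t ^ k"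
      using eventually_gt_at_top[of 0]
      by eventually_elim (use n in \<open>simp add: field_simps k_def flip: power_add\<close>)
    ultimately have "((\<lambda>t. \<bar>poly r t\<bar> / t ^ k) \<longlongrightarrow> 0) at_top" by (rule Lim_transform_eventually)
    from tendsto_unique[OF _ this abs[of k]] have "lead_coeff r = 0" by (simp add: k_def)
    thus False using n by simp
  qed
  show "\<bar>Polynomial.coeff r n\<bar> = L" using tendsto_unique[OF _ abs[OF deg] lim] by simp
qed

text \<open>With C = t^2 every u_i has modulus between t - 2 and t + 2. The upper bound comes from
  the largest modulus M on the cycle, which satisfies M^2 <= 2 M + t^2.\<close>

lemma multiplier_bounds:
  assumes t: "t \<ge> (4::real)" and m: "m > 0" and z: "(qmap ((of_real (t\<^sup>2)) / 4) ^^ m) z = z"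
  shows "(t - 2) ^ m \<le> norm (multiplier (of_real (t\<^sup>2) / 4) m z)" "norm (multiplier (of_real (t\<^sup>2) / 4) m z) \<le> (t + 2) ^ m"
proof -
  define u where "u = (\<lambda>i. 2 * (qmap (of_real (t\<^sup>2) / 4) ^^ i) z)"
  note rec = orbit_rec[OF z u_def]
  define M where "M = Max ((\<lambda>i. norm (u i)) ` {..<m})"
  have fin: "finite ((\<lambda>i. norm (u i)) ` {..<m})" "(\<lambda>i. norm (u i)) ` {..<m} \<noteq> {}" using m by auto
  have le: "norm (u i) \<le> M" for i
  proof -
    have "u i = u (i mod m)" by (rule periodic_mod[of u m, OF rec(1)])
    thus ?thesis unfolding M_def using m by (intro Max_ge) (auto intro!: image_eqI[of _ _ "i mod m"])
  qed
  have nC: "norm (of_real (t\<^sup>2) :: complex) = t\<^sup>2" by (simp add: norm_power)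
  have sq: "norm (u i) * norm (u i) = norm (2 * u (Suc i) - of_real (t\<^sup>2))" for i
    unfolding norm_mult[symmetric] rec(2) ..
  have "M \<in> (\<lambda>i. norm (u i)) ` {..<m}" unfolding M_def using fin by (rule Max_in)
  then obtain i0 where i0: "M = norm (u i0)" by auto
  have "M * M \<le> norm (2 * u (Suc i0)) + norm (of_real (t\<^sup>2) :: complex)"
    unfolding i0 sq by (rule norm_triangle_ineq4)
  hence MM: "M * M \<le> 2 * M + t\<^sup>2" using le[of "Suc i0"] unfolding nC by (simp add: norm_mult)
  have M0: "M \<ge> 0" unfolding i0 by simp
  have M: "M \<le> t + 2"
  proof (rule ccontr)
    assume "\<not> M \<le> t + 2"
    hence "(M - t - 2) * (M + t) \<ge> 0" using M0 t by (intro mult_nonneg_nonneg) auto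
    moreover have "(M - t - 2) * (M + t) = M * M - 2 * M - t\<^sup>2 - 2 * t" by (simp add: algebra_simps power2_eq_square)
    ultimately show False using MM t by linarith
  qed
  \<comment> \<open>The recursion gives |u_i|^2 >= t^2 - 2 (t + 2), and this is at least (t - 2)^2
    exactly when t >= 4.\<close>
  have lo: "t - 2 \<le> norm (u i)" for i
  proof (rule power2_le_imp_le)
    have "norm (of_real (t\<^sup>2) :: complex) - norm (2 * u (Suc i)) \<le> norm (of_real (t\<^sup>2) - 2 * u (Suc i))"
      by (rule norm_triangle_ineq2)
    hence "t\<^sup>2 - 2 * norm (u (Suc i)) \<le> (norm (u i))\<^sup>2"
      unfolding nC power2_eq_square[of "norm (u i)"] sq by (simp add: norm_mult norm_minus_commute)
    moreover have "norm (u (Suc i)) \<le> t + 2" using le[of "Suc i"] M by simp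
    moreover have "(t - 2)\<^sup>2 = t\<^sup>2 - 4 * t + 4" by (simp add: power2_eq_square algebra_simps)
    ultimately show "(t - 2)\<^sup>2 \<le> (norm (u i))\<^sup>2" using t by linarith
  qed simp
  have nm: "norm (multiplier (of_real (t\<^sup>2) / 4) m z) = (\<Prod>i<m. norm (u i))"
    unfolding rec(3) by (simp add: prod_norm)
  have "(\<Prod>i<m. t - 2) \<le> (\<Prod>i<m. norm (u i))" by (intro prod_mono) (use lo t in auto)
  thus "(t - 2) ^ m \<le> norm (multiplier (of_real (t\<^sup>2) / 4) m z)" unfolding nm by simp
  have "(\<Prod>i<m. norm (u i)) \<le> (\<Prod>i<m. t + 2)"
    by (intro prod_mono) (use le M in \<open>auto intro: order_trans\<close>)
  thus "norm (multiplier (of_real (t\<^sup>2) / 4) m z) \<le> (t + 2) ^ m" unfolding nm by simp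
qed

text \<open>The i-th coefficient is an elementary symmetric function of degree card T - i in the
  roots. Moving K^i to the left avoids that difference, and 2^(card T) absorbs the binomial
  coefficient.\<close>

lemma coeff_prod_linear_bound:
  fixes h :: "'b \<Rightarrow> 'a :: real_normed_field"
  assumes "finite T" and K: "K \<ge> 0" and "\<And>z. z \<in> T \<Longrightarrow> norm (h z) \<le> K"
  shows "norm (Polynomial.coeff (\<Prod>z\<in>T. [:- h z, 1:]) i) * K ^ i \<le> 2 ^ card T * K ^ card T"
  using assms(1,3)
proof (induction T arbitrary: i rule: finite_induct)
  case empty
  thus ?case by (cases i) auto
next
  case (insert z T)
  let ?P = "\<Prod>z\<in>T. [:- h z, 1:]"
  have IH: "norm (Polynomial.coeff ?P i) * K ^ i \<le> 2 ^ card T * K ^ card T" for i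
    using insert by blast
  have hz: "norm (h z) \<le> K" using insert.prems by simp
  have nn: "0 \<le> norm (Polynomial.coeff ?P i) * K ^ i" for i using K by simp
  have B: "0 \<le> 2 ^ card T * K ^ card T" using K by simp
  have "norm (Polynomial.coeff ([:- h z, 1:] * ?P) i) * K ^ i \<le> 2 * (K * (2 ^ card T * K ^ card T))"
  proof (cases i)
    case 0
    have "norm (h z) * norm (Polynomial.coeff ?P 0) \<le> K * (2 ^ card T * K ^ card T)"
      using IH[of 0] hz K by (intro mult_mono) auto
    also have "\<dots> \<le> 2 * (K * (2 ^ card T * K ^ card T))" using mult_nonneg_nonneg[OF K B] by linarith
    finally show ?thesis using 0 by (simp add: norm_mult)
  next
    case (Suc j)
    have "norm (Polynomial.coeff ([:- h z, 1:] * ?P) i) \<le> norm (Polynomial.coeff ?P j) + norm (h z) * norm (Polynomial.coeff ?P i)"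
      using norm_triangle_ineq4[of "Polynomial.coeff ?P j" "h z * Polynomial.coeff ?P i"]
      by (simp add: Suc norm_mult)
    also have "\<dots> \<le> norm (Polynomial.coeff ?P j) + K * norm (Polynomial.coeff ?P i)"
      using hz by (intro add_left_mono mult_right_mono) auto
    finally have "norm (Polynomial.coeff ([:- h z, 1:] * ?P) i) * K ^ i
      \<le> (norm (Polynomial.coeff ?P j) + K * norm (Polynomial.coeff ?P i)) * K ^ i"
      using K by (intro mult_right_mono) auto
    also have "\<dots> = K * (norm (Polynomial.coeff ?P j) * K ^ j) + K * (norm (Polynomial.coeff ?P i) * K ^ i)"
      by (simp add: Suc algebra_simps)
    also have "\<dots> \<le> K * (2 ^ card T * K ^ card T) + K * (2 ^ card T * K ^ card T)"
      using IH K by (intro add_mono mult_left_mono) auto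
    also have "\<dots> = 2 * (K * (2 ^ card T * K ^ card T))" by (rule mult_2[symmetric])
    finally show ?thesis .
  qed
  moreover have "2 * (K * (2 ^ card T * K ^ card T)) = 2 ^ Suc (card T) * K ^ Suc (card T)" by simp
  ultimately show ?case unfolding prod.insert[OF insert.hyps] card_insert_disjoint[OF insert.hyps] by metis
qed

lemma coeff_pcompose_square:
  "Polynomial.coeff (pcompose p [:0, 0, 1 :: 'a :: comm_ring_1:]) n = (if even n then Polynomial.coeff p (n div 2) else 0)"
proof (induction p arbitrary: n)
  case (pCons a p)
  show ?case
  proof (cases n)
    case 0
    thus ?thesis by (simp add: pcompose_pCons)
  next
    case (Suc k)
    thus ?thesis using pCons.IH[of "k - 1"]
      by (cases k) (auto simp: pcompose_pCons coeff_pCons)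
  qed
qed simp

lemma of_real_of_rat: "of_real (of_rat a) = (of_rat a :: complex)"
  by (induction a) (simp add: of_rat_rat)

lemma evc_of_real: "evc (of_real t) p = of_real (poly (map_poly of_rat p) t)"
  by (induction p) (auto simp: evc_def map_poly_pCons of_real_of_rat)

lemma evc_square: "evc (of_real (t\<^sup>2)) p = of_real (poly (map_poly of_rat (pcompose p [:0, 0, 1:])) t)"
  unfolding evc_of_real by (simp add: of_rat_hom.map_poly_pcompose poly_pcompose power2_eq_square)

text \<open>The constant coefficient is up to sign the product of all multipliers, each of size
  about t^m. For i > 0 the i-th coefficient is a sum of products with i multipliers missing, so it
  is smaller by a factor of order t^(m i).\<close>

lemma delta_coeff_growth:
  assumes m: "m > 0"
  defines "N \<equiv> m * degree (delta m)"
  defines "r \<equiv> \<lambda>i. map_poly of_rat (pcompose (delta_coeff m i) [:0, 0, 1:]) :: real poly"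
  shows "((\<lambda>t. \<bar>poly (r 0) t\<bar> / t ^ N) \<longlongrightarrow> 1) at_top"
    and "i > 0 \<Longrightarrow> ((\<lambda>t. \<bar>poly (r i) t\<bar> / t ^ N) \<longlongrightarrow> 0) at_top"
proof -
  define \<nu> where "\<nu> = degree (delta m)"
  obtain K where K: "\<And>C. \<not> good m (C / 4) \<Longrightarrow> norm C \<le> K"
    using finite_imp_bounded[OF finite_not_good_scaled[of m]] by (auto simp: bounded_iff)
  have ev: "\<forall>\<^sub>F t::real in at_top. t \<ge> 4 \<and> good m (of_real (t\<^sup>2) / 4)"
    using eventually_ge_at_top[of 4] eventually_gt_at_top[of K]
  proof eventually_elim
    case (elim t)
    have "t * 1 \<le> t * t" using elim by (intro mult_left_mono) linarith+
    hence "K < t\<^sup>2" using elim unfolding power2_eq_square by linarith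
    also have "t\<^sup>2 = norm (of_real (t\<^sup>2) :: complex)" by (simp add: norm_power)
    finally have "K < norm (of_real (t\<^sup>2) :: complex)" .
    thus ?case using K[of "of_real (t\<^sup>2)"] elim by force
  qed
  have fact: "\<exists>T. finite T \<and> card T = \<nu> \<and> evx (of_real (t\<^sup>2) / 4) (delta m) = (\<Prod>z\<in>T. [:- multiplier (of_real (t\<^sup>2) / 4) m z, 1:])
     \<and> (\<forall>z\<in>T. (t - 2) ^ m \<le> norm (multiplier (of_real (t\<^sup>2) / 4) m z) \<and> norm (multiplier (of_real (t\<^sup>2) / 4) m z) \<le> (t + 2) ^ m)"
    if t: "t \<ge> 4 \<and> good m (of_real (t\<^sup>2) / 4)" for t
  proof -
    from delta_props(3)[OF m] t obtain T where T: "T \<subseteq> per (of_real (t\<^sup>2) / 4) m" "card T = \<nu>"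
      "evx (of_real (t\<^sup>2) / 4) (delta m) = (\<Prod>z\<in>T. [:- multiplier (of_real (t\<^sup>2) / 4) m z, 1:])"
      unfolding \<nu>_def by blast
    have "(qmap (of_real (t\<^sup>2) / 4) ^^ m) z = z" if "z \<in> T" for z using that T(1) per_subset by blast
    with multiplier_bounds[of t m] t m T finite_per[OF m] show ?thesis
      by (intro exI[of _ T] conjI) (auto intro: finite_subset)
  qed
  have rr: "\<bar>poly (r i) t\<bar> = norm (Polynomial.coeff (evx (of_real (t\<^sup>2) / 4) (delta m)) i)" for i t
    unfolding evc_delta_coeff[symmetric] evc_square r_def by simp
  have lim1: "((\<lambda>t::real. (t - 2) / t) \<longlongrightarrow> 1) at_top" by real_asymp
  have lim2: "((\<lambda>t::real. (t + 2) / t) \<longlongrightarrow> 1) at_top" by real_asymp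
  show "((\<lambda>t. \<bar>poly (r 0) t\<bar> / t ^ N) \<longlongrightarrow> 1) at_top"
  proof (rule tendsto_sandwich)
    show "((\<lambda>t::real. ((t - 2) / t) ^ N) \<longlongrightarrow> 1) at_top" using tendsto_power[OF lim1, of N] by simp
    show "((\<lambda>t::real. ((t + 2) / t) ^ N) \<longlongrightarrow> 1) at_top" using tendsto_power[OF lim2, of N] by simp
    have both: "\<forall>\<^sub>F t in at_top. ((t - 2) / t) ^ N \<le> \<bar>poly (r 0) t\<bar> / t ^ N \<and> \<bar>poly (r 0) t\<bar> / t ^ N \<le> ((t + 2) / t) ^ N"
      using ev
    proof eventually_elim
      case (elim t)
      from fact[OF elim] obtain T where T: "finite T" "card T = \<nu>"
        "evx (of_real (t\<^sup>2) / 4) (delta m) = (\<Prod>z\<in>T. [:- multiplier (of_real (t\<^sup>2) / 4) m z, 1:])"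
        "\<And>z. z \<in> T \<Longrightarrow> (t - 2) ^ m \<le> norm (multiplier (of_real (t\<^sup>2) / 4) m z)"
        "\<And>z. z \<in> T \<Longrightarrow> norm (multiplier (of_real (t\<^sup>2) / 4) m z) \<le> (t + 2) ^ m" by blast
      have eq: "\<bar>poly (r 0) t\<bar> = (\<Prod>z\<in>T. norm (multiplier (of_real (t\<^sup>2) / 4) m z))"
        unfolding rr T(3) poly_0_coeff_0[symmetric] by (simp add: poly_prod prod_norm[symmetric])
      have "(\<Prod>z\<in>T. (t - 2) ^ m) \<le> \<bar>poly (r 0) t\<bar>" unfolding eq
        by (intro prod_mono) (use T elim in auto)
      moreover have "\<bar>poly (r 0) t\<bar> \<le> (\<Prod>z\<in>T. (t + 2) ^ m)" unfolding eq
        by (intro prod_mono) (use T in auto)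
      ultimately have "(t - 2) ^ N \<le> \<bar>poly (r 0) t\<bar> \<and> \<bar>poly (r 0) t\<bar> \<le> (t + 2) ^ N"
        using T(2) by (simp add: N_def \<nu>_def power_mult)
      thus ?case using elim by (auto simp: power_divide intro!: divide_right_mono)
    qed
    show "\<forall>\<^sub>F t in at_top. ((t - 2) / t) ^ N \<le> \<bar>poly (r 0) t\<bar> / t ^ N"
      "\<forall>\<^sub>F t in at_top. \<bar>poly (r 0) t\<bar> / t ^ N \<le> ((t + 2) / t) ^ N"
      using both by (auto elim: eventually_mono)
  qed
  assume i: "i > 0"
  show "((\<lambda>t. \<bar>poly (r i) t\<bar> / t ^ N) \<longlongrightarrow> 0) at_top"
  proof (rule tendsto_sandwich[OF _ _ tendsto_const])
    have "((\<lambda>t::real. inverse (t + 2)) \<longlongrightarrow> 0) at_top" by real_asymp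
    from tendsto_mult[OF tendsto_mult[OF tendsto_const[of "2 ^ \<nu>"] tendsto_power[OF lim2, of N]] tendsto_power[OF this, of "m * i"]]
    show "((\<lambda>t::real. 2 ^ \<nu> * ((t + 2) / t) ^ N * inverse (t + 2) ^ (m * i)) \<longlongrightarrow> 0) at_top"
      using i m by (simp add: power_0_left)
    show "\<forall>\<^sub>F t in at_top. 0 \<le> \<bar>poly (r i) t\<bar> / t ^ N"
      using eventually_ge_at_top[of 0] by eventually_elim simp
    show "\<forall>\<^sub>F t in at_top. \<bar>poly (r i) t\<bar> / t ^ N \<le> 2 ^ \<nu> * ((t + 2) / t) ^ N * inverse (t + 2) ^ (m * i)"
      using ev
    proof eventually_elim
      case (elim t)
      from fact[OF elim] obtain T where T: "finite T" "card T = \<nu>"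
        "evx (of_real (t\<^sup>2) / 4) (delta m) = (\<Prod>z\<in>T. [:- multiplier (of_real (t\<^sup>2) / 4) m z, 1:])"
        "\<And>z. z \<in> T \<Longrightarrow> norm (multiplier (of_real (t\<^sup>2) / 4) m z) \<le> (t + 2) ^ m" by blast
      have K0: "(t + 2) ^ m \<ge> 0" using elim by simp
      have "\<bar>poly (r i) t\<bar> * ((t + 2) ^ m) ^ i \<le> 2 ^ \<nu> * ((t + 2) ^ m) ^ \<nu>"
        unfolding rr T(3) T(2)[symmetric] by (rule coeff_prod_linear_bound[OF T(1) K0 T(4)])
      hence "\<bar>poly (r i) t\<bar> * (t + 2) ^ (m * i) \<le> 2 ^ \<nu> * (t + 2) ^ N"
        by (simp add: N_def \<nu>_def flip: power_mult)
      moreover have "(t + 2) ^ (m * i) > 0" "t ^ N > 0" using elim by auto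
      ultimately show ?case by (simp add: field_simps power_divide power_inverse)
    qed
  qed
qed

lemma delta_shape:
  assumes m: "m > 0"
  obtains d where "2 * d = m * degree (delta m)" "\<bar>Polynomial.coeff (delta_coeff m 0) d\<bar> = 1"
    "\<And>i j. j \<ge> d \<Longrightarrow> i > 0 \<or> j > d \<Longrightarrow> Polynomial.coeff (delta_coeff m i) j = 0"
proof -
  define N where "N = m * degree (delta m)"
  define q where "q i = pcompose (delta_coeff m i) [:0, 0, 1:]" for i
  have deg: "degree (map_poly of_rat (q i) :: real poly) = degree (q i)" for i by simp
  note g0 = poly_growth[OF delta_coeff_growth(1)[OF m], folded N_def q_def]
  note gi = poly_growth[OF delta_coeff_growth(2)[OF m], folded N_def q_def]
  have one: "\<bar>Polynomial.coeff (q 0) N\<bar> = 1"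
  proof -
    have "\<bar>of_rat (Polynomial.coeff (q 0) N) :: real\<bar> = 1" using g0(2) by simp
    hence "of_rat (Polynomial.coeff (q 0) N) = (1 :: real) \<or> of_rat (Polynomial.coeff (q 0) N) = (-1 :: real)" by linarith
    hence "of_rat (Polynomial.coeff (q 0) N) = (of_rat 1 :: real) \<or> of_rat (Polynomial.coeff (q 0) N) = (of_rat (-1) :: real)"
      by (simp add: of_rat_minus)
    thus ?thesis by (auto simp only: of_rat_eq_iff)
  qed
  \<comment> \<open>\<open>q 0\<close> is a polynomial in t^2, so its nonzero coefficient at N must
    sit at an even index; half of it is the degree in C.\<close>
  have "even N" using one unfolding q_def coeff_pcompose_square by (auto split: if_splits)
  then obtain d where d: "N = 2 * d" by auto
  have c: "Polynomial.coeff (delta_coeff m i) j = Polynomial.coeff (q i) (2 * j)" for i j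
    unfolding q_def coeff_pcompose_square by simp
  show ?thesis
  proof (rule that[of d])
    show "2 * d = m * degree (delta m)" using d by (simp add: N_def)
    show "\<bar>Polynomial.coeff (delta_coeff m 0) d\<bar> = 1" unfolding c using one d by simp
    fix i j :: nat assume j: "j \<ge> d" "i > 0 \<or> j > d"
    have "degree (q i) \<le> N" using g0(1) gi(1)[of i] unfolding deg by (cases "i = 0") auto
    show "Polynomial.coeff (delta_coeff m i) j = 0"
    proof (cases "j > d")
      case True
      thus ?thesis unfolding c using \<open>degree (q i) \<le> N\<close> d by (intro coeff_eq_0) simp
    next
      case False
      hence "j = d" "i > 0" using j by auto
      thus ?thesis unfolding c using gi(2)[of i] d by simp
    qed
  qed
qed

lemma delta_normal_form:
  assumes m: "m > 0"
  obtains d and s :: int and a :: "nat \<Rightarrow> int poly"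
  where "s = 1 \<or> s = -1" "2 * d = m * degree (delta m)"
    "\<And>x C. poly (evx (C / 4) (delta m)) x = of_int s * (C ^ d + (\<Sum>j<d. poly (map_poly of_int (a j)) x * C ^ j))"
proof -
  obtain d where d: "2 * d = m * degree (delta m)" "\<bar>Polynomial.coeff (delta_coeff m 0) d\<bar> = 1"
    "\<And>i j. j \<ge> d \<Longrightarrow> i > 0 \<or> j > d \<Longrightarrow> Polynomial.coeff (delta_coeff m i) j = 0"
    using delta_shape[OF m] by blast
  define \<nu> where "\<nu> = degree (delta m)"
  have "\<exists>k. Polynomial.coeff (delta_coeff m i) j = of_int k" for i j
    using delta_coeff_int[OF m, of i j] by (auto elim: Ints_cases)
  then obtain q where q: "\<And>i j. Polynomial.coeff (delta_coeff m i) j = of_int (q i j)" by metis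
  define s where "s = q 0 d"
  have "\<bar>of_int s :: rat\<bar> = 1" using d(2) q by (simp add: s_def)
  hence "of_int \<bar>s\<bar> = (of_int 1 :: rat)" by simp
  hence abs: "\<bar>s\<bar> = 1" by (simp only: of_int_eq_iff)
  \<comment> \<open>Dividing by the leading coefficient s is multiplication by s, so the polynomials
    \<open>a j\<close> defined next keep integer coefficients.\<close>
  hence ss: "s * s = 1" by (metis abs_mult_self_eq mult_1)
  define a where "a = (\<lambda>j. \<Sum>i\<le>\<nu>. Polynomial.monom (s * q i j) i)"
  have pa: "poly (map_poly of_int (a j)) (x :: complex) = (\<Sum>i\<le>\<nu>. of_int (s * q i j) * x ^ i)" for j x
    unfolding a_def of_int_poly_hom.hom_sum poly_sum by (simp add: hom_distribs poly_monom)
  show ?thesis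
  proof (rule that[of s d a])
    show "s = 1 \<or> s = -1" using abs by linarith
    show "2 * d = m * degree (delta m)" by (rule d)
    fix x C :: complex
    have ev: "evc C (delta_coeff m i) = (\<Sum>j\<le>d. of_int (q i j) * C ^ j)" for i
    proof -
      have "Polynomial.coeff (delta_coeff m i) j = 0" if "j > d" for j using d(3)[of j i] that by simp
      hence le: "degree (delta_coeff m i) \<le> d" by (intro degree_le) auto
      have "evc C (delta_coeff m i) = (\<Sum>j\<le>degree (delta_coeff m i). of_rat (Polynomial.coeff (delta_coeff m i) j) * C ^ j)"
        by (simp add: evc_def poly_altdef)
      also have "\<dots> = (\<Sum>j\<le>d. of_rat (Polynomial.coeff (delta_coeff m i) j) * C ^ j)"
        by (rule sum.mono_neutral_left) (use le in \<open>auto simp: coeff_eq_0\<close>)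
      finally show ?thesis by (simp add: q)
    qed
    have qd: "q i d = 0" if "i > 0" for i using d(3)[of d i] that q[of i d] by simp
    have "poly (evx (C / 4) (delta m)) x = (\<Sum>i\<le>\<nu>. evc C (delta_coeff m i) * x ^ i)"
      by (simp add: poly_altdef evx_monic(2)[OF delta_props(1)[OF m]] \<nu>_def evc_delta_coeff)
    also have "\<dots> = (\<Sum>i\<le>\<nu>. \<Sum>j\<le>d. of_int (q i j) * x ^ i * C ^ j)"
      by (simp add: ev sum_distrib_left mult_ac)
    also have "\<dots> = (\<Sum>j\<le>d. (\<Sum>i\<le>\<nu>. of_int (q i j) * x ^ i) * C ^ j)"
      by (subst sum.swap) (simp add: sum_distrib_right)
    also have "\<dots> = (\<Sum>j<d. (\<Sum>i\<le>\<nu>. of_int (q i j) * x ^ i) * C ^ j) + (\<Sum>i\<le>\<nu>. of_int (q i d) * x ^ i) * C ^ d"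
      by (simp add: lessThan_Suc_atMost[symmetric])
    also have "(\<Sum>i\<le>\<nu>. of_int (q i d) * x ^ i) = (\<Sum>i\<in>{0}. of_int (q i d) * x ^ i)"
      by (rule sum.mono_neutral_right) (use qd in auto)
    also have "(\<Sum>j<d. (\<Sum>i\<le>\<nu>. of_int (q i j) * x ^ i) * C ^ j) = (\<Sum>j<d. of_int (s * s) * (\<Sum>i\<le>\<nu>. of_int (q i j) * x ^ i) * C ^ j)"
      by (simp add: ss)
    also have "\<dots> = of_int s * (\<Sum>j<d. poly (map_poly of_int (a j)) x * C ^ j)"
      by (simp add: pa sum_distrib_left mult_ac)
    finally show "poly (evx (C / 4) (delta m)) x = of_int s * (C ^ d + (\<Sum>j<d. poly (map_poly of_int (a j)) x * C ^ j))"
      by (simp add: s_def algebra_simps)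
  qed
qed

section \<open>Multipliers at c = 0\<close>

text \<open>Seen from the distant point M, the unit circle looks small: after scaling, a and b
  become numbers w a and w b close to 1. The cofactor of w a - w b in the difference of n-th powers
  is a sum of terms within distance 1 of 1, so its real part is positive and it cannot
  vanish.\<close>

lemma power_shift_inj:
  fixes a b :: complex and M :: real
  assumes ab: "norm a = 1" "norm b = 1" and n: "n > 0" "2 * real n \<le> M"
    and eq: "(a - of_real M) ^ n = (b - of_real M) ^ n"
  shows "a = b"
proof (rule ccontr)
  assume ne: "a \<noteq> b"
  have M: "M > 0" using n by simp
  define w where "w = (\<lambda>x::complex. 1 - x / of_real M)"
  have wx: "x - of_real M = - (of_real M * w x)" for x using M by (simp add: w_def field_simps)
  have "(- of_real M) ^ n * w a ^ n = (- of_real M) ^ n * w b ^ n"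
    using eq unfolding wx by (simp flip: power_mult_distrib)
  hence "w a ^ n = w b ^ n" using M by simp
  hence "(w a - w b) * (\<Sum>i<n. w b ^ (n - Suc i) * w a ^ i) = 0"
    by (simp flip: power_diff_sumr2)
  moreover have "w a \<noteq> w b" using ne M by (simp add: w_def)
  ultimately have zero: "(\<Sum>i<n. w b ^ (n - Suc i) * w a ^ i) = 0" by simp
  define K where "K = 1 + 1 / M"
  have K1: "K \<ge> 1" using M by (simp add: K_def)
  have bound: "norm (w b ^ j * w a ^ i - 1) \<le> K ^ (j + i) - 1" for i j
  proof -
    have one: "norm (X * w x - 1) \<le> K ^ Suc k - 1" if X: "norm (X - 1) \<le> K ^ k - 1" and x: "norm x = 1" for X x k
    proof -
      have "norm X \<le> norm (X - 1) + 1" using norm_triangle_ineq[of "X - 1" 1] by simp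
      hence nX: "norm X \<le> K ^ k" using X by simp
      have nw: "norm (w x - 1) = 1 / M" using x M by (simp add: w_def norm_divide)
      have "X * w x - 1 = X * (w x - 1) + (X - 1)" by (simp add: algebra_simps)
      hence "norm (X * w x - 1) \<le> norm X * norm (w x - 1) + norm (X - 1)"
        by (metis norm_mult norm_triangle_ineq)
      also have "\<dots> \<le> K ^ k * (1 / M) + (K ^ k - 1)"
        unfolding nw using nX X M by (intro add_mono mult_right_mono) auto
      also have "\<dots> = K ^ Suc k - 1" by (simp add: K_def algebra_simps)
      finally show ?thesis .
    qed
    have b: "norm (w b ^ j - 1) \<le> K ^ j - 1"
    proof (induction j)
      case (Suc j)
      from one[OF Suc ab(2)] show ?case by (simp add: mult.commute)
    qed simp
    show ?thesis
    proof (induction i)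
      case (Suc i)
      from one[OF Suc ab(1)] show ?case by (simp add: mult_ac)
    qed (use b in simp)
  qed
  \<comment> \<open>This is where 2 n <= M is used: (1 + 1/M)^(n-1) <= exp((n-1)/M) < exp(1/2) <=
    2.\<close>
  have Kn: "K ^ (n - 1) < 2"
  proof -
    have "K \<le> exp (1 / M)" unfolding K_def by (rule exp_ge_add_one_self)
    hence "K ^ (n - 1) \<le> exp (1 / M) ^ (n - 1)" using K1 by (intro power_mono) auto
    also have "\<dots> = exp (real (n - 1) * (1 / M))" by (rule exp_of_nat_mult[symmetric])
    also have "\<dots> < exp (1 / 2)" using n M by (simp add: field_simps)
    also have "\<dots> \<le> 2" by (rule exp_half_le2)
    finally show ?thesis .
  qed
  have "Re (w b ^ (n - Suc i) * w a ^ i) > 0" if "i < n" for i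
  proof -
    have "norm (w b ^ (n - Suc i) * w a ^ i - 1) < 1"
      using bound[of "n - Suc i" i] Kn that by simp
    moreover have "\<bar>Re (w b ^ (n - Suc i) * w a ^ i - 1)\<bar> \<le> norm (w b ^ (n - Suc i) * w a ^ i - 1)" by (rule abs_Re_le_cmod)
    ultimately show ?thesis by simp
  qed
  hence "(\<Sum>i<n. Re (w b ^ (n - Suc i) * w a ^ i)) > 0" using n by (intro sum_pos) auto
  thus False using arg_cong[OF zero, of Re] by simp
qed

lemma unit_circle_sum_2:
  assumes "norm a = 1" "norm b = 1" "a + b = (2 :: complex)"
  shows "a = 1"
proof -
  have "Re a + Re b = 2" using arg_cong[OF assms(3), of Re] by simp
  moreover have "Re a \<le> 1" "Re b \<le> 1" using complex_Re_le_cmod[of a] complex_Re_le_cmod[of b] assms by auto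
  ultimately have "Re a = 1" by simp
  moreover have "(Re a)\<^sup>2 + (Im a)\<^sup>2 = 1" using assms(1) cmod_power2[of a] by simp
  ultimately show ?thesis by (simp add: complex_eq_iff)
qed

lemma per_0_1: "per 0 1 = {0, 1}"
proof -
  have "z \<in> per 0 1 \<longleftrightarrow> z = 0 \<or> z = 1" for z
  proof
    assume "z \<in> per 0 1"
    hence "(qmap 0 ^^ 1) z = z" using per_iff[of z 0 1 1] by simp
    hence "z * (z - 1) = 0" by (simp add: qmap_def power2_eq_square algebra_simps)
    thus "z = 0 \<or> z = 1" by simp
  qed (auto simp: per_def power_0_left)
  thus ?thesis by blast
qed

text \<open>For m >= 2 the number nu of cycles obeys 2 nu <= m nu <= 2^m, which is what
  \<open>power_shift_inj\<close> asks for with M = 2^m. For m = 1 the values agree also under x -> 2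
  - x, but 1 is the only point of the unit circle that this sends to the unit circle, which explains
  the assumption on x1.\<close>

lemma delta_at_0_inj:
  assumes m: "m > 0" and pos: "degree (delta m) > 0"
    and x: "norm x1 = 1" "norm x2 = 1" "x1 \<noteq> 1"
    and eq: "poly (evx 0 (delta m)) x1 = poly (evx 0 (delta m)) x2"
  shows "x1 = x2"
proof -
  obtain T where T: "T \<subseteq> per 0 m" "card T = degree (delta m)" "evx 0 (delta m) = (\<Prod>z\<in>T. [:- multiplier 0 m z, 1:])"
    using delta_props(3)[OF m good_0] by blast
  have cp: "card (per 0 m) = m * degree (delta m)" using card_per[OF m good_0] delta_props(2)[OF m] by simp
  show ?thesis
  proof (cases "m = 1")
    case True
    hence "T = per 0 1" using card_subset_eq[OF finite_per[OF m] T(1)] cp T(2) by simp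
    hence p: "poly (evx 0 (delta m)) y = y * (y - 2)" for y
      unfolding T(3) per_0_1 by (simp add: True multiplier_def poly_prod)
    have "(x1 - x2) * (x1 + x2 - 2) = 0" using eq unfolding p by (simp add: algebra_simps)
    moreover have "x1 + x2 \<noteq> 2" using unit_circle_sum_2[OF x(1,2)] x(3) by blast
    ultimately show ?thesis by simp
  next
    case False
    hence m2: "m \<ge> 2" using m by simp
    have mul: "multiplier 0 m z = 2 ^ m" if "z \<in> T" for z
    proof -
      have zp: "z \<in> per 0 m" using that T by blast
      have "z \<noteq> 0"
      proof
        assume "z = 0"
        hence "(qmap 0 ^^ 1) z = z" by (simp add: qmap_def)
        hence "m dvd 1" using per_iff[OF zp] by blast
        thus False using m2 by simp
      qed
      have "z * z ^ (2 ^ m - 1) = z" using per_iff[OF zp, of m] by (simp flip: power_Suc)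
      thus ?thesis using \<open>z \<noteq> 0\<close> by (simp add: multiplier_0)
    qed
    have "evx 0 (delta m) = [:- (2 ^ m), 1:] ^ card T"
      unfolding T(3) using mul by (simp add: prod_constant[symmetric] del: prod_constant)
    hence e: "(x1 - of_real (2 ^ m)) ^ card T = (x2 - of_real (2 ^ m)) ^ card T" using eq by simp
    have "card (per 0 m) \<le> 2 ^ m"
    proof -
      have nz: "itp 0 m - [:0, 1:] \<noteq> 0" using monic_nonzero conjunct1[OF monic_minus_X[OF itp_monic m]] by blast
      have "card (per 0 m) \<le> card {z. (qmap 0 ^^ m) z = z}"
        by (rule card_mono[OF finite_fixpoints[OF m] per_subset])
      also have "{z. (qmap 0 ^^ m) z = z} = {z. poly (itp 0 m - [:0, 1:]) z = 0}" unfolding poly_itp_minus_X by simp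
      also have "card \<dots> \<le> degree (itp 0 m - [:0, 1:])" by (rule card_poly_roots_bound[OF nz])
      also have "\<dots> = 2 ^ m" using monic_minus_X[OF itp_monic m] by blast
      finally show ?thesis .
    qed
    moreover have "2 * card T \<le> m * card T" using m2 by simp
    moreover have "m * card T = card (per 0 m)" using cp T(2) by simp
    ultimately have "2 * card T \<le> 2 ^ m" by (metis le_trans)
    hence "real (2 * card T) \<le> real (2 ^ m)" by (simp only: of_nat_le_iff)
    thus ?thesis using power_shift_inj[OF x(1,2) _ _ e] pos T(2) by simp
  qed
qed

section \<open>Roots of unity\<close>

lemma prim_root_exists:
  assumes "n > 0"
  shows "prim_roots n \<noteq> {}"
  using cis_power_eq_1_iff[OF assms] unfolding prim_roots_def by blast

lemma prim_root_power_one: "z \<in> prim_roots n \<Longrightarrow> z ^ n = 1"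
  using prim_roots_iff[of z n n] by simp

lemma prim_root_nonzero: "n > 0 \<Longrightarrow> z \<in> prim_roots n \<Longrightarrow> z \<noteq> 0"
  using prim_root_power_one[of z n] by (auto simp: power_0_left)

lemma algebraic_int_root_of_unity:
  assumes "(z :: complex) ^ n = 1" "n > 0"
  shows "algebraic_int z"
  by (rule algebraic_int_root[of 1 "Polynomial.monom 1 n"]) (use assms in \<open>auto simp: poly_monom degree_monom_eq\<close>)

lemma algebraic_int_prim_root: "n > 0 \<Longrightarrow> z \<in> prim_roots n \<Longrightarrow> algebraic_int z"
  using algebraic_int_root_of_unity prim_root_power_one by blast

lemma norm_root_of_unity: "(z :: complex) ^ n = 1 \<Longrightarrow> n > 0 \<Longrightarrow> norm z = 1"
  by (metis norm_one norm_power norm_ge_zero power_eq_1_iff less_numeral_extra(3))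

lemma power_mod_root:
  fixes z :: "'a :: monoid_mult"
  assumes "z ^ n = 1"
  shows "z ^ (i mod n) = z ^ i"
  using assms by (metis mod_mult_div_eq mult.commute mult_1_right power_add power_mult power_one)

lemma prim_root_generates:
  assumes n: "n > 0" and z: "z \<in> prim_roots n" and w: "w ^ n = 1"
  obtains i where "w = z ^ i"
proof -
  have inj: "inj_on (\<lambda>i. z ^ i) {..<n}"
  proof -
    have "i = j" if "i \<le> j" "j < n" "z ^ i = z ^ j" for i j
    proof -
      have "z ^ i * z ^ (j - i) = z ^ i * 1" using that by (metis le_add_diff_inverse mult_1_right power_add)
      hence "z ^ (j - i) = 1" using prim_root_nonzero[OF n z] by simp
      hence "n dvd j - i" using prim_roots_iff[OF z] by blast
      thus ?thesis using that by (metis dvd_imp_le diff_is_0_eq le_antisym less_imp_diff_less linorder_not_less neq0_conv)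
    qed
    thus ?thesis unfolding inj_on_def by (metis lessThan_iff nle_le)
  qed
  have "(\<lambda>i. z ^ i) ` {..<n} = {w. w ^ n = 1}"
  proof (rule card_subset_eq[OF finite_roots_of_unity[OF n]])
    show "(\<lambda>i. z ^ i) ` {..<n} \<subseteq> {w. w ^ n = 1}"
      using prim_root_power_one[OF z] by (auto simp: power_mult[symmetric] mult.commute[of _ n]) (simp add: power_mult)
    show "card ((\<lambda>i. z ^ i) ` {..<n}) = card {w :: complex. w ^ n = 1}"
      using card_image[OF inj] card_roots_unity_eq[OF n] by simp
  qed
  with w that show ?thesis by blast
qed

lemma one_minus_power:
  assumes "algebraic_int (z :: complex)"
  shows "\<exists>w. algebraic_int w \<and> 1 - z ^ i = (1 - z) * w"
proof (intro exI conjI)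
  show "algebraic_int (\<Sum>k<i. z ^ k)" by (intro algebraic_int_ring_intros assms)
  show "1 - z ^ i = (1 - z) * (\<Sum>k<i. z ^ k)" by (rule one_diff_power_eq)
qed

text \<open>The value at 1 of (X^(pq) - 1)/(X^q - 1) = 1 + X^q + ... + X^((p-1)q), where q =
  p^(e-1).\<close>

lemma prime_eq_prod_prim_roots:
  assumes p: "prime p" and e: "e > 0"
  shows "of_nat p = (\<Prod>z\<in>prim_roots (p ^ e). 1 - z)"
proof -
  obtain f where f: "e = Suc f" using e by (cases e) auto
  \<comment> \<open>Here q is p^(e-1), not p^e: the primitive roots of order p^e are the roots of
    X^(pq) - 1 that are not roots of X^q - 1.\<close>
  define q where "q = p ^ f"
  have q: "q > 0" "p ^ e = p * q" "p > 0" using p by (auto simp: q_def f prime_gt_0_nat)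
  have pq: "p * q > 0" using q by simp
  let ?X = "\<lambda>d. Polynomial.monom 1 d - 1 :: complex poly"
  have un: "{z::complex. z ^ (p * q) = 1} = {z. z ^ q = 1} \<union> prim_roots (p ^ e)"
  proof (intro equalityI subsetI)
    fix z :: complex assume "z \<in> {z. z ^ (p * q) = 1}"
    hence z: "z ^ (p ^ e) = 1" using q by simp
    obtain r where r: "\<And>d. z ^ d = 1 \<longleftrightarrow> r dvd d" using exists_order[OF z] p by (auto simp: prime_gt_0_nat)
    have "r dvd p ^ e" using r z by blast
    then obtain i where i: "i \<le> e" "r = p ^ i" using p by (auto simp: divides_primepow_nat)
    show "z \<in> {z. z ^ q = 1} \<union> prim_roots (p ^ e)"
    proof (cases "i = e")
      case True
      thus ?thesis using r i by (auto simp: prim_roots_def)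
    next
      case False
      hence "r dvd q" using i f by (simp add: q_def le_imp_power_dvd)
      thus ?thesis using r by blast
    qed
  next
    fix z :: complex assume "z \<in> {z. z ^ q = 1} \<union> prim_roots (p ^ e)"
    thus "z \<in> {z. z ^ (p * q) = 1}"
      using prim_root_power_one[of z "p ^ e"] q by (auto simp: mult.commute[of p] power_mult)
  qed
  have disj: "{z. z ^ q = 1} \<inter> prim_roots (p ^ e) = {}"
  proof -
    have "\<not> p ^ e dvd q" using q p prime_gt_1_nat[OF p] by (auto dest!: dvd_imp_le)
    thus ?thesis using prim_roots_iff[of _ "p ^ e" q] by auto
  qed
  have fin: "finite {z::complex. z ^ q = 1}" "finite (prim_roots (p ^ e))"
    using finite_roots_of_unity[OF q(1)] finite_prim_roots[of "p ^ e"] q pq by auto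
  have "?X (p * q) = ?X q * (\<Prod>z\<in>prim_roots (p ^ e). [:- z, 1:])"
    unfolding x_pow_minus_1_factorization[OF pq] x_pow_minus_1_factorization[OF q(1)] un
    by (rule prod.union_disjoint[OF fin disj])
  moreover have "?X (p * q) = ?X q * (\<Sum>i<p. Polynomial.monom 1 q ^ i)"
  proof -
    have "?X (p * q) = Polynomial.monom 1 q ^ p - 1" by (simp add: monom_power mult.commute)
    thus ?thesis by (simp add: power_diff_1_eq)
  qed
  moreover have "?X q \<noteq> 0" using monic_x_pow_minus_1(1)[OF q(1), where 'a = complex] by (rule monic_nonzero)
  ultimately have "(\<Prod>z\<in>prim_roots (p ^ e). [:- z, 1:]) = (\<Sum>i<p. Polynomial.monom 1 q ^ i)"
    by (metis mult_left_cancel)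
  from arg_cong[OF this, of "\<lambda>P. poly P 1"] show ?thesis
    by (simp add: poly_prod poly_sum poly_monom)
qed

text \<open>Any two primitive roots are powers of each other, so the numbers 1 - x divide one
  another and each factor of p in \<open>prime_eq_prod_prim_roots\<close> is a multiple of 1 - z. If
  one of them were a unit, all would be, and 1/p would be an algebraic integer.\<close>

lemma prime_uniformizer:
  assumes p: "prime p" and e: "e > 0" and z: "z \<in> prim_roots (p ^ e)"
  shows "\<exists>w. algebraic_int w \<and> of_nat p = (1 - z) ^ card (prim_roots (p ^ e)) * w"
    and "algebraic_int y \<Longrightarrow> (1 - z) * y \<noteq> 1"
proof -
  let ?R = "prim_roots (p ^ e)"
  have q: "p ^ e > 0" using p by (simp add: prime_gt_0_nat)
  have "\<exists>w. algebraic_int w \<and> 1 - x = (1 - x') * w" if "x \<in> ?R" "x' \<in> ?R" for x x'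
    using prim_root_generates[OF q that(2) prim_root_power_one[OF that(1)]]
      one_minus_power[OF algebraic_int_prim_root[OF q that(2)]] by metis
  then obtain w where w: "\<And>x x'. x \<in> ?R \<Longrightarrow> x' \<in> ?R \<Longrightarrow> algebraic_int (w x x') \<and> 1 - x = (1 - x') * w x x'" by metis
  show "\<exists>w. algebraic_int w \<and> of_nat p = (1 - z) ^ card ?R * w"
  proof (intro exI conjI)
    show "algebraic_int (\<Prod>x\<in>?R. w x z)" by (intro algebraic_int_prod) (use w z in blast)
    have "of_nat p = (\<Prod>x\<in>?R. (1 - z) * w x z)"
      unfolding prime_eq_prod_prim_roots[OF p e] by (rule prod.cong[OF refl]) (use w z in blast)
    thus "of_nat p = (1 - z) ^ card ?R * (\<Prod>x\<in>?R. w x z)" by (simp add: prod.distrib)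
  qed
  assume y: "algebraic_int y"
  show "(1 - z) * y \<noteq> 1"
  proof
    assume unit: "(1 - z) * y = 1"
    have "(1 - x) * (w z x * y) = 1" if "x \<in> ?R" for x
      using unit w[OF z that] by (simp flip: mult.assoc)
    hence "(\<Prod>x\<in>?R. (1 - x) * (w z x * y)) = 1" by (intro prod.neutral) blast
    hence "of_nat p * (\<Prod>x\<in>?R. w z x * y) = 1"
      unfolding prime_eq_prod_prim_roots[OF p e] by (simp only: prod.distrib)
    moreover have "algebraic_int (\<Prod>x\<in>?R. w z x * y)"
      by (intro algebraic_int_prod algebraic_int_add_mult(2) y) (use w z in blast)
    moreover define v where "v = (\<Prod>x\<in>?R. w z x * y)"
    ultimately have v: "of_nat p * v = 1" "algebraic_int v" by simp_all
    hence "v = of_rat (1 / of_nat p)" using prime_gt_0_nat[OF p] by (simp add: of_rat_divide field_simps)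
    hence "v \<in> \<int>" using rational_algebraic_int_is_int[OF v(2)] by simp
    then obtain t where "v = of_int t" by (auto elim: Ints_cases)
    hence "of_int (int p * t) = (of_int 1 :: complex)" using v(1) by simp
    hence "int p * t = 1" by (simp only: of_int_eq_iff)
    hence "int p dvd 1" by (metis dvd_triv_left)
    thus False using prime_gt_1_nat[OF p] by simp
  qed
qed

text \<open>The exponents come from the Chinese remainder theorem: b is 1 mod k and 0 mod q, c the
  reverse, so b + c is 1 mod k q. They are the same for all z.\<close>

lemma prim_root_split:
  assumes cop: "coprime k q" and k: "k > 1" and q: "q > 1"
  obtains b c where "\<And>z. z \<in> prim_roots (k * q) \<Longrightarrow> z ^ b \<in> prim_roots k \<and> z ^ c \<in> prim_roots q \<and> z ^ b * z ^ c = z"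
proof -
  obtain b where b: "[b = 1] (mod k)" "[b = 0] (mod q)" using binary_chinese_remainder_nat[OF cop] by blast
  obtain c where c: "[c = 0] (mod k)" "[c = 1] (mod q)" using binary_chinese_remainder_nat[OF cop] by blast
  have "[b + c = 1 + 0] (mod k)" by (intro cong_add b c)
  moreover have "[b + c = 0 + 1] (mod q)" by (intro cong_add b c)
  ultimately have "[b + c = 1] (mod (k * q))" using cop by (simp add: coprime_cong_mult_nat)
  hence bc: "(b + c) mod (k * q) = 1 mod (k * q)" by (rule unique_euclidean_semiring_class.cong_def[THEN iffD1])
  have key: "z ^ b' \<in> prim_roots k'" if z: "z \<in> prim_roots (k' * q')" and cop': "coprime b' k'" and b': "q' dvd b'" "q' > 0" and cop: "coprime k' q'" for z b' k' q'
    unfolding prim_roots_def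
  proof (intro CollectI allI)
    fix d
    have "(z ^ b') ^ d = 1 \<longleftrightarrow> k' * q' dvd b' * d" unfolding power_mult[symmetric] by (rule prim_roots_iff[OF z])
    also have "\<dots> \<longleftrightarrow> k' dvd b' * d"
      using b' cop by (auto intro: divides_mult dvd_mult2 dvd_mult_left)
    also have "\<dots> \<longleftrightarrow> k' dvd d" using cop' by (simp add: coprime_dvd_mult_right_iff coprime_commute)
    finally show "(z ^ b') ^ d = 1 \<longleftrightarrow> k' dvd d" .
  qed
  show ?thesis
  proof (rule that[of b c])
    fix z assume z: "z \<in> prim_roots (k * q)"
    have 1: "coprime b k" using b(1) by (metis cong_imp_coprime cong_sym coprime_1_left)
    have 2: "coprime c q" using c(2) by (metis cong_imp_coprime cong_sym coprime_1_left)
    have 3: "q dvd b" "k dvd c" using b(2) c(1) by (simp_all add: cong_0_iff)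
    have 4: "z \<in> prim_roots (q * k)" using z by (simp add: mult.commute)
    have "z ^ (b + c) = z ^ 1"
      using power_mod_root[OF prim_root_power_one[OF z]] bc by metis
    thus "z ^ b \<in> prim_roots k \<and> z ^ c \<in> prim_roots q \<and> z ^ b * z ^ c = z"
      using key[OF z 1 3(1) _ cop] key[OF 4 2 3(2)] cop k q by (simp add: power_add coprime_commute)
  qed
qed

lemma card_prim_roots_mult_le:
  assumes cop: "coprime k q" and k: "k > 1" and q: "q > 1"
  shows "card (prim_roots (k * q)) \<le> card (prim_roots k) * card (prim_roots q)"
proof -
  obtain b c where bc: "\<And>z. z \<in> prim_roots (k * q) \<Longrightarrow> z ^ b \<in> prim_roots k \<and> z ^ c \<in> prim_roots q \<and> z ^ b * z ^ c = z"
    using prim_root_split[OF assms] by blast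
  have "card (prim_roots (k * q)) \<le> card (prim_roots k \<times> prim_roots q)"
  proof (rule card_inj_on_le)
    show "inj_on (\<lambda>z. (z ^ b, z ^ c)) (prim_roots (k * q))"
      by (rule inj_onI) (metis bc prod.inject)
    show "(\<lambda>z. (z ^ b, z ^ c)) ` prim_roots (k * q) \<subseteq> prim_roots k \<times> prim_roots q" using bc by blast
    show "finite (prim_roots k \<times> prim_roots q)" using finite_prim_roots k q by simp
  qed
  thus ?thesis by (simp add: card_cartesian_product)
qed

section \<open>Independence over the rationals\<close>

lemma algebraic_int_poly_of_int: "algebraic_int (x :: complex) \<Longrightarrow> algebraic_int (poly (map_poly of_int q) x)"
  by (induction q) (auto simp: map_poly_pCons intro!: algebraic_int_add_mult)

lemma poly_of_int_diff:
  assumes "algebraic_int (x :: complex)" "algebraic_int y"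
  shows "\<exists>w. algebraic_int w \<and> poly (map_poly of_int q) x - poly (map_poly of_int q) y = (x - y) * w"
proof (induction q)
  case (pCons c q)
  then obtain w where w: "algebraic_int w" "poly (map_poly of_int q) x - poly (map_poly of_int q) y = (x - y) * w" by blast
  let ?q = "\<lambda>x. poly (map_poly of_int q) x"
  have "poly (map_poly of_int (pCons c q)) x - poly (map_poly of_int (pCons c q)) y = (x - y) * ?q x + y * (?q x - ?q y)"
    by (simp add: hom_distribs algebra_simps)
  also have "\<dots> = (x - y) * (?q x + y * w)" unfolding w(2) by (simp add: algebra_simps)
  finally show ?case using w assms
    by (intro exI[of _ "?q x + y * w"]) (auto intro!: algebraic_int_add_mult algebraic_int_poly_of_int)
qed auto

lemma of_int_mod_ring_eq_0_iff: "(of_int x :: 'p :: prime_card mod_ring) = 0 \<longleftrightarrow> int CARD('p) dvd x"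
  using of_int_eq_0_iff_char_dvd[of x, where 'a = "'p mod_ring"] by simp

lemma poly_mod_ring_lift: "\<exists>S :: int poly. map_poly of_int S = (s :: 'p :: prime_card mod_ring poly)"
  by (intro exI[of _ "map_poly to_int_mod_ring s"] poly_eqI)
    (simp add: coeff_map_poly of_int_of_int_mod_ring)

lemma poly_mod_ring_eq_0_iff:
  "(map_poly of_int r :: 'p :: prime_card mod_ring poly) = 0 \<longleftrightarrow> (\<forall>j. int CARD('p) dvd Polynomial.coeff r j)"
  by (auto simp: poly_eq_iff coeff_map_poly of_int_mod_ring_eq_0_iff)

text \<open>If r were nonzero mod p, its small degree would make it coprime to the irreducible P
  there. The Bezout identity, lifted to Z with an error divisible by p and evaluated at \<theta>,
  would exhibit 1 as \<pi> times an algebraic integer. In other words, \<theta> has full degree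
  modulo \<pi>.\<close>

lemma prime_dvd_coeffs_if_nonunit_value:
  fixes P r :: "int poly" and \<pi> \<theta> :: complex
  assumes irr: "irreducible (map_poly of_int P :: 'p :: prime_card mod_ring poly)"
    and degP: "degree (map_poly of_int P :: 'p mod_ring poly) = degree P"
    and \<theta>: "algebraic_int \<theta>" and nonunit: "\<And>y. algebraic_int y \<Longrightarrow> \<pi> * y \<noteq> 1"
    and p: "algebraic_int w" "of_nat CARD('p) = \<pi> * w"
    and P: "algebraic_int v" "poly (map_poly of_int P) \<theta> = \<pi> * v"
    and r: "algebraic_int u" "poly (map_poly of_int r) \<theta> = \<pi> * u" "degree r < degree P"
  shows "int CARD('p) dvd Polynomial.coeff r j"
proof -
  let ?h = "map_poly of_int P :: 'p mod_ring poly" and ?R = "map_poly of_int r :: 'p mod_ring poly"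
  have "?R = 0"
  proof (rule ccontr)
    assume R0: "?R \<noteq> 0"
    have "\<not> ?h dvd ?R"
    proof
      assume "?h dvd ?R"
      from dvd_imp_degree_le[OF this R0] have "degree P \<le> degree ?R" unfolding degP .
      also have "\<dots> \<le> degree r" by (rule degree_map_poly_le)
      finally show False using r(3) by simp
    qed
    hence cop: "coprime ?h ?R" using irr by (simp add: prime_elem_imp_coprime irreducible_imp_prime_elem)
    obtain s t where st: "s * ?h + t * ?R = 1"
      using bezout_coefficients_fst_snd[of ?h ?R] coprime_imp_gcd_eq_1[OF cop] by metis
    obtain S T :: "int poly" where ST: "map_poly of_int S = s" "map_poly of_int T = t"
      using poly_mod_ring_lift[of s] poly_mod_ring_lift[of t] by blast
    have "(map_poly of_int (S * P + T * r - 1) :: 'p mod_ring poly) = 0"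
      using st by (simp add: ST[symmetric] hom_distribs)
    hence "\<forall>j. int CARD('p) dvd Polynomial.coeff (S * P + T * r - 1) j" unfolding poly_mod_ring_eq_0_iff .
    hence "[:int CARD('p):] dvd S * P + T * r - 1" by (simp add: const_poly_dvd_iff)
    then obtain Q where Q: "S * P + T * r - 1 = [:int CARD('p):] * Q" by blast
    let ?e = "\<lambda>q :: int poly. poly (map_poly of_int q) \<theta>"
    have "?e (S * P + T * r - 1) = ?e ([:int CARD('p):] * Q)" unfolding Q ..
    hence "?e S * ?e P + ?e T * ?e r - 1 = of_nat CARD('p) * ?e Q" by (simp add: hom_distribs)
    hence "1 = ?e S * ?e P + ?e T * ?e r - of_nat CARD('p) * ?e Q" by (simp add: algebra_simps)
    also have "\<dots> = \<pi> * (?e S * v + ?e T * u - w * ?e Q)"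
      unfolding P(2) r(2) p(2) by (simp add: algebra_simps)
    finally have "\<pi> * (?e S * v + ?e T * u - w * ?e Q) = 1" ..
    moreover have "algebraic_int (?e S * v + ?e T * u - w * ?e Q)"
      by (intro algebraic_int_diff algebraic_int_add_mult algebraic_int_poly_of_int \<theta> p P r)
    ultimately show False using nonunit by blast
  qed
  thus ?thesis unfolding poly_mod_ring_eq_0_iff by blast
qed

lemma int_eq_0_if_all_powers_dvd:
  fixes x p :: int
  assumes "p > 1" "\<And>t. p ^ t dvd x"
  shows "x = 0"
proof (rule ccontr)
  assume x: "x \<noteq> 0"
  define t where "t = nat \<bar>x\<bar>"
  have "int t < 2 ^ t" using of_nat_less_two_power[of t, where 'a = int] .
  also have "\<dots> \<le> p ^ t" using assms(1) by (intro power_mono) auto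
  also have "\<dots> \<le> \<bar>x\<bar>" using dvd_imp_le_int[OF x assms(2)[of t]] assms(1) by simp
  finally show False by (simp add: t_def)
qed

text \<open>Ramification index N and residue degree \<open>degree P\<close> multiply. In an integer
  relation the rows are treated in increasing i: modulo \<pi>^(i+1) only row i remains, so its inner
  sum is divisible by \<pi> and its coefficients by p. The relation can then be divided by p,
  without end.\<close>

lemma uniformizer_powers_independent:
  fixes P :: "int poly" and \<pi> \<theta> :: complex and c :: "nat \<Rightarrow> nat \<Rightarrow> int"
  assumes irr: "irreducible (map_poly of_int P :: 'p :: prime_card mod_ring poly)"
    and degP: "degree (map_poly of_int P :: 'p mod_ring poly) = degree P"
    and \<theta>: "algebraic_int \<theta>" and \<pi>: "algebraic_int \<pi>"
    and nonunit: "\<And>y. algebraic_int y \<Longrightarrow> \<pi> * y \<noteq> 1"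
    and p: "algebraic_int w" "of_nat CARD('p) = \<pi> ^ N * w" and N: "N > 0"
    and P: "algebraic_int v" "poly (map_poly of_int P) \<theta> = \<pi> * v"
    and zero: "(\<Sum>i<N. \<Sum>j<degree P. of_int (c i j) * \<pi> ^ i * \<theta> ^ j) = 0"
    and ij: "i < N" "j < degree P"
  shows "c i j = 0"
proof -
  let ?D = "degree P" and ?p = "int CARD('p)"
  have p1: "?p > 1" using prime_gt_1_nat[OF prime_card[where 'a = 'p]] by simp
  have \<pi>0: "\<pi> \<noteq> 0"
  proof
    assume "\<pi> = 0"
    hence "of_nat CARD('p) = (0 :: complex)" using p(2) N by simp
    thus False by simp
  qed
  have p': "algebraic_int (\<pi> ^ (N - 1) * w)" "of_nat CARD('p) = \<pi> * (\<pi> ^ (N - 1) * w)"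
    using p N \<pi> by (cases N; simp add: algebraic_int_ring_intros)+
  have step: "\<forall>j<?D. ?p dvd c i j"
    if zero: "(\<Sum>i<N. \<Sum>j<?D. of_int (c i j) * \<pi> ^ i * \<theta> ^ j) = 0" and iN: "i < N" for c :: "nat \<Rightarrow> nat \<Rightarrow> int" and i
    using iN
  proof (induction i rule: less_induct)
    case (less i)
    define R where "R = (\<lambda>i. \<Sum>j<?D. of_int (c i j) * \<theta> ^ j)"
    have Rint: "algebraic_int (R i)" for i unfolding R_def by (intro algebraic_int_ring_intros \<theta> algebraic_int_of_int)
    have zR: "(\<Sum>i<N. \<pi> ^ i * R i) = 0"
      using zero by (simp add: R_def sum_distrib_left mult_ac)
    \<comment> \<open>Rows before i are divisible by p by the induction hypothesis, hence by \<pi>^N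
      with N >= i + 1; rows after i carry a high enough power of \<pi> themselves.\<close>
    have "\<exists>u. algebraic_int u \<and> \<pi> ^ i' * R i' = \<pi> ^ Suc i * u" if i': "i' \<in> {..<N} - {i}" for i'
    proof (cases "i' < i")
      case True
      with less have dv: "\<forall>j<?D. ?p dvd c i' j" by simp
      have "R i' = of_nat CARD('p) * (\<Sum>j<?D. of_int (c i' j div ?p) * \<theta> ^ j)"
        unfolding R_def sum_distrib_left
      proof (rule sum.cong[OF refl])
        fix j assume "j \<in> {..<?D}"
        hence "c i' j = ?p * (c i' j div ?p)" using dv by simp
        hence "(of_int (c i' j) :: complex) = of_int (?p * (c i' j div ?p))" by metis
        thus "of_int (c i' j) * \<theta> ^ j = of_nat CARD('p) * (of_int (c i' j div ?p) * \<theta> ^ j)" by simp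
      qed
      moreover have "algebraic_int (\<Sum>j<?D. of_int (c i' j div ?p) * \<theta> ^ j)"
        by (intro algebraic_int_ring_intros \<theta> algebraic_int_of_int)
      ultimately obtain y where y: "algebraic_int y" "R i' = of_nat CARD('p) * y" by blast
      have NN: "\<pi> ^ N = \<pi> ^ Suc i * \<pi> ^ (N - Suc i)" using less.prems by (metis Suc_leI le_add_diff_inverse power_add)
      show ?thesis
      proof (intro exI conjI)
        show "algebraic_int (\<pi> ^ i' * \<pi> ^ (N - Suc i) * w * y)" by (intro algebraic_int_ring_intros \<pi> p y)
        show "\<pi> ^ i' * R i' = \<pi> ^ Suc i * (\<pi> ^ i' * \<pi> ^ (N - Suc i) * w * y)"
          unfolding y p NN by (simp only: mult_ac)
      qed
    next
      case False
      hence gt: "Suc i \<le> i'" using i' by auto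
      hence "\<pi> ^ i' = \<pi> ^ Suc i * \<pi> ^ (i' - Suc i)" by (metis le_add_diff_inverse power_add)
      thus ?thesis using Rint \<pi>
        by (intro exI[of _ "\<pi> ^ (i' - Suc i) * R i'"]) (simp add: algebraic_int_ring_intros mult_ac)
    qed
    then obtain u where u: "\<And>i'. i' \<in> {..<N} - {i} \<Longrightarrow> algebraic_int (u i') \<and> \<pi> ^ i' * R i' = \<pi> ^ Suc i * u i'" by metis
    have "0 = \<pi> ^ i * R i + (\<Sum>i'\<in>{..<N} - {i}. \<pi> ^ i' * R i')"
      using zR less.prems by (simp add: sum.remove[of "{..<N}" i])
    also have "(\<Sum>i'\<in>{..<N} - {i}. \<pi> ^ i' * R i') = \<pi> ^ Suc i * (\<Sum>i'\<in>{..<N} - {i}. u i')"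
      unfolding sum_distrib_left by (rule sum.cong[OF refl]) (use u in blast)
    finally have "\<pi> ^ i * (R i + \<pi> * (\<Sum>i'\<in>{..<N} - {i}. u i')) = 0" by (simp add: algebra_simps)
    hence Ri: "R i = \<pi> * (- (\<Sum>i'\<in>{..<N} - {i}. u i'))" using \<pi>0 by (simp add: eq_neg_iff_add_eq_0)
    define r where "r = (\<Sum>j<?D. Polynomial.monom (c i j) j)"
    have cr: "Polynomial.coeff r j = (if j < ?D then c i j else 0)" for j
      by (simp add: r_def coeff_sum)
    have re: "poly (map_poly of_int r) \<theta> = R i"
      unfolding r_def R_def of_int_poly_hom.hom_sum poly_sum by (simp add: hom_distribs poly_monom)
    show ?case
    proof (intro allI impI)
      fix j assume j: "j < ?D"
      have "degree r \<le> ?D - 1" by (rule degree_le) (use cr in auto)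
      hence "degree r < ?D" using j by simp
      have uint: "algebraic_int (- (\<Sum>i'\<in>{..<N} - {i}. u i'))"
        by (intro algebraic_int_minus algebraic_int_sum) (use u in blast)
      have "?p dvd Polynomial.coeff r j"
        by (rule prime_dvd_coeffs_if_nonunit_value[OF irr degP \<theta> nonunit p' P uint re[unfolded Ri] \<open>degree r < ?D\<close>])
      thus "?p dvd c i j" using cr j by simp
    qed
  qed
  \<comment> \<open>The coefficients divided by p satisfy the same relation, so each round gains one
    more factor p.\<close>
  have "\<forall>i<N. \<forall>j<?D. ?p ^ t dvd c i j" if "(\<Sum>i<N. \<Sum>j<?D. of_int (c i j) * \<pi> ^ i * \<theta> ^ j) = 0" for t c
    using that
  proof (induction t arbitrary: c)
    case (Suc t)
    define c' where "c' = (\<lambda>i j. c i j div ?p)"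
    have c': "c i j = ?p * c' i j" if "i < N" "j < ?D" for i j
      using step[OF Suc.prems that(1)] that(2) by (simp add: c'_def)
    have "(\<Sum>i<N. \<Sum>j<?D. of_int (c i j) * \<pi> ^ i * \<theta> ^ j) = of_nat CARD('p) * (\<Sum>i<N. \<Sum>j<?D. of_int (c' i j) * \<pi> ^ i * \<theta> ^ j)"
      unfolding sum_distrib_left by (intro sum.cong refl) (simp add: c')
    hence "(\<Sum>i<N. \<Sum>j<?D. of_int (c' i j) * \<pi> ^ i * \<theta> ^ j) = 0" using Suc.prems by simp
    from Suc.IH[OF this] show ?case using c' by simp
  qed simp
  from this[OF zero] show ?thesis using ij by (intro int_eq_0_if_all_powers_dvd[OF p1]) blast
qed

section \<open>Linear algebra over the rationals\<close>

interpretation Qspace: vector_space "\<lambda>(q :: rat) (z :: complex). of_rat q * z"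
  by unfold_locales (simp_all add: algebra_simps of_rat_add of_rat_mult)

lemma independent_family_transfer:
  fixes f :: "'i \<Rightarrow> complex" and g :: "'j \<Rightarrow> complex"
  assumes fin: "finite I" "finite J" and card: "card J \<le> card I"
    and ind: "\<And>c. (\<Sum>i\<in>I. of_rat (c i) * f i) = 0 \<Longrightarrow> \<forall>i\<in>I. c i = 0"
    and span: "\<And>i. i \<in> I \<Longrightarrow> f i \<in> Qspace.span (g ` J)"
    and zero: "(\<Sum>j\<in>J. of_rat (b j) * g j) = 0" and j: "j \<in> J"
  shows "b j = 0"
proof (rule ccontr)
  assume bj: "b j \<noteq> 0"
  have inj: "inj_on f I"
  proof (rule inj_onI, rule ccontr)
    fix x y assume xy: "x \<in> I" "y \<in> I" "f x = f y" "x \<noteq> y"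
    define c :: "'i \<Rightarrow> rat" where "c = (\<lambda>i. if i = x then 1 else if i = y then - 1 else 0)"
    have "(\<Sum>i\<in>I. of_rat (c i) * f i) = (\<Sum>i\<in>{x, y}. of_rat (c i) * f i)"
      by (rule sum.mono_neutral_right) (use xy fin in \<open>auto simp: c_def\<close>)
    also have "\<dots> = 0" using xy by (simp add: c_def of_rat_minus)
    finally have "c x = 0" using ind xy by blast
    thus False by (simp add: c_def)
  qed
  have indep: "Qspace.independent (f ` I)"
  proof
    assume "Qspace.dependent (f ` I)"
    then obtain u where u: "\<exists>v\<in>f ` I. u v \<noteq> 0" "(\<Sum>v\<in>f ` I. of_rat (u v) * v) = 0"
      using fin by (auto simp: Qspace.dependent_finite)
    have "(\<Sum>i\<in>I. of_rat (u (f i)) * f i) = 0" using u(2) by (simp add: sum.reindex[OF inj])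
    from ind[OF this] show False using u(1) by blast
  qed
  let ?S = "Qspace.span (g ` (J - {j}))"
  have gS: "g i \<in> ?S" if "i \<in> J - {j}" for i using that by (intro Qspace.span_base) blast
  have gj: "g j \<in> ?S"
  proof -
    have "of_rat (b j) * g j + (\<Sum>i\<in>J - {j}. of_rat (b i) * g i) = 0"
      using zero j fin by (simp add: sum.remove)
    hence "of_rat (b j) * g j = - (\<Sum>i\<in>J - {j}. of_rat (b i) * g i)" by (simp add: eq_neg_iff_add_eq_0)
    also have "\<dots> \<in> ?S" by (intro Qspace.span_neg Qspace.span_sum Qspace.span_scale gS)
    finally have "of_rat (inverse (b j)) * (of_rat (b j) * g j) \<in> ?S" by (rule Qspace.span_scale)
    moreover have "of_rat (inverse (b j)) * (of_rat (b j) * g j) = g j"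
      using bj by (simp add: of_rat_inverse)
    ultimately show ?thesis by metis
  qed
  have "g ` J \<subseteq> ?S" using gS gj by blast
  hence "Qspace.span (g ` J) \<subseteq> ?S" by (rule Qspace.span_minimal) (rule Qspace.subspace_span)
  hence "f ` I \<subseteq> ?S" using span by blast
  from Qspace.independent_span_bound[OF _ indep this] have "card (f ` I) \<le> card (g ` (J - {j}))" using fin by simp
  also have "\<dots> \<le> card (J - {j})" using fin by (intro card_image_le) simp
  also have "\<dots> < card J" by (rule card_Diff1_less[OF fin(2) j])
  finally show False using card card_image[OF inj] by simp
qed

lemma common_denominator:
  assumes "finite I"
  shows "\<exists>M::int. M > 0 \<and> (\<forall>i\<in>I. \<exists>k. (c i :: rat) * of_int M = of_int k)"
  using assms
proof (induction I rule: finite_induct)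
  case (insert x I)
  then obtain M where M: "M > 0" "\<forall>i\<in>I. \<exists>k. c i * of_int M = of_int k" by blast
  obtain a b where ab: "b > 0" "c x = of_int a / of_int b" by (metis quotient_of_denom_pos quotient_of_div surj_pair)
  have "\<exists>k. c i * of_int (M * b) = of_int k" if i: "i \<in> insert x I" for i
  proof (cases "i = x")
    case True
    have "c i * of_int (M * b) = of_int (a * M)" using ab True by (simp add: field_simps)
    thus ?thesis by blast
  next
    case False
    then obtain k where "c i * of_int M = of_int k" using i M by blast
    hence "c i * of_int (M * b) = of_int (k * b)" by (simp flip: mult.assoc)
    thus ?thesis by blast
  qed
  thus ?case using M ab by (intro exI[of _ "M * b"]) auto
qed (auto intro: exI[of _ 1])

text \<open>A(x, C) up to its sign, as a function on complex numbers; x will be a root of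
  unity.\<close>

definition monic_in_C :: "(nat \<Rightarrow> int poly) \<Rightarrow> nat \<Rightarrow> complex \<Rightarrow> complex \<Rightarrow> complex" where
  "monic_in_C a d x C = C ^ d + (\<Sum>j<d. poly (map_poly of_int (a j)) x * C ^ j)"

lemma algebraic_int_monic_in_C:
  "algebraic_int x \<Longrightarrow> algebraic_int C \<Longrightarrow> algebraic_int (monic_in_C a d x C)"
  unfolding monic_in_C_def by (intro algebraic_int_ring_intros algebraic_int_poly_of_int)

text \<open>The equation for \<theta> is monic with coefficients in Z[z], so the products z^i
  \<theta>^j with i < n and j < d span a stable module; exponents of z are reduced by z^n =
  1.\<close>

lemma algebraic_int_root_monic_in_C:
  assumes z: "z ^ n = 1" "n > 0" and root: "monic_in_C a d z \<theta> = 0" and d: "d > 0"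
  shows "algebraic_int \<theta>"
proof -
  define B where "B = (\<lambda>(i, j). z ^ i * \<theta> ^ j) ` ({..<n} \<times> {..<d})"
  have fin: "finite B" by (simp add: B_def)
  have one: "1 \<in> B" unfolding B_def using z d by (intro image_eqI[of _ _ "(0, 0)"]) auto
  have B: "z ^ i * \<theta> ^ j \<in> int_span B" if "j < d" for i j
  proof -
    have "z ^ (i mod n) * \<theta> ^ j \<in> int_span B"
      by (rule int_span_base) (use that z in \<open>auto simp: B_def intro!: image_eqI[of _ _ "(i mod n, j)"]\<close>)
    thus ?thesis using power_mod_root[OF z(1)] by metis
  qed
  have Bz: "poly (map_poly of_int q) z * z ^ i * \<theta> ^ j \<in> int_span B" if "j < d" for q i j
  proof (induction q arbitrary: i)
    case (pCons c q)
    have "poly (map_poly of_int (pCons c q)) z * z ^ i * \<theta> ^ j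
      = of_int c * (z ^ i * \<theta> ^ j) + poly (map_poly of_int q) z * z ^ Suc i * \<theta> ^ j"
      by (simp add: hom_distribs algebra_simps)
    also have "\<dots> \<in> int_span B" by (intro int_span_add int_span_scale B that pCons.IH)
    finally show ?case .
  qed (simp add: int_span.zero)
  have "\<theta> * b \<in> int_span B" if b: "b \<in> B" for b
  proof -
    from b obtain i j where ij: "b = z ^ i * \<theta> ^ j" "i < n" "j < d" by (auto simp: B_def)
    show ?thesis
    proof (cases "Suc j < d")
      case True
      thus ?thesis using B[OF True, of i] ij by (simp add: mult_ac)
    next
      case False
      hence "Suc j = d" using ij by simp
      hence "\<theta> * b = z ^ i * \<theta> ^ d" using ij by (metis mult.left_commute power_Suc)
      also have "\<theta> ^ d = - (\<Sum>j<d. poly (map_poly of_int (a j)) z * \<theta> ^ j)"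
        using root by (simp add: monic_in_C_def eq_neg_iff_add_eq_0)
      also have "z ^ i * - (\<Sum>j<d. poly (map_poly of_int (a j)) z * \<theta> ^ j)
        = of_int (-1) * (\<Sum>j<d. poly (map_poly of_int (a j)) z * z ^ i * \<theta> ^ j)"
        by (simp add: sum_distrib_left mult_ac sum_negf)
      also have "\<dots> \<in> int_span B" by (intro int_span_scale int_span_sum Bz) simp
      finally show ?thesis .
    qed
  qed
  thus ?thesis by (intro algebraic_int_if_finite_span[OF fin one] int_span_finite[OF _ fin])
qed

lemma degree_cyclotomic:
  assumes n: "n > 0"
  shows "degree (cyclotomic n) = card (prim_roots n)" "lead_coeff (cyclotomic n) = 1"
proof -
  have "degree (map_poly of_rat (cyclotomic n) :: complex poly) = card (prim_roots n)"
    unfolding cyclotomic_complex[OF n] by (rule monic_prod_linear)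
  thus d: "degree (cyclotomic n) = card (prim_roots n)" by simp
  have "lead_coeff (map_poly of_rat (cyclotomic n) :: complex poly) = 1"
    unfolding cyclotomic_complex[OF n] by (rule monic_prod_linear)
  hence "of_rat (lead_coeff (cyclotomic n)) = (of_rat 1 :: complex)" by simp
  thus "lead_coeff (cyclotomic n) = 1" by (simp only: of_rat_eq_iff)
qed

lemma evc_cyclotomic:
  assumes n: "n > 0"
  shows "evc z (cyclotomic n) = 0 \<longleftrightarrow> z \<in> prim_roots n"
  unfolding evc_def cyclotomic_complex[OF n] using finite_prim_roots[OF n] by (auto simp: poly_prod)

text \<open>All that the reduction argument takes over from dynamics: A(x, C) in normal form, and P
  as the product of A(z, C) over primitive k-th roots of unity, up to s. In the application P is the
  integer form of \<open>Delta_tilde (m * k) m\<close> and s is a sign.\<close>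

locale ramified_reduction =
  fixes k e d :: nat and a :: "nat \<Rightarrow> int poly" and P :: "int poly" and s :: complex
    and ty :: "'p :: prime_card itself"
  assumes irr: "irreducible (map_poly of_int P :: 'p mod_ring poly)"
    and degP: "degree (map_poly of_int P :: 'p mod_ring poly) = degree P" "degree P = card (prim_roots k) * d"
    and s: "algebraic_int s"
    and P: "\<And>C. poly (map_poly of_int P) C = s * (\<Prod>z\<in>prim_roots k. monic_in_C a d z C)"
    and k: "k > 1" "\<not> CARD('p) dvd k" and e: "e > 0"
begin

definition q :: nat where "q = CARD('p) ^ e"

abbreviation A where "A \<equiv> monic_in_C a d"

lemma prime_p: "prime CARD('p)"
  by (rule prime_card)

lemma q_gt_1: "q > 1"
  unfolding q_def using e prime_gt_1_nat[OF prime_p] by (intro one_less_power) auto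

lemma coprime_k_q: "coprime k q"
  unfolding q_def using prime_imp_coprime[OF prime_p k(2)] by (simp add: coprime_commute)

lemma n_pos: "k * q > 0"
  using k q_gt_1 by simp

lemma d_pos: "d > 0"
proof (rule ccontr)
  assume "\<not> d > 0"
  hence "degree (map_poly of_int P :: 'p mod_ring poly) = 0" using degP by simp
  moreover have "(map_poly of_int P :: 'p mod_ring poly) \<noteq> 0" using irr by auto
  ultimately have "(map_poly of_int P :: 'p mod_ring poly) dvd 1" by (simp add: is_unit_iff_degree)
  thus False using irr irreducible_not_unit by blast
qed

text \<open>The powers of \<pi> are adapted to reduction mod p and known to be independent, whereas
  the powers of z are adapted to conjugation. The count of
  \<open>independent_family_transfer\<close> exchanges one family for the other.\<close>

lemma powers_independent:
  assumes z: "z \<in> prim_roots (k * q)" and \<theta>: "A z \<theta> = 0"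
    and zero: "(\<Sum>(i, j)\<in>{..<card (prim_roots (k * q))} \<times> {..<d}. of_rat (b i j) * (z ^ i * \<theta> ^ j)) = 0"
    and ij: "i < card (prim_roots (k * q))" "j < d"
  shows "b i j = 0"
proof -
  let ?\<phi> = "card (prim_roots (k * q))" and ?N = "card (prim_roots q)" and ?D = "degree P"
  obtain l c where lc: "\<And>z. z \<in> prim_roots (k * q) \<Longrightarrow> z ^ l \<in> prim_roots k \<and> z ^ c \<in> prim_roots q \<and> z ^ l * z ^ c = z"
    using prim_root_split[OF coprime_k_q k(1) q_gt_1] by blast
  have z': "z ^ l \<in> prim_roots k" and \<eta>: "z ^ c \<in> prim_roots q" and zz: "z ^ l * z ^ c = z" using lc[OF z] by auto
  define \<pi> where "\<pi> = 1 - z ^ c"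
  have zint: "algebraic_int z" using algebraic_int_prim_root[OF n_pos z] .
  have \<theta>int: "algebraic_int \<theta>"
    by (rule algebraic_int_root_monic_in_C[OF prim_root_power_one[OF z] n_pos \<theta> d_pos])
  have \<pi>int: "algebraic_int \<pi>" unfolding \<pi>_def by (intro algebraic_int_diff algebraic_int_power zint algebraic_int_1)
  note unif = prime_uniformizer[OF prime_p e \<eta>[unfolded q_def], folded q_def \<pi>_def]
  obtain w where w: "algebraic_int w" "of_nat CARD('p) = \<pi> ^ ?N * w" using unif(1) by blast
  have N: "?N > 0" using prim_root_exists[of q] finite_prim_roots[of q] q_gt_1 by (simp add: card_gt_0_iff)
  have "\<exists>v. algebraic_int v \<and> A (z ^ l) \<theta> = \<pi> * v"
  proof -
    have "\<exists>v. algebraic_int v \<and> poly (map_poly of_int (a j)) (z ^ l) - poly (map_poly of_int (a j)) z = \<pi> * v" for j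
    proof -
      obtain v where v: "algebraic_int v" "poly (map_poly of_int (a j)) (z ^ l) - poly (map_poly of_int (a j)) z = (z ^ l - z) * v"
        using poly_of_int_diff[OF algebraic_int_power[OF zint] zint] by blast
      \<comment> \<open>Since z = z^l z^c, passing from z to its k-part z^l is invisible modulo
        \<pi> = 1 - z^c; integer polynomials therefore take congruent values at the two.\<close>
      have "z ^ l - z = z ^ l * \<pi>" using zz by (simp add: \<pi>_def right_diff_distrib)
      thus ?thesis using v by (intro exI[of _ "z ^ l * v"]) (simp add: algebraic_int_add_mult algebraic_int_power zint mult_ac)
    qed
    then obtain v where v: "\<And>j. algebraic_int (v j)" "\<And>j. poly (map_poly of_int (a j)) (z ^ l) - poly (map_poly of_int (a j)) z = \<pi> * v j" by metis
    have "A (z ^ l) \<theta> = A (z ^ l) \<theta> - A z \<theta>" using \<theta> by simp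
    also have "\<dots> = (\<Sum>j<d. (poly (map_poly of_int (a j)) (z ^ l) - poly (map_poly of_int (a j)) z) * \<theta> ^ j)"
      by (simp add: monic_in_C_def sum_subtractf left_diff_distrib)
    also have "\<dots> = \<pi> * (\<Sum>j<d. v j * \<theta> ^ j)" unfolding v(2) by (simp add: sum_distrib_left mult.assoc)
    finally show ?thesis
      by (intro exI[of _ "\<Sum>j<d. v j * \<theta> ^ j"]) (simp add: algebraic_int_ring_intros v \<theta>int)
  qed
  then obtain v where v: "algebraic_int v" "A (z ^ l) \<theta> = \<pi> * v" by blast
  define v' where "v' = s * (v * (\<Prod>x\<in>prim_roots k - {z ^ l}. A x \<theta>))"
  have v'int: "algebraic_int v'" unfolding v'_def
    by (intro algebraic_int_add_mult(2) s v algebraic_int_prod algebraic_int_monic_in_C \<theta>int)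
      (use algebraic_int_prim_root[of k] k in auto)
  have P\<theta>: "poly (map_poly of_int P) \<theta> = \<pi> * v'"
  proof -
    have "finite (prim_roots k)" using finite_prim_roots k by simp
    from prod.remove[OF this z', of "\<lambda>x. A x \<theta>"] show ?thesis unfolding P v'_def v(2) by (simp add: mult_ac)
  qed
  let ?I = "{..<?N} \<times> {..<?D}" and ?J = "{..<?\<phi>} \<times> {..<d}"
  let ?f = "\<lambda>(i, j). \<pi> ^ i * \<theta> ^ j" and ?g = "\<lambda>(i, j). z ^ i * \<theta> ^ j"
  \<comment> \<open>J has phi(k q) d elements and I has phi(q) phi(k) d, so the inequality
    \<open>card_prim_roots_mult_le\<close> is the direction needed.\<close>
  have card: "card ?J \<le> card ?I"
  proof -
    have "?\<phi> * d \<le> card (prim_roots k) * ?N * d"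
      by (intro mult_right_mono card_prim_roots_mult_le coprime_k_q k q_gt_1) simp
    thus ?thesis by (simp add: degP mult_ac)
  qed
  have ind: "\<forall>x\<in>?I. c x = 0" if zero: "(\<Sum>x\<in>?I. of_rat (c x) * ?f x) = 0" for c
  proof -
    obtain M where M: "M > 0" "\<forall>x\<in>?I. \<exists>k. c x * of_int M = of_int k" using common_denominator[of ?I c] by auto
    then obtain h where h: "\<And>x. x \<in> ?I \<Longrightarrow> c x * of_int M = of_int (h x)" by metis
    have "(\<Sum>i<?N. \<Sum>j<?D. of_int (h (i, j)) * \<pi> ^ i * \<theta> ^ j) = (\<Sum>x\<in>?I. of_int (h x) * ?f x)"
      unfolding sum.cartesian_product by (rule sum.cong) (auto simp: mult.assoc)
    also have "\<dots> = (\<Sum>x\<in>?I. of_int M * (of_rat (c x) * ?f x))"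
    proof (rule sum.cong[OF refl])
      fix x assume "x \<in> ?I"
      from arg_cong[OF h[OF this], of "of_rat :: rat \<Rightarrow> complex"]
      have "of_int (h x) = of_int M * (of_rat (c x) :: complex)" by (simp add: of_rat_mult mult.commute)
      thus "of_int (h x) * ?f x = of_int M * (of_rat (c x) * ?f x)" by (simp only: mult.assoc)
    qed
    also have "\<dots> = 0" unfolding sum_distrib_left[symmetric] zero by simp
    finally have *: "(\<Sum>i<?N. \<Sum>j<?D. of_int (h (i, j)) * \<pi> ^ i * \<theta> ^ j) = 0" .
    show ?thesis
    proof
      fix x assume x: "x \<in> ?I"
      then obtain i j where ij: "x = (i, j)" "i < ?N" "j < ?D" by auto
      have "h (i, j) = 0"
        using uniformizer_powers_independent[OF irr degP(1) \<theta>int \<pi>int unif(2) w N v'int P\<theta>, of "\<lambda>i j. h (i, j)"] * ij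
        by simp
      thus "c x = 0" using h[OF x] M(1) ij by simp
    qed
  qed
  \<comment> \<open>The span of the z^i \<theta>^j is stable under z by the cyclotomic relation and
    under \<theta> by A z \<theta> = 0, hence also under \<pi> = 1 - z^c; starting from 1 it
    contains every \<pi>^i \<theta>^j.\<close>
  have span: "?f x \<in> Qspace.span (?g ` ?J)" if "x \<in> ?I" for x
  proof -
    let ?S = "Qspace.span (?g ` ?J)"
    have \<phi>0: "?\<phi> > 0" using z finite_prim_roots[OF n_pos] by (auto simp: card_gt_0_iff)
    have base: "z ^ i * \<theta> ^ j \<in> ?S" if "i < ?\<phi>" "j < d" for i j
      by (rule Qspace.span_base) (use that in \<open>auto intro!: image_eqI[of _ _ "(i, j)"]\<close>)
    have closed: "y * x \<in> ?S" if x: "x \<in> ?S" and y: "\<And>i j. i < ?\<phi> \<Longrightarrow> j < d \<Longrightarrow> y * (z ^ i * \<theta> ^ j) \<in> ?S" for x y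
      using x
    proof (induction x rule: Qspace.span_induct_alt)
      case (step c x x')
      have "y * x \<in> ?S" using step.hyps(1) y by auto
      from Qspace.span_add[OF Qspace.span_scale[OF this, of c] step.IH] show ?case by (simp add: algebra_simps)
    qed (simp add: Qspace.span_zero)
    have zS: "z * x \<in> ?S" if "x \<in> ?S" for x
    proof (rule closed[OF that])
      fix i j assume ij: "i < ?\<phi>" "j < d"
      show "z * (z ^ i * \<theta> ^ j) \<in> ?S"
      proof (cases "Suc i < ?\<phi>")
        case True
        thus ?thesis using base[OF True ij(2)] by (simp add: mult_ac)
      next
        case False
        hence i: "Suc i = ?\<phi>" using ij by simp
        have "0 = evc z (cyclotomic (k * q))" using evc_cyclotomic[OF n_pos] z by simp
        also have "\<dots> = (\<Sum>t\<le>?\<phi>. of_rat (Polynomial.coeff (cyclotomic (k * q)) t) * z ^ t)"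
          by (simp add: evc_def poly_altdef degree_cyclotomic[OF n_pos])
        also have "\<dots> = (\<Sum>t<?\<phi>. of_rat (Polynomial.coeff (cyclotomic (k * q)) t) * z ^ t) + z ^ ?\<phi>"
          using degree_cyclotomic[OF n_pos] by (simp add: lessThan_Suc_atMost[symmetric])
        finally have "z ^ ?\<phi> = - (\<Sum>t<?\<phi>. of_rat (Polynomial.coeff (cyclotomic (k * q)) t) * z ^ t)"
          by (simp add: eq_neg_iff_add_eq_0 add.commute)
        hence "z ^ ?\<phi> * \<theta> ^ j = - (\<Sum>t<?\<phi>. of_rat (Polynomial.coeff (cyclotomic (k * q)) t) * (z ^ t * \<theta> ^ j))"
          by (simp add: sum_distrib_right mult.assoc)
        also have "\<dots> \<in> ?S"
          by (intro Qspace.span_neg Qspace.span_sum Qspace.span_scale base ij) simp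
        finally show ?thesis unfolding i[symmetric] by (simp add: mult_ac)
      qed
    qed
    have zpS: "z ^ t * x \<in> ?S" if "x \<in> ?S" for x t
      by (induction t) (use that zS in \<open>auto simp: mult.assoc\<close>)
    have polyS: "poly (map_poly of_int h) z * x \<in> ?S" if "x \<in> ?S" for x and h :: "int poly"
      using that
    proof (induction h arbitrary: x)
      case (pCons c h)
      have "of_rat (of_int c) * x + poly (map_poly of_int h) z * (z * x) \<in> ?S"
        by (intro Qspace.span_add Qspace.span_scale pCons zS)
      thus ?case by (simp add: hom_distribs algebra_simps)
    qed (simp add: Qspace.span_zero)
    have \<theta>S: "\<theta> * x \<in> ?S" if "x \<in> ?S" for x
    proof (rule closed[OF that])
      fix i j assume ij: "i < ?\<phi>" "j < d"
      show "\<theta> * (z ^ i * \<theta> ^ j) \<in> ?S"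
      proof (cases "Suc j < d")
        case True
        thus ?thesis using base[OF ij(1) True] by (simp add: mult_ac)
      next
        case False
        hence j: "Suc j = d" using ij by simp
        have "\<theta> ^ d = - (\<Sum>j<d. poly (map_poly of_int (a j)) z * \<theta> ^ j)"
          using \<theta> by (simp add: monic_in_C_def eq_neg_iff_add_eq_0)
        hence "z ^ i * \<theta> ^ d = - (\<Sum>j<d. poly (map_poly of_int (a j)) z * (z ^ i * \<theta> ^ j))"
          by (simp add: sum_distrib_left mult_ac)
        also have "\<dots> \<in> ?S" by (intro Qspace.span_neg Qspace.span_sum polyS base ij) simp
        finally show ?thesis unfolding j[symmetric] by (simp add: mult_ac)
      qed
    qed
    have \<theta>pS: "\<theta> ^ t * x \<in> ?S" if "x \<in> ?S" for x t
      by (induction t) (use that \<theta>S in \<open>auto simp: mult.assoc\<close>)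
    have \<pi>S: "\<pi> ^ t * x \<in> ?S" if "x \<in> ?S" for x t
    proof (induction t)
      case (Suc t)
      from Qspace.span_diff[OF Suc zpS[OF Suc, of c]] show ?case by (simp add: \<pi>_def algebra_simps)
    qed (use that in simp)
    have "1 \<in> ?S" using base[OF \<phi>0 d_pos] by simp
    from \<pi>S[OF \<theta>pS[OF this]] have "\<pi> ^ i * \<theta> ^ j \<in> ?S" for i j by simp
    thus ?thesis by (simp add: case_prod_beta)
  qed
  have "(case (i, j) of (i, j) \<Rightarrow> b i j) = 0"
    by (rule independent_family_transfer[where f = ?f and g = ?g and I = ?I and J = ?J and b = "\<lambda>(i, j). b i j", OF _ _ card ind span])
      (use zero ij in \<open>auto simp: case_prod_beta\<close>)
  thus ?thesis by simp
qed

end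

section \<open>Irreducibility\<close>

lemma evc_mod_cyclotomic:
  assumes "n > 0" "z \<in> prim_roots n"
  shows "evc z (b mod cyclotomic n) = evc z b"
proof -
  have "evc z (cyclotomic n * (b div cyclotomic n) + b mod cyclotomic n) = evc z (b mod cyclotomic n)"
    using evc_cyclotomic[OF assms(1)] assms(2) by (simp only: evc.hom_add evc.hom_mult) simp
  thus ?thesis by simp
qed

lemma evc_const: "evc z [:x:] = of_rat x"
  by (cases "x = 0") (simp_all add: evc_def map_poly_pCons)

lemma evc_sum:
  assumes "degree p < n"
  shows "evc z p = (\<Sum>i<n. of_rat (Polynomial.coeff p i) * z ^ i)"
proof -
  have "evc z p = (\<Sum>i\<le>degree p. of_rat (Polynomial.coeff p i) * z ^ i)" by (simp add: evc_def poly_altdef)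
  also have "\<dots> = (\<Sum>i<n. of_rat (Polynomial.coeff p i) * z ^ i)"
    by (rule sum.mono_neutral_left) (use assms in \<open>auto simp: coeff_eq_0\<close>)
  finally show ?thesis .
qed

lemma prod_dvd_if_pairwise_coprime:
  fixes f :: "'i \<Rightarrow> 'a :: semiring_gcd"
  assumes "\<And>i. i \<in> I \<Longrightarrow> f i dvd c" "\<And>i j. i \<in> I \<Longrightarrow> j \<in> I \<Longrightarrow> i \<noteq> j \<Longrightarrow> coprime (f i) (f j)"
  shows "prod f I dvd c"
  using assms
proof (induction I rule: infinite_finite_induct)
  case (insert i I)
  have "coprime (f i) (prod f I)" by (rule prod_coprime_right) (use insert in auto)
  thus ?case using insert by (simp add: divides_mult)
qed auto

lemma coprime_if_no_common_root:
  fixes f g :: "complex poly"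
  assumes "f \<noteq> 0" "\<And>x. poly f x = 0 \<Longrightarrow> poly g x = 0 \<Longrightarrow> False"
  shows "coprime f g"
proof (rule coprimeI)
  fix c assume c: "c dvd f" "c dvd g"
  show "c dvd 1"
  proof (rule ccontr)
    assume "\<not> c dvd 1"
    moreover have "c \<noteq> 0" using c(1) assms(1) by auto
    ultimately have "degree c > 0" by (simp add: is_unit_iff_degree)
    then obtain x where "poly c x = 0" using alg_closed_imp_poly_has_root by blast
    thus False using assms(2)[of x] c by (auto elim!: dvdE)
  qed
qed

context ramified_reduction
begin

text \<open>This carries a relation at one z to every conjugate z': after reduction modulo the
  cyclotomic polynomial the rational coefficients themselves are zero by
  \<open>powers_independent\<close>, so each b j is divisible by that polynomial.\<close>

lemma coefficients_vanish:
  assumes z: "z \<in> prim_roots (k * q)" and \<theta>: "A z \<theta> = 0"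
    and zero: "(\<Sum>j<d. evc z (b j) * \<theta> ^ j) = 0" and j: "j < d" and z': "z' \<in> prim_roots (k * q)"
  shows "evc z' (b j) = 0"
proof -
  let ?\<phi> = "card (prim_roots (k * q))"
  define r where "r j = b j mod cyclotomic (k * q)" for j
  have \<phi>0: "?\<phi> > 0" using z finite_prim_roots[OF n_pos] by (auto simp: card_gt_0_iff)
  have c0: "cyclotomic (k * q) \<noteq> 0" using monic_nonzero[OF degree_cyclotomic(2)[OF n_pos]] .
  have deg: "degree (r j) < ?\<phi>" for j
    using degree_mod_less[OF c0, of "b j"] \<phi>0 degree_cyclotomic(1)[OF n_pos] by (auto simp: r_def)
  have ev: "evc x (b j) = (\<Sum>i<?\<phi>. of_rat (Polynomial.coeff (r j) i) * x ^ i)" if "x \<in> prim_roots (k * q)" for x j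
    using evc_mod_cyclotomic[OF n_pos that, of "b j"] evc_sum[OF deg, of x] by (simp add: r_def)
  have "(\<Sum>(i, j)\<in>{..<?\<phi>} \<times> {..<d}. of_rat (Polynomial.coeff (r j) i) * (z ^ i * \<theta> ^ j))
    = (\<Sum>i<?\<phi>. \<Sum>j<d. of_rat (Polynomial.coeff (r j) i) * (z ^ i * \<theta> ^ j))"
    by (rule sum.cartesian_product[symmetric])
  also have "\<dots> = (\<Sum>j<d. \<Sum>i<?\<phi>. of_rat (Polynomial.coeff (r j) i) * (z ^ i * \<theta> ^ j))" by (rule sum.swap)
  also have "\<dots> = (\<Sum>j<d. evc z (b j) * \<theta> ^ j)"
    unfolding ev[OF z] by (simp add: sum_distrib_right mult.assoc)
  finally have "(\<Sum>(i, j)\<in>{..<?\<phi>} \<times> {..<d}. of_rat (Polynomial.coeff (r j) i) * (z ^ i * \<theta> ^ j)) = 0"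
    using zero by simp
  from powers_independent[OF z \<theta> this _ j] have "Polynomial.coeff (r j) i = 0" if "i < ?\<phi>" for i using that by blast
  thus ?thesis unfolding ev[OF z'] by simp
qed

text \<open>A as an element of Q[x][C]. The inner variable is now x, so \<open>evx\<close>, written
  for Q[c][x], here specialises x to a root of unity and leaves a polynomial in C.\<close>

definition AA :: "rat poly poly" where
  "AA = Polynomial.monom 1 d + (\<Sum>j<d. Polynomial.monom (map_poly of_int (a j)) j)"

lemma coeff_AA: "Polynomial.coeff AA j = (if j = d then 1 else if j < d then map_poly of_int (a j) else 0)"
  by (auto simp: AA_def coeff_sum)

lemma AA_monic: "degree AA = d" "lead_coeff AA = 1"
proof -
  show "degree AA = d" by (intro antisym degree_le le_degree) (auto simp: coeff_AA)
  thus "lead_coeff AA = 1" by (simp add: coeff_AA)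
qed

lemma evc_of_int_poly: "evc z (map_poly of_int p) = poly (map_poly of_int p) z"
  by (simp add: evc_def map_poly_map_poly o_def)

lemma poly_evx_AA: "poly (evx z AA) C = A z C"
proof -
  have "poly (evx z AA) C = (\<Sum>j\<le>d. evc z (Polynomial.coeff AA j) * C ^ j)"
    by (simp add: poly_altdef evx_monic[OF AA_monic(2)] AA_monic(1) coeff_evx)
  also have "\<dots> = C ^ d + (\<Sum>j<d. evc z (Polynomial.coeff AA j) * C ^ j)"
    by (simp add: lessThan_Suc_atMost[symmetric] coeff_AA)
  also have "(\<Sum>j<d. evc z (Polynomial.coeff AA j) * C ^ j) = (\<Sum>j<d. poly (map_poly of_int (a j)) z * C ^ j)"
    by (rule sum.cong) (auto simp: coeff_AA evc_of_int_poly)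
  finally show ?thesis by (simp add: monic_in_C_def)
qed

text \<open>The remainder of g on division by the monic \<open>AA\<close> has fewer than d
  coefficients in Q[x] and vanishes at (z, \<theta>), so \<open>coefficients_vanish\<close> makes it
  zero at every primitive root x. Thus g is a multiple of all the A(x, C), which are pairwise
  coprime.\<close>

lemma degree_ge_if_shared_root:
  assumes inj: "\<And>z z'. z \<in> prim_roots (k * q) \<Longrightarrow> z' \<in> prim_roots (k * q) \<Longrightarrow> (\<And>C. A z C = A z' C) \<Longrightarrow> z = z'"
    and g: "g \<noteq> 0" "evc \<theta> g = 0" and z: "z \<in> prim_roots (k * q)" and \<theta>: "A z \<theta> = 0"
  shows "card (prim_roots (k * q)) * d \<le> degree g"
proof -
  let ?R = "prim_roots (k * q)"
  \<comment> \<open>g with coefficients read as constants in x, so that a single division serves all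
    primitive roots at once.\<close>
  define G where "G = map_poly (\<lambda>x. [:x:]) g"
  have evG: "evx x G = map_poly of_rat g" for x
    by (simp add: G_def evx_def map_poly_map_poly o_def evc_const)
  obtain Q R where QR: "pseudo_divmod G AA = (Q, R)" by force
  have AA0: "AA \<noteq> 0" by (rule monic_nonzero[OF AA_monic(2)])
  from pseudo_divmod[OF AA0 QR] AA_monic have GQ: "G = AA * Q + R" and R: "R = 0 \<or> degree R < d" by auto
  have coeffR: "Polynomial.coeff R j = 0" if "j \<ge> d" for j using R that by (auto simp: coeff_eq_0)
  have evR: "evx x G = evx x AA * evx x Q + evx x R" for x unfolding GQ by (simp only: evx.hom_add evx.hom_mult)
  have "poly (evx z R) \<theta> = 0"
    using arg_cong[OF evR[of z], of "\<lambda>p. poly p \<theta>"] g(2) by (simp add: evG poly_evx_AA \<theta> evc_def)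
  moreover have "poly (evx z R) \<theta> = (\<Sum>j<d. evc z (Polynomial.coeff R j) * \<theta> ^ j)"
  proof -
    have "poly (evx z R) \<theta> = (\<Sum>j\<le>degree (evx z R). evc z (Polynomial.coeff R j) * \<theta> ^ j)"
      by (simp add: poly_altdef coeff_evx)
    also have "\<dots> = (\<Sum>j<d. evc z (Polynomial.coeff R j) * \<theta> ^ j)"
    proof (rule sum.mono_neutral_cong)
      fix j assume "j \<in> {..<d} - {..degree (evx z R)}"
      hence "Polynomial.coeff (evx z R) j = 0" by (intro coeff_eq_0) simp
      thus "evc z (Polynomial.coeff R j) * \<theta> ^ j = 0" by (simp add: coeff_evx)
    next
      fix j assume "j \<in> {..degree (evx z R)} - {..<d}"
      thus "evc z (Polynomial.coeff R j) * \<theta> ^ j = 0" using coeffR[of j] by simp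
    qed auto
    finally show ?thesis .
  qed
  ultimately have "(\<Sum>j<d. evc z (Polynomial.coeff R j) * \<theta> ^ j) = 0" by simp
  note van = coefficients_vanish[OF z \<theta> this]
  have dvd: "evx x AA dvd map_poly of_rat g" if x: "x \<in> ?R" for x
  proof -
    have "Polynomial.coeff (evx x R) j = 0" for j
      using van[OF _ x, of j] coeffR[of j] by (cases "j < d") (simp_all add: coeff_evx)
    hence "evx x R = 0" by (intro poly_eqI) simp
    thus ?thesis using evR[of x] unfolding evG by simp
  qed
  have mon: "degree (evx x AA) = d" "lead_coeff (evx x AA) = 1" for x
    using evx_monic[OF AA_monic(2), of x] AA_monic by auto
  have cop: "coprime (evx x AA) (evx y AA)" if xy: "x \<in> ?R" "y \<in> ?R" "x \<noteq> y" for x y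
  proof (rule coprime_if_no_common_root)
    show "evx x AA \<noteq> 0" by (rule monic_nonzero[OF mon(2)])
    fix t assume "poly (evx x AA) t = 0" "poly (evx y AA) t = 0"
    hence t: "A x t = 0" "A y t = 0" by (simp_all add: poly_evx_AA)
    obtain i where i: "y = x ^ i" using prim_root_generates[OF n_pos xy(1) prim_root_power_one[OF xy(2)]] .
    \<comment> \<open>Writing y = x^i turns A(x, t) - A(y, t) = 0 into a relation at the single root
      x, with b j = a_j(x) - a_j(x^i), to which \<open>coefficients_vanish\<close> applies.\<close>
    define b :: "nat \<Rightarrow> rat poly" where
      "b j = map_poly of_int (a j) - pcompose (map_poly of_int (a j)) (Polynomial.monom 1 i)" for j
    have evb: "evc x (b j) = poly (map_poly of_int (a j)) x - poly (map_poly of_int (a j)) y" for j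
    proof -
      have "evc x (pcompose p (Polynomial.monom 1 i)) = evc y p" for p
        by (simp add: evc_def of_rat_hom.map_poly_pcompose poly_pcompose hom_distribs poly_monom i)
      thus ?thesis by (simp add: b_def evc.hom_minus evc_of_int_poly)
    qed
    have "(\<Sum>j<d. evc x (b j) * t ^ j) = A x t - A y t"
      by (simp add: evb monic_in_C_def sum_subtractf left_diff_distrib)
    hence "(\<Sum>j<d. evc x (b j) * t ^ j) = 0" using t by simp
    from coefficients_vanish[OF xy(1) t(1) this _ xy(1)]
    have "poly (map_poly of_int (a j)) x = (poly (map_poly of_int (a j)) y :: complex)" if "j < d" for j
      using evb[of j] that by simp
    hence "A x C = A y C" for C unfolding monic_in_C_def by simp
    from inj[OF xy(1,2) this] xy(3) show False by simp
  qed
  have "(\<Prod>x\<in>?R. evx x AA) dvd map_poly of_rat g"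
    by (rule prod_dvd_if_pairwise_coprime) (use dvd cop in auto)
  hence "degree (\<Prod>x\<in>?R. evx x AA) \<le> degree (map_poly of_rat g :: complex poly)"
    by (rule dvd_imp_degree_le) (use g in simp)
  moreover have "degree (\<Prod>x\<in>?R. evx x AA) = card ?R * d"
    by (subst degree_prod_eq_sum_degree) (use mon monic_nonzero[OF mon(2)] in auto)
  ultimately show ?thesis by simp
qed

end

text \<open>The degrees of both arguments survive specialisation of c, since one has constant
  coefficients and the other is monic in x; so the resultant may be specialised and expanded over
  the primitive roots.\<close>

lemma evc_Delta:
  assumes m: "m > 0" and K: "K > 0"
  shows "evc c (Delta (m * K) m) = (\<Prod>z\<in>prim_roots K. poly (evx c (delta m)) z)"
proof -
  let ?L = "map_poly (\<lambda>a. [:a:]) (cyclotomic K)"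
  have L: "map_poly (evc c) ?L = root_prod (mset_set (prim_roots K))"
    unfolding root_prod_mset_set cyclotomic_complex[OF K, symmetric]
    by (simp add: map_poly_map_poly o_def evc_const)
  have "degree (map_poly (evc c) ?L) = card (prim_roots K)"
    unfolding L degree_root_prod by simp
  moreover have "degree ?L = card (prim_roots K)"
    using degree_cyclotomic(1)[OF K] by (simp add: degree_map_poly)
  ultimately have d1: "degree (map_poly (evc c) ?L) = degree ?L" by simp
  have d2: "degree (map_poly (evc c) (delta m)) = degree (delta m)"
    using evx_monic(2)[OF delta_props(1)[OF m], of c] by (simp add: evx_def)
  have "evc c (Delta (m * K) m) = resultant (root_prod (mset_set (prim_roots K))) (evx c (delta m))"
    using m by (simp add: Delta_def evc.resultant_map_poly[OF d1 d2, symmetric] L evx_def)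
  thus ?thesis by (simp add: resultant_root_prod prod_unfold_prod_mset)
qed

lemma evc_scale: "evc C (pcompose p [:0, 1/4:]) = evc (C / 4) p"
  by (simp add: evc_def of_rat_hom.map_poly_pcompose poly_pcompose of_rat_divide)

theorem theorem1p3:
  fixes m k e :: nat and P :: "int poly"
  assumes "m \<ge> 1" and "k \<ge> 2" and "e \<ge> 1"
    and "\<not> CARD('p::prime_card) dvd k"
    and "map_poly rat_of_int P = Delta_tilde (m * k) m"
    and "irreducible (map_poly of_int P :: 'p mod_ring poly)"
  shows "irreducible (Delta (m * k * CARD('p) ^ e) m)"
proof -
  have m: "m > 0" and k: "k > 1" and e: "e > 0" using assms by auto
  obtain s d a where s: "s = 1 \<or> s = (-1 :: int)" and d: "2 * d = m * degree (delta m)"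
    and nf: "\<And>x C. poly (evx (C / 4) (delta m)) x = of_int s * monic_in_C a d x C"
    by (rule delta_normal_form[OF m, folded monic_in_C_def]) (rule that)
  have tilde: "evc C (Delta_tilde (m * K) m) = of_int s ^ card (prim_roots K) * (\<Prod>z\<in>prim_roots K. monic_in_C a d z C)"
    if "K > 0" for K C
    unfolding Delta_tilde_def evc_scale evc_Delta[OF m that] nf by (simp add: prod.distrib)
  have s0: "s \<noteq> 0" using s by auto
  define S where "S = s ^ card (prim_roots k)"
  have S: "S = 1 \<or> S = -1" using s unfolding S_def by (cases "even (card (prim_roots k))") auto
  have Pev: "poly (map_poly of_int P) C = of_int S * (\<Prod>z\<in>prim_roots k. monic_in_C a d z C)" for C :: complex
  proof -
    have "poly (map_poly of_int P) C = evc C (map_poly rat_of_int P)"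
      by (simp add: evc_def map_poly_map_poly o_def)
    thus ?thesis using tilde[of k C] k assms(5) by (simp add: S_def)
  qed
  \<comment> \<open>A(z, .) as a polynomial in C, from which the degrees and leading coefficients of
    P and of Delta are read off.\<close>
  define B where "B z = Polynomial.monom 1 d + (\<Sum>j<d. Polynomial.monom (poly (map_poly of_int (a j)) z) j)" for z :: complex
  have polyB: "poly (B z) C = monic_in_C a d z C" for z C
    by (simp add: B_def monic_in_C_def poly_monom poly_sum)
  have cB: "Polynomial.coeff (B z) j = (if j = d then 1 else if j < d then poly (map_poly of_int (a j)) z else 0)" for z j
    by (auto simp: B_def coeff_sum)
  have degB: "degree (B z) = d" for z by (intro antisym degree_le le_degree) (auto simp: cB)
  have leadB: "lead_coeff (B z) = 1" for z unfolding degB by (simp add: cB)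
  have prodB: "degree (\<Prod>z\<in>Z. B z) = card Z * d" "lead_coeff (\<Prod>z\<in>Z. B z) = 1" for Z
  proof -
    show "degree (\<Prod>z\<in>Z. B z) = card Z * d"
      by (subst degree_prod_eq_sum_degree) (use degB monic_nonzero[OF leadB] in auto)
    show "lead_coeff (\<Prod>z\<in>Z. B z) = 1" unfolding lead_coeff_prod using leadB by (intro prod.neutral) blast
  qed
  have PB: "map_poly of_int P = Polynomial.smult (of_int S :: complex) (\<Prod>z\<in>prim_roots k. B z)"
    by (simp add: poly_eq_poly_eq_iff[symmetric] fun_eq_iff Pev poly_prod polyB)
  have "degree (map_poly of_int P :: complex poly) = card (prim_roots k) * d"
    unfolding PB using S prodB by auto
  hence degP: "degree P = card (prim_roots k) * d" by simp
  have "lead_coeff (map_poly of_int P :: complex poly) = of_int S"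
    unfolding PB lead_coeff_smult using prodB(2)[of "prim_roots k"] by simp
  hence "of_int (lead_coeff P) = (of_int S :: complex)" by simp
  hence "lead_coeff P = S" by (simp only: of_int_eq_iff)
  \<comment> \<open>The leading coefficient of P is 1 or -1, so the degree does not drop mod
    p.\<close>
  hence "(of_int (lead_coeff P) :: 'p mod_ring) \<noteq> 0" using S by auto
  hence degP': "degree (map_poly of_int P :: 'p mod_ring poly) = degree P" by (intro degree_map_poly) auto
  interpret ramified_reduction k e d a P "of_int S" "TYPE('p)"
    by unfold_locales (fact assms(6) degP' degP algebraic_int_of_int Pev k assms(4) e)+
  let ?\<Delta> = "Delta (m * k * CARD('p) ^ e) m"
  have nq: "m * k * CARD('p) ^ e = m * (k * q)" by (simp add: q_def mult.assoc)
  let ?scale = "\<lambda>f :: rat poly. pcompose f [:0, 1/4:]"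
  have degs: "degree (?scale f) = degree f" for f by (simp add: degree_pcompose)
  have ev\<Delta>: "evc C (?scale ?\<Delta>) = of_int s ^ card (prim_roots (k * q)) * (\<Prod>z\<in>prim_roots (k * q). monic_in_C a d z C)" for C
    using tilde[OF n_pos, of C] by (simp add: Delta_tilde_def nq)
  have "map_poly of_rat (?scale ?\<Delta>) = Polynomial.smult (of_int s ^ card (prim_roots (k * q)) :: complex) (\<Prod>z\<in>prim_roots (k * q). B z)"
    using ev\<Delta> by (simp add: poly_eq_poly_eq_iff[symmetric] fun_eq_iff poly_prod polyB evc_def)
  from arg_cong[OF this, of degree] have deg\<Delta>: "degree ?\<Delta> = card (prim_roots (k * q)) * d"
    using s0 prodB(1) degs by simp
  have pos: "degree ?\<Delta> > 0"
    using prim_root_exists[OF n_pos] finite_prim_roots[OF n_pos] d_pos by (simp add: deg\<Delta> card_gt_0_iff)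
  \<comment> \<open>Only C = 0 is inspected; k > 1 keeps z away from 1, the exceptional point of
    \<open>delta_at_0_inj\<close>.\<close>
  have inj: "z = z'" if z: "z \<in> prim_roots (k * q)" "z' \<in> prim_roots (k * q)" and eq: "\<And>C. A z C = A z' C" for z z'
  proof (rule delta_at_0_inj[OF m])
    show "degree (delta m) > 0" using d d_pos by (intro Nat.gr0I) simp
    show "norm z = 1" "norm z' = 1" using norm_root_of_unity[OF prim_root_power_one n_pos] z by blast+
    have "k * q \<noteq> 1" using k by simp
    thus "z \<noteq> 1" using prim_roots_iff[OF z(1), of 1] by simp
    show "poly (evx 0 (delta m)) z = poly (evx 0 (delta m)) z'" using nf[of 0] eq[of 0] by simp
  qed
  \<comment> \<open>A nonconstant factor u has a complex root, shared with some A(z, C), so u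
    already has the full degree. Working with C in place of c changes neither degrees nor
    factorizations.\<close>
  have half: "degree v = 0" if uv: "?\<Delta> = u * v" and u: "degree u > 0" for u v
  proof -
    have nz: "u \<noteq> 0" "v \<noteq> 0" using uv pos by auto
    have "degree (map_poly of_rat (?scale u) :: complex poly) > 0" using u degs by simp
    then obtain t where t: "evc t (?scale u) = 0" unfolding evc_def using alg_closed_imp_poly_has_root by blast
    have "evc t (?scale ?\<Delta>) = evc t (?scale u) * evc t (?scale v)"
      unfolding uv pcompose_mult evc.hom_mult ..
    hence "(\<Prod>z\<in>prim_roots (k * q). monic_in_C a d z t) = 0" using t s0 unfolding ev\<Delta> by auto
    then obtain z where z: "z \<in> prim_roots (k * q)" "A z t = 0" using finite_prim_roots[OF n_pos] by auto
    have "?scale u \<noteq> 0" using u degs[of u] by (metis degree_0 less_numeral_extra(3))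
    have "card (prim_roots (k * q)) * d \<le> degree (?scale u)"
      by (rule degree_ge_if_shared_root[OF _ \<open>?scale u \<noteq> 0\<close> t z]) (rule inj)
    hence "degree ?\<Delta> \<le> degree u" unfolding deg\<Delta> degs .
    moreover have "degree ?\<Delta> = degree u + degree v" unfolding uv by (rule degree_mult_eq[OF nz])
    ultimately show ?thesis by simp
  qed
  show ?thesis
  proof (rule irreducibleI)
    show "?\<Delta> \<noteq> 0" using pos by auto
    show "\<not> ?\<Delta> dvd 1" using pos by (auto simp: is_unit_iff_degree)
    fix u v assume uv: "?\<Delta> = u * v"
    have "u \<noteq> 0" "v \<noteq> 0" using uv pos by auto
    thus "u dvd 1 \<or> v dvd 1" using half[OF uv] by (auto simp: is_unit_iff_degree)
  qed
qed

end
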